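(* Let $k$ be a field. (i) (Projective dimension $1$.) Let $S=k[x]$ and let $\underline{d},\overline{d}\in\mathbb N^{2}$ be degree sequences with $\underline{d}_i\le\overline{d}_i$ for $i=0,1$. Then $B_{\mathbb N}(\underline d,\overline d)=B_{\mathrm{mod}}(\underline d,\overline d)$. (ii) (Projective dimension $2$ level modules.) Let $S=k[x,y]$ and let $\underline{d},\overline{d}\in\mathbb N^{3}$ be degree sequences with $\underline{d}_i\le\overline{d}_i$ for $i=0,1,2$ and with $\underline{d}_0=\overline{d}_0$ and $\underline{d}_2=\overline{d}_2$. Then $B_{\mathbb N}(\underline d,\overline d)=B_{\mathrm{mod}}(\underline d,\overline d)$.
   Context: $S$ has the standard grading. For a finitely generated graded $S$-module $M$ with minimal graded free resolution with terms $F_i=\bigoplus_j S(-j)^{\beta_{i,j}(M)}$, the Betti diagram $\beta(M)$ is the vector with coordinates $\beta_{i,j}(M)$ in $\bigoplus_{j\in\mathbb Z}\bigoplus_{i=0}^p\mathbb Q$. A degree sequence is a sequence $d=(d_0,\dots,d_p)\in\mathbb N^{p+1}$ with $d_i<d_{i+1}$ for all $i$. Given degree sequences $\underline d,\overline d\in\mathbb N^{p+1}$ with $\underline d_i\le\overline d_i$ for all $i$, let $\mathcal Z$ be the semigroup (under direct sum) of finitely generated graded $S$-modules $M$ of projective dimension $\le p$ such that $\beta_{i,j}(M)\neq 0$ only if $i\le p$ and $\underline{d}_i\le j\le\overline{d}_i$. The semigroup of Betti diagrams is $B_{\mathrm{mod}}(\underline d,\overline d)=\{\beta(M): M\in\mathcal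 Z\}$. The cone of Betti diagrams $B_{\mathbb Q}(\underline d,\overline d)$ is the positive rational cone spanned by $B_{\mathrm{mod}}(\underline d,\overline d)$. The semigroup of virtual Betti diagrams $B_{\mathbb N}(\underline d,\overline d)$ is the semigroup of lattice points (vectors with integer coordinates) in $B_{\mathbb Q}(\underline d,\overline d)$. *)

theory Defs
  imports
    "HOL-Algebra.Algebra"
    "HOL-Algebra.Algebraic_Closure_Type"
    "HOL-Library.Poly_Mapping"
    "HOL-Library.Extended_Nat"
    "HOL-Library.Numeral_Type"
begin

section \<open>Modules, free modules and projective dimension\<close>

text \<open>The commutative ring given by a type is passed to the locale-based notions
  of HOL-Algebra as the record \<open>ring_of_type_algebra\<close>.\<close>

definition fin_gen :: "('r::comm_ring_1, 'm, 'z) module_scheme \<Rightarrow> bool" where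
  "fin_gen M \<longleftrightarrow> (\<exists>A. finite A \<and> A \<subseteq> carrier M \<and>
     (\<forall>m\<in>carrier M. \<exists>c :: 'm \<Rightarrow> 'r. m = (\<Oplus>\<^bsub>M\<^esub>a\<in>A. c a \<odot>\<^bsub>M\<^esub> a)))"

definition mod_hom ::
  "('r::comm_ring_1, 'm, 'y) module_scheme \<Rightarrow> ('r, 'n, 'z) module_scheme \<Rightarrow> ('m \<Rightarrow> 'n) set" where
  "mod_hom M N = {f \<in> carrier M \<rightarrow> carrier N.
     (\<forall>x\<in>carrier M. \<forall>y\<in>carrier M. f (x \<oplus>\<^bsub>M\<^esub> y) = f x \<oplus>\<^bsub>N\<^esub> f y) \<and>
     (\<forall>r. \<forall>x\<in>carrier M. f (r \<odot>\<^bsub>M\<^esub> x) = r \<odot>\<^bsub>N\<^esub> f x)}"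

definition mod_ker ::
  "('r, 'm, 'y) module_scheme \<Rightarrow> ('r, 'n, 'z) module_scheme \<Rightarrow> ('m \<Rightarrow> 'n) \<Rightarrow> 'm set" where
  "mod_ker M N f = {x \<in> carrier M. f x = \<zero>\<^bsub>N\<^esub>}"

text \<open>The free module with basis indexed by \<open>B\<close>. The ring multiplication and unit of the
  record play no role for modules.\<close>

definition free_module :: "'b set \<Rightarrow> ('r::comm_ring_1, 'b \<Rightarrow> 'r) module" where
  "free_module B =
    \<lparr>carrier = {f. finite {e. f e \<noteq> 0} \<and> {e. f e \<noteq> 0} \<subseteq> B},
     monoid.mult = undefined, monoid.one = undefined,
     ring.zero = (\<lambda>_. 0), ring.add = (\<lambda>f g e. f e + g e),
     module.smult = (\<lambda>r f e. r * f e)\<rparr>"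

text \<open>\<open>resolves P \<phi> \<epsilon> M\<close>: the sequence
  \<open>\<dots> \<rightarrow> P 2 \<rightarrow> P 1 \<rightarrow> P 0 \<rightarrow> M \<rightarrow> 0\<close> of homomorphisms
  \<open>\<phi> i : P (i + 1) \<rightarrow> P i\<close> and \<open>\<epsilon> : P 0 \<rightarrow> M\<close> is exact.\<close>

definition resolves ::
  "(nat \<Rightarrow> ('r::comm_ring_1, 'p, 'y) module_scheme) \<Rightarrow> (nat \<Rightarrow> 'p \<Rightarrow> 'p) \<Rightarrow> ('p \<Rightarrow> 'm) \<Rightarrow>
   ('r, 'm, 'z) module_scheme \<Rightarrow> bool" where
  "resolves P \<phi> \<epsilon> M \<longleftrightarrow>
     (\<forall>i. \<phi> i \<in> mod_hom (P (Suc i)) (P i)) \<and> \<epsilon> \<in> mod_hom (P 0) M \<and>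
     \<epsilon> ` carrier (P 0) = carrier M \<and>
     mod_ker (P 0) M \<epsilon> = \<phi> 0 ` carrier (P 1) \<and>
     (\<forall>i. mod_ker (P (Suc i)) (P i) (\<phi> i) = \<phi> (Suc i) ` carrier (P (Suc (Suc i))))"

text \<open>Projective means: a direct summand of a free module. A free module of countable rank is
  general enough for the finitely generated modules considered here; the index type
  \<open>int \<times> nat\<close> is the one of the graded free modules below.\<close>

definition projective :: "('r::comm_ring_1, 'p, 'z) module_scheme \<Rightarrow> bool" where
  "projective P \<longleftrightarrow> module ring_of_type_algebra P \<and>
     (\<exists>B :: (int \<times> nat) set.
        \<exists>\<iota> \<in> mod_hom P (free_module B). \<exists>\<pi> \<in> mod_hom (free_module B) P.
          \<forall>x\<in>carrier P. \<pi> (\<iota> x) = x)"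

definition has_projective_resolution ::
  "('r::comm_ring_1, 'm, 'z) module_scheme \<Rightarrow> nat \<Rightarrow> bool" where
  "has_projective_resolution M n \<longleftrightarrow>
     (\<exists>(P :: nat \<Rightarrow> ('r, int \<times> nat \<Rightarrow> 'r) module) \<phi> \<epsilon>.
        (\<forall>i. projective (P i)) \<and> (\<forall>i>n. carrier (P i) = {\<zero>\<^bsub>P i\<^esub>}) \<and> resolves P \<phi> \<epsilon> M)"

definition proj_dim :: "('r::comm_ring_1, 'm, 'z) module_scheme \<Rightarrow> enat" where
  "proj_dim M = (INF n\<in>{n. has_projective_resolution M n}. enat n)"

section \<open>Graded modules over the polynomial ring\<close>

text \<open>Polynomials over \<open>'k\<close> in variables indexed by the finite type \<open>'v\<close>.\<close>

type_synonym ('k, 'v) mpol = "('v \<Rightarrow>\<^sub>0 nat) \<Rightarrow>\<^sub>0 'k"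

text \<open>The homogeneous component \<open>S\<^sub>d\<close> of the standard grading; it is zero for \<open>d < 0\<close>.\<close>

definition homog_polys :: "int \<Rightarrow> ('k::field, 'v::finite) mpol set" where
  "homog_polys d = {s. \<forall>m. Poly_Mapping.lookup s m \<noteq> 0 \<longrightarrow>
     int (\<Sum>v\<in>UNIV. Poly_Mapping.lookup m v) = d}"

text \<open>The homogeneous maximal ideal: the polynomials without constant term.\<close>

definition irrelevant_ideal :: "('k::field, 'v::finite) mpol set" where
  "irrelevant_ideal = {s. Poly_Mapping.lookup s 0 = 0}"

record ('r, 'm) graded_module = "('r, 'm) module" +
  component :: "int \<Rightarrow> 'm set"

definition is_graded_module :: "(('k::field, 'v::finite) mpol, 'm) graded_module \<Rightarrow> bool" where
  "is_graded_module M \<longleftrightarrow>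
     module ring_of_type_algebra M \<and>
     (\<forall>j. subgroup (component M j) (add_monoid M)) \<and>
     (\<forall>d j. \<forall>s\<in>homog_polys d. \<forall>m\<in>component M j. s \<odot>\<^bsub>M\<^esub> m \<in> component M (j + d)) \<and>
     (\<forall>m\<in>carrier M. \<exists>!c. (\<forall>j. c j \<in> component M j) \<and> finite {j. c j \<noteq> \<zero>\<^bsub>M\<^esub>} \<and>
        m = (\<Oplus>\<^bsub>M\<^esub>j\<in>{j. c j \<noteq> \<zero>\<^bsub>M\<^esub>}. c j))"

definition graded_hom ::
  "(('k::field, 'v::finite) mpol, 'm) graded_module \<Rightarrow>
   (('k, 'v) mpol, 'n) graded_module \<Rightarrow> ('m \<Rightarrow> 'n) set" where
  "graded_hom M N = {f \<in> mod_hom M N. \<forall>j. f ` component M j \<subseteq> component N j}"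

text \<open>\<open>graded_free b\<close> is \<open>\<Oplus>\<^sub>j S(-j)\<^bsup>b j\<^esup>\<close>. Its basis elements \<open>(j, l)\<close> with \<open>l < b j\<close>
  have degree \<open>j\<close>, so an element is homogeneous of degree \<open>t\<close> if and only if its coordinate at
  \<open>(j, l)\<close> lies in \<open>S(-j)\<^sub>t = S\<^bsub>t-j\<^esub>\<close>.\<close>

definition graded_free ::
  "(int \<Rightarrow> nat) \<Rightarrow> (('k::field, 'v::finite) mpol, int \<times> nat \<Rightarrow> ('k, 'v) mpol) graded_module" where
  "graded_free b = module.extend (free_module {(j, l). l < b j})
     \<lparr>component = (\<lambda>t. {f \<in> carrier (free_module {(j, l). l < b j}).
        \<forall>j l. f (j, l) \<in> homog_polys (t - j)})\<rparr>"

section \<open>Betti diagrams\<close>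

text \<open>\<open>has_betti_numbers M b\<close>: the module \<open>M\<close> has a minimal graded free resolution whose
  \<open>i\<close>-th term is \<open>\<Oplus>\<^sub>j S(-j)\<^bsup>b i j\<^esup>\<close>. A finitely generated graded module has a
  minimal graded free resolution, unique up to isomorphism, so \<open>b\<close> is determined by \<open>M\<close>.\<close>

definition has_betti_numbers ::
  "(('k::field, 'v::finite) mpol, 'm) graded_module \<Rightarrow> (nat \<Rightarrow> int \<Rightarrow> nat) \<Rightarrow> bool" where
  "has_betti_numbers M b \<longleftrightarrow>
     (\<forall>i. finite {j. b i j \<noteq> 0}) \<and>
     (\<exists>\<phi> \<epsilon>. resolves (\<lambda>i. graded_free (b i)) \<phi> \<epsilon> M \<and>
        \<epsilon> \<in> graded_hom (graded_free (b 0)) M \<and>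
        (\<forall>i. \<phi> i \<in> graded_hom (graded_free (b (Suc i))) (graded_free (b i))) \<and>
        (\<forall>i. \<forall>x\<in>carrier (graded_free (b (Suc i)) ::
                (('k, 'v) mpol, int \<times> nat \<Rightarrow> ('k, 'v) mpol) graded_module).
           \<forall>e. \<phi> i x e \<in> irrelevant_ideal))"

text \<open>Only the entries \<open>d 0, \<dots>, d p\<close> of \<open>d\<close> matter here and below.\<close>

definition degree_sequence :: "nat \<Rightarrow> (nat \<Rightarrow> nat) \<Rightarrow> bool" where
  "degree_sequence p d \<longleftrightarrow> (\<forall>i<p. d i < d (Suc i))"

text \<open>A vector in \<open>\<Oplus>\<^sub>j \<Oplus>\<^bsub>i\<le>p\<^esub> \<rat>\<close> is given by its coordinate function; all functions
  occurring below are zero outside a finite set of pairs \<open>(i, j)\<close>. The itself-argument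
  specifies the polynomial ring \<open>S\<close>.

  HOL cannot quantify over modules on all types, so the modules range over carriers
  inside one type. Every finitely generated \<open>S\<close>-module is isomorphic to a quotient of a free module
  of finite rank, whose elements are cosets, that is, sets of elements of the free module.
  Hence the type \<open>(int \<times> nat \<Rightarrow> S) set\<close> contains all of them up to isomorphism.\<close>

definition B_mod ::
  "('k::field, 'v::finite) mpol itself \<Rightarrow> nat \<Rightarrow> (nat \<Rightarrow> nat) \<Rightarrow> (nat \<Rightarrow> nat) \<Rightarrow>
   (nat \<Rightarrow> int \<Rightarrow> rat) set" where
  "B_mod S p dl du = {(\<lambda>i j. of_nat (b i j)) | b.
     \<exists>M :: (('k, 'v) mpol, (int \<times> nat \<Rightarrow> ('k, 'v) mpol) set) graded_module.
       is_graded_module M \<and> fin_gen M \<and> proj_dim M \<le> enat p \<and> has_betti_numbers M b \<and>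
       (\<forall>i j. b i j \<noteq> 0 \<longrightarrow> i \<le> p \<and> int (dl i) \<le> j \<and> j \<le> int (du i))}"

definition rational_cone :: "(nat \<Rightarrow> int \<Rightarrow> rat) set \<Rightarrow> (nat \<Rightarrow> int \<Rightarrow> rat) set" where
  "rational_cone G = {(\<lambda>i j. \<Sum>v\<in>A. c v * v i j) | A c. finite A \<and> A \<subseteq> G \<and> (\<forall>v\<in>A. 0 \<le> c v)}"

definition B_Q ::
  "('k::field, 'v::finite) mpol itself \<Rightarrow> nat \<Rightarrow> (nat \<Rightarrow> nat) \<Rightarrow> (nat \<Rightarrow> nat) \<Rightarrow>
   (nat \<Rightarrow> int \<Rightarrow> rat) set" where
  "B_Q S p dl du = rational_cone (B_mod S p dl du)"

definition B_N ::
  "('k::field, 'v::finite) mpol itself \<Rightarrow> nat \<Rightarrow> (nat \<Rightarrow> nat) \<Rightarrow> (nat \<Rightarrow> nat) \<Rightarrow>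
   (nat \<Rightarrow> int \<Rightarrow> rat) set" where
  "B_N S p dl du = {v \<in> B_Q S p dl du. \<forall>i j. v i j \<in> \<int>}"

end

theory Submission
  imports Defs
begin

text \<open>
  Both parts have the same shape. Some inequalities that are linear in the diagram hold for the Betti
  diagrams of all modules under consideration, hence on the cone that these diagrams span. Conversely, a
  diagram of natural numbers that satisfies the inequalities is the diagram of an explicit
  module, so that every lattice point of the cone is reached.

  In one variable, a minimal resolution is an injection \<open>F\<^sub>1 \<rightarrow> F\<^sub>0\<close> with image in \<open>xF\<^sub>0\<close>. Comparing
  dimensions in degree \<open>t\<close> gives \<open>\<Sum>\<^bsub>j\<le>t\<^esub> \<beta>\<^bsub>1,j\<^esub> \<le> \<Sum>\<^bsub>j<t\<^esub> \<beta>\<^bsub>0,j\<^esub>\<close> (\<open>strand_inequality_one\<close>). Given these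
  inequalities, every generator of \<open>F\<^sub>1\<close> can be matched with a generator of \<open>F\<^sub>0\<close> of its own that has smaller
  degree (\<open>exists_matching\<close>), and a pair of degrees \<open>i < j\<close> is realised by \<open>S(-i)/(x\<^bsup>j-i\<^esup>)\<close>, an unmatched
  generator by \<open>S(-i)\<close>.

  In the level case in two variables, let \<open>F\<^sub>0\<close> be generated in degree \<open>a\<close>, let \<open>F\<^sub>2\<close> be generated in degree \<open>c\<close>, and put
  \<open>m = c - a\<close>. The inequalities are
  \<open>\<Sum>\<^sub>j \<beta>\<^bsub>1,j\<^esub> \<le> \<beta>\<^bsub>0,a\<^esub> + \<beta>\<^bsub>2,c\<^esub>\<close>, as the rank of the module is not negative (\<open>rank_inequality\<close>),
  and \<open>m \<beta>\<^bsub>2,c\<^esub> \<le> \<Sum>\<^sub>j (j - a) \<beta>\<^bsub>1,j\<^esub>\<close> (\<open>degree_inequality\<close>). If the second one failed, counting conditions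
  would give a nonzero element of \<open>F\<^sub>2\<close> of degree \<open>c + m - 1\<close> whose image in \<open>F\<^sub>1\<close> vanishes modulo the regular
  sequence \<open>x\<^sup>m, y\<^sup>m\<close>; since all generators of \<open>F\<^sub>0\<close> have degree \<open>a\<close>, exactness would make the element itself
  vanish modulo \<open>x\<^sup>m, y\<^sup>m\<close>, which is absurd because its coordinates have degree \<open>m - 1\<close>.

  For the converse, lay intervals of the lengths \<open>j - a\<close>, one for each generator of \<open>F\<^sub>1\<close>, end to end on a line, in any
  order. The inequality says that the points \<open>0, m, \<dots>, \<beta>\<^bsub>2,c\<^esub> m\<close> all lie on the union. Each of these points
  selects an interval, the selected intervals are distinct because all lengths are below \<open>m\<close>, and there is one more of
  them than there are generators of \<open>F\<^sub>2\<close>. An interval of length \<open>e\<close> that is not selected becomes a relation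
  \<open>y\<^sup>e g = x\<^sup>e g'\<close> between two neighbouring generators of a chain; an interval that the selecting point divides
  into parts of lengths \<open>v\<close> and \<open>u\<close> becomes a relation \<open>x\<^sup>u y\<^sup>v g = 0\<close> on a single generator. The stretch
  between two consecutive selected intervals is responsible for one syzygy, of degree exactly \<open>a + m = c\<close>. All matrices
  consist of monomials up to sign and respect a grading by pairs of integers, so exactness can be checked
  in one multidegree at a time, where it is elementary linear algebra over the field
  (\<open>multigraded_in_B_mod\<close>, locale \<open>zigzag\<close>).
\<close>

section \<open>Linear systems over a field\<close>

text \<open>The one fact from linear algebra on which all dimension counts rest. The proof is Gaussian elimination: one equation
  is solved for an unknown that occurs in it and removed together with that unknown.\<close>

lemma homogeneous_system_nontrivial:
  fixes A :: "'c \<Rightarrow> 'j \<Rightarrow> 'k::field"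
  assumes "finite K" "finite J" "card K < card J"
  shows "\<exists>z. (\<exists>j\<in>J. z j \<noteq> 0) \<and> (\<forall>j. j \<notin> J \<longrightarrow> z j = 0) \<and>
             (\<forall>c\<in>K. (\<Sum>j\<in>J. A c j * z j) = 0)"
  using assms
proof (induction K arbitrary: J A rule: finite_induct)
  case empty
  then obtain j where "j \<in> J"
    by fastforce
  then show ?case
    by (intro exI[of _ "\<lambda>i. if i = j then 1 else 0"]) auto
next
  case (insert c K)
  show ?case
  proof (cases "\<forall>j\<in>J. A c j = 0")
    case True
    with insert.IH[of J A] insert.prems insert.hyps show ?thesis
      by auto
  next
    case False
    then obtain p where p: "p \<in> J" "A c p \<noteq> 0"
      by auto
    define A' where "A' = (\<lambda>d j. A d j - A d p * A c j / A c p)"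
    have "card K < card (J - {p})"
      using insert.prems insert.hyps p by simp
    then obtain z where z: "\<exists>j\<in>J - {p}. z j \<noteq> 0" "\<And>j. j \<notin> J - {p} \<Longrightarrow> z j = 0"
        "\<And>d. d \<in> K \<Longrightarrow> (\<Sum>j\<in>J - {p}. A' d j * z j) = 0"
      using insert.IH[of "J - {p}" A'] insert.prems by auto
    define y where "y = z(p := - (\<Sum>j\<in>J - {p}. A c j * z j) / A c p)"
    have y_sum: "(\<Sum>j\<in>J. A d j * y j) = A d p * y p + (\<Sum>j\<in>J - {p}. A d j * z j)" for d
      using insert.prems p by (subst sum.remove[of _ p]) (auto simp: y_def intro!: sum.cong)
    have "(\<Sum>j\<in>J. A c j * y j) = 0"
      unfolding y_sum using p by (simp add: y_def)
    moreover have "(\<Sum>j\<in>J. A d j * y j) = 0" if "d \<in> K" for d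
    proof -
      have "(\<Sum>j\<in>J - {p}. A' d j * z j)
          = (\<Sum>j\<in>J - {p}. A d j * z j) - A d p / A c p * (\<Sum>j\<in>J - {p}. A c j * z j)"
        by (simp add: A'_def left_diff_distrib sum_subtractf sum_distrib_left mult.assoc)
      then show ?thesis
        unfolding y_sum using z(3)[OF that] by (simp add: y_def)
    qed
    moreover have "\<exists>j\<in>J. y j \<noteq> 0"
      using z(1) by (auto simp: y_def)
    moreover have "y j = 0" if "j \<notin> J" for j
      using z(2) that p by (auto simp: y_def)
    ultimately show ?thesis
      by auto
  qed
qed

text \<open>For \<open>k\<^sup>I \<rightarrow> k\<^sup>J \<rightarrow> k\<^sup>K\<close> exact in the middle, \<open>|J| \<le> |I| + |K|\<close>. Choose a minimal set \<open>R\<close> of coordinates that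
  detects whether an element of the image vanishes. Minimality gives \<open>|R| \<le> |I|\<close>, and adding the
  coordinates in \<open>R\<close> to the \<open>K\<close> equations leaves only the zero solution.\<close>

lemma card_le_of_exact:
  fixes A :: "'c \<Rightarrow> 'j \<Rightarrow> 'k::field" and B :: "'j \<Rightarrow> 'i \<Rightarrow> 'k"
  assumes fin: "finite I" "finite J" "finite K"
    and exact: "\<And>z. (\<And>j. j \<notin> J \<Longrightarrow> z j = 0) \<Longrightarrow> (\<And>c. c \<in> K \<Longrightarrow> (\<Sum>j\<in>J. A c j * z j) = 0) \<Longrightarrow>
      \<exists>v. \<forall>j\<in>J. z j = (\<Sum>i\<in>I. B j i * v i)"
  shows "card J \<le> card I + card K"
proof -
  define im where "im = (\<lambda>v j. \<Sum>i\<in>I. B j i * v i)"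
\<comment> \<open>\<open>det R\<close>: the coordinates in \<open>R\<close> determine the elements of the image\<close>
  define det where "det = (\<lambda>R. R \<subseteq> J \<and> (\<forall>v. (\<forall>j\<in>R. im v j = 0) \<longrightarrow> (\<forall>j\<in>J. im v j = 0)))"
  have "det J"
    by (auto simp: det_def)
  then obtain R where R: "det R" and R_min: "\<And>R'. det R' \<Longrightarrow> card R \<le> card R'"
    using ex_has_least_nat[of det J card] by auto
  have R_sub: "R \<subseteq> J" and fin_R: "finite R"
    using R fin finite_subset by (auto simp: det_def)
  have "\<exists>v. (\<forall>j\<in>R - {r}. im v j = 0) \<and> im v r \<noteq> 0" if "r \<in> R" for r
  proof -
    have "card (R - {r}) < card R"
      using that fin_R by (rule card_Diff1_less[rotated])
    then have "\<not> det (R - {r})"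
      using R_min leD by blast
    then obtain v where v: "\<forall>j\<in>R - {r}. im v j = 0" "\<not> (\<forall>j\<in>J. im v j = 0)"
      using R_sub by (auto simp: det_def)
    then have "\<not> (\<forall>j\<in>R. im v j = 0)"
      using R unfolding det_def by blast
    with v(1) show ?thesis
      by blast
  qed
  then obtain v where v: "\<And>r j. r \<in> R \<Longrightarrow> j \<in> R \<Longrightarrow> j \<noteq> r \<Longrightarrow> im (v r) j = 0"
      "\<And>r. r \<in> R \<Longrightarrow> im (v r) r \<noteq> 0"
    by (metis Diff_iff singletonD)
  have "card R \<le> card I"
  proof (rule ccontr)
    assume "\<not> card R \<le> card I"
    then obtain y where y: "\<exists>r\<in>R. y r \<noteq> 0" "\<forall>i\<in>I. (\<Sum>r\<in>R. v r i * y r) = 0"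
      using homogeneous_system_nontrivial[of I R "\<lambda>i r. v r i"] fin fin_R by auto
    then obtain s where s: "s \<in> R" "y s \<noteq> 0"
      by auto
    have "(\<Sum>r\<in>R. im (v r) s * y r) = (\<Sum>r\<in>R. \<Sum>i\<in>I. B s i * (v r i * y r))"
      by (simp add: im_def sum_distrib_right mult.assoc)
    also have "\<dots> = (\<Sum>i\<in>I. B s i * (\<Sum>r\<in>R. v r i * y r))"
      by (subst sum.swap) (simp add: sum_distrib_left)
    also have "\<dots> = 0"
      using y(2) by simp
    finally have "im (v s) s * y s + (\<Sum>r\<in>R - {s}. im (v r) s * y r) = 0"
      using s fin_R by (simp add: sum.remove[of R s])
    moreover have "(\<Sum>r\<in>R - {s}. im (v r) s * y r) = 0"
      using s v(1)[of _ s] by (intro sum.neutral) auto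
    ultimately have "im (v s) s * y s = 0"
      by simp
    then show False
      using s v(2) by auto
  qed
  moreover have "card J \<le> card K + card R"
  proof (rule ccontr)
    assume "\<not> card J \<le> card K + card R"
    then have less: "card (K <+> R) < card J"
      using fin fin_R by (simp add: card_Plus)
    obtain z where z: "\<exists>j\<in>J. z j \<noteq> 0" "\<And>j. j \<notin> J \<Longrightarrow> z j = 0"
        "\<And>c. c \<in> K <+> R \<Longrightarrow>
          (\<Sum>j\<in>J. (case c of Inl d \<Rightarrow> A d j | Inr r \<Rightarrow> if j = r then 1 else 0) * z j) = 0"
      using homogeneous_system_nontrivial[OF _ fin(2) less,
          of "\<lambda>c j. case c of Inl d \<Rightarrow> A d j | Inr r \<Rightarrow> if j = r then 1 else 0"] fin fin_R
      by auto
    have "(\<Sum>j\<in>J. A c j * z j) = 0" if "c \<in> K" for c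
      using z(3)[of "Inl c"] that by (simp add: InlI)
    from exact[OF z(2) this] obtain u where u: "\<forall>j\<in>J. z j = im u j"
      by (auto simp: im_def)
    have "z r = 0" if "r \<in> R" for r
      using z(3)[of "Inr r"] that R_sub fin
      by (auto simp: InrI subset_iff if_distrib[of "\<lambda>x. x * _"] cong: if_cong)
    then have "\<forall>j\<in>R. im u j = 0"
      using u R_sub by (metis subsetD)
    then show False
      using R u z(1) by (auto simp: det_def)
  qed
  ultimately show ?thesis
    by simp
qed

section \<open>Monomials and homogeneous polynomials\<close>

definition mdeg :: "('v::finite \<Rightarrow>\<^sub>0 nat) \<Rightarrow> nat" where
  "mdeg m = (\<Sum>v\<in>UNIV. Poly_Mapping.lookup m v)"

lemma mdeg_add: "mdeg (m + m') = mdeg m + mdeg m'"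
  by (simp add: mdeg_def lookup_add sum.distrib)

lemma mdeg_eq_0_iff: "mdeg m = 0 \<longleftrightarrow> m = 0"
proof
  assume "mdeg m = 0"
  then show "m = 0"
    by (intro poly_mapping_eqI) (simp add: mdeg_def)
qed (simp add: mdeg_def)

lemma homog_polys_iff:
  "s \<in> homog_polys d \<longleftrightarrow> (\<forall>m. Poly_Mapping.lookup s m \<noteq> 0 \<longrightarrow> int (mdeg m) = d)"
  by (simp add: homog_polys_def mdeg_def)

text \<open>Multiplication by a monomial shifts coefficients; \<open>k - m\<close> is the quotient monomial when \<open>m\<close> divides \<open>k\<close>.\<close>

lemma lookup_single_times:
  fixes p :: "('v \<Rightarrow>\<^sub>0 nat) \<Rightarrow>\<^sub>0 'k::comm_ring_1"
  shows "Poly_Mapping.lookup (Poly_Mapping.single m c * p) k =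
    (if \<forall>v. Poly_Mapping.lookup m v \<le> Poly_Mapping.lookup k v
     then c * Poly_Mapping.lookup p (k - m) else 0)"
proof -
  have 1: "Poly_Mapping.lookup (Poly_Mapping.single m c * p) k
    = c * Sum_any (\<lambda>q. Poly_Mapping.lookup p q when k = m + q)"
    by (simp add: lookup_mult lookup_single when_mult)
  show ?thesis
  proof (cases "\<forall>v. Poly_Mapping.lookup m v \<le> Poly_Mapping.lookup k v")
    case True
    have "k = m + (k - m)"
      using True by (intro poly_mapping_eqI) (simp add: lookup_add lookup_minus)
    then have "k = m + q \<longleftrightarrow> q = k - m" for q
      by (metis add_diff_cancel_left')
    then show ?thesis
      using True 1 by simp
  next
    case False
    then have "k \<noteq> m + q" for q
      by (auto simp: lookup_add)
    then show ?thesis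
      using False 1 by auto
  qed
qed

lemma homog_polys_mult:
  fixes p q :: "('k::field, 'v::finite) mpol"
  assumes "p \<in> homog_polys d" "q \<in> homog_polys e"
  shows "p * q \<in> homog_polys (d + e)"
  unfolding homog_polys_iff
proof (intro allI impI)
  fix m assume "Poly_Mapping.lookup (p * q) m \<noteq> 0"
  then have "m \<in> Poly_Mapping.keys (p * q)"
    by (simp add: in_keys_iff)
  then obtain a b where "m = a + b" "a \<in> Poly_Mapping.keys p" "b \<in> Poly_Mapping.keys q"
    using keys_mult[of p q] by auto
  then show "int (mdeg m) = d + e"
    using assms by (auto simp: homog_polys_iff in_keys_iff mdeg_add)
qed

lemma homog_polys_0: "0 \<in> homog_polys d"
  by (simp add: homog_polys_iff)

lemma homog_polys_add:
  "p \<in> homog_polys d \<Longrightarrow> q \<in> homog_polys d \<Longrightarrow> p + q \<in> homog_polys d"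
  unfolding homog_polys_iff lookup_add
proof (intro allI impI)
  fix m
  assume hom: "\<forall>m. Poly_Mapping.lookup p m \<noteq> 0 \<longrightarrow> int (mdeg m) = d"
      "\<forall>m. Poly_Mapping.lookup q m \<noteq> 0 \<longrightarrow> int (mdeg m) = d"
    and "Poly_Mapping.lookup p m + Poly_Mapping.lookup q m \<noteq> 0"
  then have "Poly_Mapping.lookup p m \<noteq> 0 \<or> Poly_Mapping.lookup q m \<noteq> 0"
    by auto
  with hom show "int (mdeg m) = d"
    by blast
qed

lemma homog_polys_sum:
  "(\<And>i. i \<in> A \<Longrightarrow> f i \<in> homog_polys d) \<Longrightarrow> sum f A \<in> homog_polys d"
  by (induction A rule: infinite_finite_induct) (auto simp: homog_polys_0 homog_polys_add)

lemma homog_polys_single: "int (mdeg m) = d \<Longrightarrow> Poly_Mapping.single m c \<in> homog_polys d"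
  by (simp add: homog_polys_iff lookup_single when_def)

section \<open>Graded free modules\<close>

abbreviation gens :: "(int \<Rightarrow> nat) \<Rightarrow> (int \<times> nat) set" where
  "gens b \<equiv> {(j, l). l < b j}"

lemma gens_Sigma: "gens b = (SIGMA j:{j. b j \<noteq> 0}. {..<b j})"
  by auto

lemma finite_gens: "finite {j. b j \<noteq> 0} \<Longrightarrow> finite (gens b)"
  by (simp add: gens_Sigma)

lemma sum_gens:
  assumes "finite {j. b j \<noteq> 0}"
  shows "(\<Sum>e\<in>gens b. f (fst e)) = (\<Sum>j\<in>{j. b j \<noteq> 0}. of_nat (b j) * f j)"
  proof -
  have "(\<Sum>e\<in>gens b. f (fst e)) = (\<Sum>j\<in>{j. b j \<noteq> 0}. \<Sum>l<b j. f (fst (j, l)))"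
    unfolding gens_Sigma using assms by (subst sum.Sigma) (auto intro!: sum.cong)
  then show ?thesis
    by simp
qed

lemma free_module_simps:
  "carrier (free_module B) = {f. finite {e. f e \<noteq> 0} \<and> {e. f e \<noteq> 0} \<subseteq> B}"
  "\<zero>\<^bsub>free_module B\<^esub> = (\<lambda>_. 0)"
  "x \<oplus>\<^bsub>free_module B\<^esub> y = (\<lambda>e. x e + y e)"
  "r \<odot>\<^bsub>free_module B\<^esub> x = (\<lambda>e. r * x e)"
  by (simp_all add: free_module_def)

lemma graded_free_simps:
  "carrier (graded_free b) = {f. finite {e. f e \<noteq> 0} \<and> {e. f e \<noteq> 0} \<subseteq> gens b}"
  "\<zero>\<^bsub>graded_free b\<^esub> = (\<lambda>_. 0)"
  "x \<oplus>\<^bsub>graded_free b\<^esub> y = (\<lambda>e. x e + y e)"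
  "r \<odot>\<^bsub>graded_free b\<^esub> x = (\<lambda>e. r * x e)"
  by (simp_all add: graded_free_def module.defs) (simp_all add: free_module_def)

text \<open>With finitely many generators the finiteness of supports is automatic, so only the support condition
  remains to be checked.\<close>

lemma carrier_graded_free:
  assumes "finite {j. b j \<noteq> 0}"
  shows "carrier (graded_free b) =
    {f :: int \<times> nat \<Rightarrow> ('k::field, 'v::finite) mpol. \<forall>e. f e \<noteq> 0 \<longrightarrow> e \<in> gens b}"
  unfolding graded_free_simps(1)
proof (intro Collect_cong iffI allI impI conjI)
  fix f :: "int \<times> nat \<Rightarrow> ('k, 'v) mpol"
  assume "\<forall>e. f e \<noteq> 0 \<longrightarrow> e \<in> gens b"
  then show "{e. f e \<noteq> 0} \<subseteq> gens b"
    by blast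
  then show "finite {e. f e \<noteq> 0}"
    using finite_gens[OF assms] by (rule finite_subset)
qed blast

lemma component_graded_free:
  "component (graded_free b) t = {f \<in> carrier (graded_free b). \<forall>e. f e \<in> homog_polys (t - fst e)}"
  by (auto simp: graded_free_def module.defs free_module_def)

lemma abelian_group_free_module:
  "abelian_group (free_module B :: ('r::comm_ring_1, 'b \<Rightarrow> 'r) module)"
proof (rule abelian_groupI)
  have fin_add: "finite {e. x e + y e \<noteq> 0}" if "finite {e. x e \<noteq> 0}" "finite {e. y e \<noteq> 0}"
    for x y :: "'b \<Rightarrow> 'r"
    by (rule finite_subset[OF _ finite_UnI[OF that]]) auto
  show "x \<oplus>\<^bsub>free_module B\<^esub> y \<in> carrier (free_module B)"
    if "x \<in> carrier (free_module B)" "y \<in> carrier (free_module B)" for x y :: "'b \<Rightarrow> 'r"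
    using that fin_add[of x y] by (auto simp: free_module_simps subset_iff) (metis add.right_neutral)
  show "\<exists>y\<in>carrier (free_module B). y \<oplus>\<^bsub>free_module B\<^esub> x = \<zero>\<^bsub>free_module B\<^esub>"
    if "x \<in> carrier (free_module B)" for x :: "'b \<Rightarrow> 'r"
    using that by (intro bexI[of _ "\<lambda>e. - x e"]) (auto simp: free_module_simps)
qed (simp_all add: free_module_simps algebra_simps)

lemma module_free_module: "module ring_of_type_algebra (free_module B)"
proof (rule moduleI[OF cring_from_type_algebra abelian_group_free_module])
  show "r \<odot>\<^bsub>free_module B\<^esub> x \<in> carrier (free_module B)"
    if "x \<in> carrier (free_module B)" for r x
    using that by (auto simp: free_module_simps intro: rev_finite_subset)
qed (simp_all add: free_module_simps
       ring_of_type_algebra_def distrib_left distrib_right mult.assoc)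

\<comment> \<open>Generators are pairs, but statements quantified over generators are kept in unsplit form.\<close>
declare split_paired_All [simp del] split_paired_Ex [simp del]

section \<open>Homomorphisms of graded free modules\<close>

text \<open>The homogeneous component of degree \<open>d\<close> of a polynomial.\<close>

definition hpart :: "int \<Rightarrow> ('k::field, 'v::finite) mpol \<Rightarrow> ('k, 'v) mpol" where
  "hpart d p = Poly_Mapping.Abs_poly_mapping
     (\<lambda>m. if int (mdeg m) = d then Poly_Mapping.lookup p m else 0)"

lemma lookup_hpart:
  "Poly_Mapping.lookup (hpart d p) m = (if int (mdeg m) = d then Poly_Mapping.lookup p m else 0)"
proof -
  have "finite {m. (if int (mdeg m) = d then Poly_Mapping.lookup p m else 0) \<noteq> 0}"
    by (rule finite_subset[OF _ finite_lookup[of p]]) auto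
  then show ?thesis
    by (simp add: hpart_def)
qed

lemma hpart_homog: "hpart d p \<in> homog_polys d"
  by (simp add: homog_polys_iff lookup_hpart)

lemma hpart_0 [simp]: "hpart d 0 = 0"
  by (rule poly_mapping_eqI) (simp add: lookup_hpart)

lemma hpart_of_homog: "p \<in> homog_polys e \<Longrightarrow> hpart d p = (if d = e then p else 0)"
  by (rule poly_mapping_eqI) (auto simp: lookup_hpart homog_polys_iff)

lemma hpart_sum: "hpart d (sum f A) = (\<Sum>i\<in>A. hpart d (f i))"
  by (rule poly_mapping_eqI) (simp add: lookup_hpart lookup_sum)

lemma sum_hpart:
  assumes "finite T" "\<And>m. Poly_Mapping.lookup p m \<noteq> 0 \<Longrightarrow> int (mdeg m) \<in> T"
  shows "(\<Sum>d\<in>T. hpart d p) = p"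
  using assms by (intro poly_mapping_eqI) (auto simp: lookup_hpart lookup_sum)

text \<open>The homogeneous component of degree \<open>t\<close> of an element of a graded free module: the coordinate at a generator of
  degree \<open>j\<close> contributes in degree \<open>t - j\<close>.\<close>

definition vpart :: "int \<Rightarrow> (int \<times> nat \<Rightarrow> ('k::field, 'v::finite) mpol) \<Rightarrow> int \<times> nat \<Rightarrow> ('k, 'v) mpol"
  where "vpart t x = (\<lambda>e. hpart (t - fst e) (x e))"

lemma graded_free_0: "(\<lambda>_. 0) \<in> carrier (graded_free b)"
  by (simp add: graded_free_simps)

lemma graded_free_add:
  assumes "x \<in> carrier (graded_free b)" "y \<in> carrier (graded_free b)"
  shows "(\<lambda>e. x e + y e) \<in> carrier (graded_free b)"
proof -
  have "{e. x e + y e \<noteq> 0} \<subseteq> {e. x e \<noteq> 0} \<union> {e. y e \<noteq> 0}"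
    by auto
  with assms show ?thesis
    unfolding graded_free_simps mem_Collect_eq by (meson Un_least finite_UnI finite_subset subset_trans)
qed

lemma graded_free_smult:
  assumes "x \<in> carrier (graded_free b)"
  shows "(\<lambda>e. r * x e) \<in> carrier (graded_free b)"
proof -
  have "{e. r * x e \<noteq> 0} \<subseteq> {e. x e \<noteq> 0}"
    by auto
  with assms show ?thesis
    unfolding graded_free_simps mem_Collect_eq by (meson finite_subset subset_trans)
qed

lemma graded_free_sum:
  assumes "\<And>i. i \<in> A \<Longrightarrow> f i \<in> carrier (graded_free b)"
  shows "(\<lambda>e. \<Sum>i\<in>A. f i e) \<in> carrier (graded_free b)"
  using assms
proof (induction A rule: infinite_finite_induct)
  case (insert i A)
  then show ?case
    using graded_free_add[of "f i" b "\<lambda>e. \<Sum>i\<in>A. f i e"] by simp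
qed (simp_all add: graded_free_0)

lemma vpart_component:
  assumes "x \<in> carrier (graded_free b)"
  shows "vpart t x \<in> component (graded_free b) t"
proof -
  have "{e. vpart t x e \<noteq> 0} \<subseteq> {e. x e \<noteq> 0}"
    by (auto simp: vpart_def)
  with assms show ?thesis
    unfolding component_graded_free graded_free_simps mem_Collect_eq
    by (auto simp: vpart_def hpart_homog finite_subset)
qed

lemma vpart_of_component:
  assumes "x \<in> component (graded_free b) s"
  shows "vpart t x = (if t = s then x else (\<lambda>_. 0))"
proof -
  have "x e \<in> homog_polys (s - fst e)" for e
    using assms by (simp add: component_graded_free)
  then have "vpart t x e = (if t = s then x e else 0)" for e
    by (simp add: vpart_def hpart_of_homog[of "x e" "s - fst e"])
  then show ?thesis
    by auto
qed

lemma vpart_sum: "vpart t (\<lambda>e. \<Sum>i\<in>A. f i e) = (\<lambda>e. \<Sum>i\<in>A. vpart t (f i) e)"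
  by (simp add: vpart_def hpart_sum)

lemma sum_vpart:
  assumes "x \<in> carrier (graded_free b)"
  shows "\<exists>T. finite T \<and> (\<forall>t. t \<notin> T \<longrightarrow> vpart t x = (\<lambda>_. 0)) \<and> x = (\<lambda>e. \<Sum>t\<in>T. vpart t x e)"
proof -
  define E where "E = {e. x e \<noteq> 0}"
  define T where "T = (\<Union>e\<in>E. (\<lambda>m. int (mdeg m) + fst e) ` Poly_Mapping.keys (x e))"
  have fin: "finite T"
    using assms by (auto simp: T_def E_def graded_free_simps)
  have in_T: "int (mdeg m) + fst e \<in> T" if "Poly_Mapping.lookup (x e) m \<noteq> 0" for e m
    using that by (force simp: T_def E_def in_keys_iff)
  have "vpart t x e = 0" if "t \<notin> T" for t e
    unfolding vpart_def using that in_T[of e]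
    by (intro poly_mapping_eqI) (force simp: lookup_hpart)
  moreover have "x e = (\<Sum>t\<in>T. vpart t x e)" for e
  proof -
    have "(\<Sum>t\<in>T. vpart t x e) = (\<Sum>d\<in>(\<lambda>t. t - fst e) ` T. hpart d (x e))"
      by (subst sum.reindex) (auto simp: vpart_def inj_on_def)
    also have "\<dots> = x e"
    proof (rule sum_hpart)
      show "int (mdeg m) \<in> (\<lambda>t. t - fst e) ` T" if "Poly_Mapping.lookup (x e) m \<noteq> 0" for m
        using in_T[OF that] by (rule image_eqI[rotated]) simp
    qed (use fin in simp)
    finally show ?thesis ..
  qed
  ultimately show ?thesis
    using fin by blast
qed

lemma mod_hom_closed:
  "f \<in> mod_hom (graded_free b) (graded_free b') \<Longrightarrow> x \<in> carrier (graded_free b) \<Longrightarrow>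
   f x \<in> carrier (graded_free b')"
  by (auto simp: mod_hom_def)

lemma mod_hom_add:
  "f \<in> mod_hom (graded_free b) (graded_free b') \<Longrightarrow> x \<in> carrier (graded_free b) \<Longrightarrow>
   y \<in> carrier (graded_free b) \<Longrightarrow> f (\<lambda>e. x e + y e) = (\<lambda>e. f x e + f y e)"
  by (simp add: mod_hom_def graded_free_simps)

lemma mod_hom_smult:
  "f \<in> mod_hom (graded_free b) (graded_free b') \<Longrightarrow> x \<in> carrier (graded_free b) \<Longrightarrow>
   f (\<lambda>e. r * x e) = (\<lambda>e. r * f x e)"
  by (simp add: mod_hom_def graded_free_simps)

lemma mod_hom_0:
  "f \<in> mod_hom (graded_free b) (graded_free b') \<Longrightarrow> f (\<lambda>_. 0) = (\<lambda>_. 0)"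
  using mod_hom_smult[of f b b' "\<lambda>_. 0" 0] by (simp add: graded_free_0)

lemma mod_hom_sum:
  assumes f: "f \<in> mod_hom (graded_free b) (graded_free b')"
    and x: "\<And>i. i \<in> A \<Longrightarrow> x i \<in> carrier (graded_free b)"
  shows "f (\<lambda>e. \<Sum>i\<in>A. x i e) = (\<lambda>e. \<Sum>i\<in>A. f (x i) e)"
  using x
proof (induction A rule: infinite_finite_induct)
  case (insert i A)
  then show ?case
    using mod_hom_add[OF f, of "x i" "\<lambda>e. \<Sum>i\<in>A. x i e"] graded_free_sum[of A x b] by simp
qed (simp_all add: mod_hom_0[OF f])

lemma graded_hom_D:
  assumes "f \<in> graded_hom (graded_free b) (graded_free b')"
  shows "f \<in> mod_hom (graded_free b) (graded_free b')"
    and "x \<in> component (graded_free b) t \<Longrightarrow> f x \<in> component (graded_free b') t"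
  using assms by (auto simp: graded_hom_def)

lemma component_sub_carrier: "x \<in> component (graded_free b) t \<Longrightarrow> x \<in> carrier (graded_free b)"
  by (simp add: component_graded_free)

text \<open>This is what makes the exactness of a graded complex available degree by degree: the degree \<open>t\<close> part of
  a preimage is again a preimage of the degree \<open>t\<close> part.\<close>

lemma graded_hom_vpart:
  assumes f: "f \<in> graded_hom (graded_free b) (graded_free b')"
    and x: "x \<in> carrier (graded_free b)"
  shows "f (vpart t x) = vpart t (f x)"
proof -
  obtain T where T: "finite T" "\<And>t. t \<notin> T \<Longrightarrow> vpart t x = (\<lambda>_. 0)"
    "x = (\<lambda>e. \<Sum>t\<in>T. vpart t x e)"
    using sum_vpart[OF x] by blast
  have comp: "f (vpart s x) \<in> component (graded_free b') s" for s
    using graded_hom_D(2)[OF f] vpart_component[OF x] by blast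
  have "f x = f (\<lambda>e. \<Sum>t\<in>T. vpart t x e)"
    using T(3) by simp
  also have "\<dots> = (\<lambda>e. \<Sum>s\<in>T. f (vpart s x) e)"
    by (rule mod_hom_sum[OF graded_hom_D(1)[OF f]])
      (use vpart_component[OF x] component_sub_carrier in blast)
  finally have "vpart t (f x) = (\<lambda>e. \<Sum>s\<in>T. vpart t (f (vpart s x)) e)"
    by (simp add: vpart_sum)
  also have "\<dots> = (\<lambda>e. \<Sum>s\<in>T. if t = s then f (vpart t x) e else 0)"
    by (intro ext sum.cong) (auto simp: vpart_of_component[OF comp])
  also have "\<dots> = f (vpart t x)"
  proof (cases "t \<in> T")
    case False
    then have "f (vpart t x) = (\<lambda>_. 0)"
      using T(2) mod_hom_0[OF graded_hom_D(1)[OF f]] by simp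
    then show ?thesis
      using False T(1) by simp
  qed (use T(1) in simp)
  finally show ?thesis ..
qed

section \<open>Strands of graded free modules\<close>

text \<open>The pairs of a generator and a monomial whose product has degree \<open>t\<close>: a \<open>k\<close>-basis of the degree \<open>t\<close>
  component of the free module. Linear algebra over \<open>k\<close> is done in these coordinates.\<close>

definition strand :: "(int \<Rightarrow> nat) \<Rightarrow> int \<Rightarrow> ((int \<times> nat) \<times> ('v::finite \<Rightarrow>\<^sub>0 nat)) set" where
  "strand b t = {(e, m). e \<in> gens b \<and> int (mdeg m) = t - fst e}"

lemma finite_mdeg: "finite {m :: 'v::finite \<Rightarrow>\<^sub>0 nat. int (mdeg m) = d}"
proof -
  have "Poly_Mapping.lookup m v \<le> nat d" if "int (mdeg m) = d" for m and v :: 'v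
  proof -
    have "Poly_Mapping.lookup m v \<le> mdeg m"
      unfolding mdeg_def by (rule member_le_sum) auto
    then show ?thesis
      using that by simp
  qed
  then have "Poly_Mapping.lookup ` {m :: 'v \<Rightarrow>\<^sub>0 nat. int (mdeg m) = d} \<subseteq> (UNIV \<rightarrow>\<^sub>E {..nat d})"
    by (auto simp: PiE_UNIV_domain)
  then have "finite (Poly_Mapping.lookup ` {m :: 'v \<Rightarrow>\<^sub>0 nat. int (mdeg m) = d})"
    by (rule finite_subset) (intro finite_PiE; simp)
  then show ?thesis
    by (rule finite_imageD) (simp add: inj_on_def)
qed

lemma strand_Sigma: "strand b t = (SIGMA e:gens b. {m. int (mdeg m) = t - fst e})"
  by (auto simp: strand_def)

lemma finite_strand: "finite {j. b j \<noteq> 0} \<Longrightarrow> finite (strand b t)"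
  unfolding strand_Sigma using finite_gens finite_mdeg by blast

text \<open>The basis element of the component that belongs to a member of the strand.\<close>

definition mono_vec :: "(int \<times> nat) \<times> ('v \<Rightarrow>\<^sub>0 nat) \<Rightarrow> int \<times> nat \<Rightarrow> ('k::field, 'v::finite) mpol" where
  "mono_vec s = (\<lambda>e. if e = fst s then Poly_Mapping.single (snd s) 1 else 0)"

definition lin_comb ::
  "((int \<times> nat) \<times> ('v \<Rightarrow>\<^sub>0 nat)) set \<Rightarrow> ((int \<times> nat) \<times> ('v \<Rightarrow>\<^sub>0 nat) \<Rightarrow> 'k) \<Rightarrow>
   int \<times> nat \<Rightarrow> ('k::field, 'v::finite) mpol" where
  "lin_comb J z = (\<lambda>e. \<Sum>s\<in>J. Poly_Mapping.single 0 (z s) * mono_vec s e)"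

lemma lookup_const_times:
  "Poly_Mapping.lookup (Poly_Mapping.single 0 c * p) m = c * Poly_Mapping.lookup p m"
  for p :: "('k::field, 'v) mpol"
  by (simp add: lookup_single_times)

lemma lookup_lin_comb:
  assumes "finite J"
  shows "Poly_Mapping.lookup (lin_comb J z e) m = (if (e, m) \<in> J then z (e, m) else 0)"
proof -
  have "Poly_Mapping.lookup (lin_comb J z e) m = (\<Sum>s\<in>J. if s = (e, m) then z s else 0)"
    unfolding lin_comb_def lookup_sum lookup_const_times
    by (intro sum.cong) (auto simp: mono_vec_def lookup_single when_def)
  then show ?thesis
    using assms by simp
qed

lemma mono_vec_carrier: "fst s \<in> gens b \<Longrightarrow> mono_vec s \<in> carrier (graded_free b)"
  by (auto simp: graded_free_simps mono_vec_def)

lemma lin_comb_carrier: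
  assumes "\<And>s. s \<in> J \<Longrightarrow> fst s \<in> gens b"
  shows "lin_comb J z \<in> carrier (graded_free b)"
  unfolding lin_comb_def
  by (intro graded_free_sum graded_free_smult mono_vec_carrier assms)

lemma lookup_hom_lin_comb:
  assumes f: "f \<in> mod_hom (graded_free b) (graded_free b')"
    and J: "\<And>s. s \<in> J \<Longrightarrow> fst s \<in> gens b"
  shows "Poly_Mapping.lookup (f (lin_comb J z) e) m
    = (\<Sum>s\<in>J. Poly_Mapping.lookup (f (mono_vec s) e) m * z s)"
proof -
  have "f (lin_comb J z) = (\<lambda>e. \<Sum>s\<in>J. f (\<lambda>e. Poly_Mapping.single 0 (z s) * mono_vec s e) e)"
    unfolding lin_comb_def
    by (rule mod_hom_sum[OF f]) (intro graded_free_smult mono_vec_carrier J)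
  also have "\<dots> = (\<lambda>e. \<Sum>s\<in>J. Poly_Mapping.single 0 (z s) * f (mono_vec s) e)"
    by (intro ext sum.cong refl) (subst mod_hom_smult[OF f mono_vec_carrier[OF J]]; simp)
  finally show ?thesis
    by (simp add: lookup_sum lookup_const_times mult.commute)
qed

lemma lin_comb_component:
  assumes "\<And>s. s \<in> J \<Longrightarrow> s \<in> strand b t"
  shows "lin_comb J z \<in> component (graded_free b) t"
  unfolding component_graded_free
proof (intro CollectI conjI allI)
  show "lin_comb J z \<in> carrier (graded_free b)"
    by (rule lin_comb_carrier) (use assms in \<open>auto simp: strand_def\<close>)
  show "lin_comb J z e \<in> homog_polys (t - fst e)" for e
    unfolding lin_comb_def
  proof (rule homog_polys_sum)
    fix s assume "s \<in> J"
    then have "int (mdeg (snd s)) = t - fst (fst s)"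
      using assms[of s] by (auto simp: strand_def)
    then show "Poly_Mapping.single 0 (z s) * mono_vec s e \<in> homog_polys (t - fst e)"
      by (auto simp: mono_vec_def homog_polys_0 mult_single homog_polys_single)
  qed
qed

lemma component_eq_lin_comb:
  assumes fin: "finite {j. b j \<noteq> 0}" and x: "x \<in> component (graded_free b) t"
  shows "x = lin_comb (strand b t) (\<lambda>s. Poly_Mapping.lookup (x (fst s)) (snd s))"
proof (intro ext poly_mapping_eqI)
  fix e m
  have "(e, m) \<in> strand b t" if "Poly_Mapping.lookup (x e) m \<noteq> 0"
  proof -
    have "x e \<noteq> 0"
      using that by auto
    then show ?thesis
      using x that by (auto simp: component_graded_free graded_free_simps strand_def homog_polys_iff
        simp del: split_paired_All)
  qed
  then show "Poly_Mapping.lookup (x e) m =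
    Poly_Mapping.lookup (lin_comb (strand b t) (\<lambda>s. Poly_Mapping.lookup (x (fst s)) (snd s)) e) m"
    by (auto simp: lookup_lin_comb[OF finite_strand[OF fin]])
qed

text \<open>The degree \<open>t\<close> strand of \<open>F\<^sub>2 \<rightarrow> F\<^sub>1 \<rightarrow> F\<^sub>0\<close> is an exact sequence of vector spaces in the middle. By minimality the
  last map has its values in the span of the basis elements that involve a nontrivial monomial, so only those
  count in the target.\<close>

lemma strand_inequality:
  fixes \<phi>0 \<phi>1 :: "(int \<times> nat \<Rightarrow> ('k::field, 'v::finite) mpol) \<Rightarrow> int \<times> nat \<Rightarrow> ('k, 'v) mpol"
  assumes fin: "finite {j. b0 j \<noteq> 0}" "finite {j. b1 j \<noteq> 0}" "finite {j. b2 j \<noteq> 0}"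
    and \<phi>0: "\<phi>0 \<in> graded_hom (graded_free b1) (graded_free b0)"
    and \<phi>1: "\<phi>1 \<in> graded_hom (graded_free b2) (graded_free b1)"
    and exact: "\<And>x. x \<in> carrier (graded_free b1) \<Longrightarrow> \<phi>0 x = (\<lambda>_. 0) \<Longrightarrow>
       \<exists>y\<in>carrier (graded_free b2). x = \<phi>1 y"
    and minimal: "\<And>x e. x \<in> carrier (graded_free b1) \<Longrightarrow> \<phi>0 x e \<in> irrelevant_ideal"
  shows "card (strand b1 t :: (_ \<times> ('v \<Rightarrow>\<^sub>0 nat)) set) \<le>
    card (strand b2 t :: (_ \<times> ('v \<Rightarrow>\<^sub>0 nat)) set) +
    card {s \<in> strand b0 t :: (_ \<times> ('v \<Rightarrow>\<^sub>0 nat)) set. snd s \<noteq> 0}"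
proof (rule card_le_of_exact)
  show "finite (strand b1 t)" "finite (strand b2 t)" "finite {s \<in> strand b0 t. snd s \<noteq> 0}"
    by (intro finite_Collect_conjI finite_strand fin disjI1; simp add: finite_strand fin)+
  have J: "fst s \<in> gens b" if "s \<in> strand b t" for b and s :: "_ \<times> ('v \<Rightarrow>\<^sub>0 nat)"
    using that by (auto simp: strand_def)
  fix z :: "(int \<times> nat) \<times> ('v \<Rightarrow>\<^sub>0 nat) \<Rightarrow> 'k"
  assume z: "\<And>c. c \<in> {s \<in> strand b0 t. snd s \<noteq> 0} \<Longrightarrow>
      (\<Sum>j\<in>strand b1 t. Poly_Mapping.lookup (\<phi>0 (mono_vec j) (fst c)) (snd c) * z j) = 0"
  define x where "x = lin_comb (strand b1 t) z"
  have x: "x \<in> component (graded_free b1) t"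
    unfolding x_def by (rule lin_comb_component)
  then have comp: "\<phi>0 x \<in> component (graded_free b0) t"
    by (rule graded_hom_D(2)[OF \<phi>0])
  have "Poly_Mapping.lookup (\<phi>0 x e) m = 0" for e m
  proof (cases "(e, m) \<in> strand b0 t \<and> m \<noteq> 0")
    case True
    then show ?thesis
      using z[of "(e, m)"] lookup_hom_lin_comb[OF graded_hom_D(1)[OF \<phi>0] J, of "strand b1 t" z e m]
      by (simp add: x_def)
  next
    case False
    then consider "e \<notin> gens b0" | "int (mdeg m) \<noteq> t - fst e" | "m = 0"
      by (auto simp: strand_def)
    then show ?thesis
    proof cases
      case 1
      then have "\<phi>0 x e = 0"
        using comp by (auto simp: component_graded_free graded_free_simps)
      then show ?thesis
        by simp
    next
      case 2
      then show ?thesis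
        using comp unfolding component_graded_free homog_polys_iff by blast
    next
      case 3
      then show ?thesis
        using minimal[OF component_sub_carrier[OF x]] by (simp add: irrelevant_ideal_def)
    qed
  qed
  then have "\<phi>0 x = (\<lambda>_. 0)"
    by (intro ext poly_mapping_eqI) simp
  then obtain y where y: "y \<in> carrier (graded_free b2)" "x = \<phi>1 y"
    using exact component_sub_carrier[OF x] by blast
  have "x = \<phi>1 (vpart t y)"
    using graded_hom_vpart[OF \<phi>1 y(1), of t] y(2) vpart_of_component[OF x, of t] by simp
  also have "vpart t y = lin_comb (strand b2 t) (\<lambda>s. Poly_Mapping.lookup (vpart t y (fst s)) (snd s))"
    by (rule component_eq_lin_comb[OF fin(3) vpart_component[OF y(1)]])
  finally have x_eq: "x = \<phi>1 \<dots>" .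
  define v where "v = (\<lambda>s. Poly_Mapping.lookup (vpart t y (fst s)) (snd s))"
  have "z j = (\<Sum>i\<in>strand b2 t. Poly_Mapping.lookup (\<phi>1 (mono_vec i) (fst j)) (snd j) * v i)"
    if "j \<in> strand b1 t" for j
  proof -
    have "z j = Poly_Mapping.lookup (x (fst j)) (snd j)"
      using that by (simp add: x_def lookup_lin_comb[OF finite_strand[OF fin(2)]])
    also have "x = \<phi>1 (lin_comb (strand b2 t) v)"
      using x_eq by (simp add: v_def)
    finally show ?thesis
      by (simp add: lookup_hom_lin_comb[OF graded_hom_D(1)[OF \<phi>1] J])
  qed
  then show "\<exists>v. \<forall>j\<in>strand b1 t. z j =
      (\<Sum>i\<in>strand b2 t. Poly_Mapping.lookup (\<phi>1 (mono_vec i) (fst j)) (snd j) * v i)"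
    by blast
qed

section \<open>Dimension counts in one and two variables\<close>

lemma card_strand:
  assumes "finite {j. b j \<noteq> 0}"
  shows "card (strand b t :: (_ \<times> ('v::finite \<Rightarrow>\<^sub>0 nat)) set)
    = (\<Sum>e\<in>gens b. card {m :: 'v \<Rightarrow>\<^sub>0 nat. int (mdeg m) = t - fst e})"
  unfolding strand_Sigma by (rule card_SigmaI) (use finite_gens[OF assms] finite_mdeg in blast)+

lemma mdeg_one:
  fixes vx :: "'v::finite"
  assumes "UNIV = {vx}"
  shows "mdeg m = Poly_Mapping.lookup m vx"
  unfolding mdeg_def assms by simp

lemma monomial_one:
  fixes vx :: "'v::finite"
  assumes "UNIV = {vx}"
  shows "{m :: 'v \<Rightarrow>\<^sub>0 nat. int (mdeg m) = d} =
    (if d \<ge> 0 then {Poly_Mapping.single vx (nat d)} else {})"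
proof -
  have "m = Poly_Mapping.single vx (nat d)" if "int (mdeg m) = d" for m :: "'v \<Rightarrow>\<^sub>0 nat"
  proof (rule poly_mapping_eqI)
    fix v
    have "v = vx"
      using assms by auto
    then show "Poly_Mapping.lookup m v = Poly_Mapping.lookup (Poly_Mapping.single vx (nat d)) v"
      using that by (auto simp: mdeg_one[OF assms])
  qed
  then show ?thesis
    by (auto simp: mdeg_one[OF assms])
qed

lemma mdeg_two:
  fixes vx vy :: "'v::finite"
  assumes "UNIV = {vx, vy}" "vx \<noteq> vy"
  shows "mdeg m = Poly_Mapping.lookup m vx + Poly_Mapping.lookup m vy"
  unfolding mdeg_def assms(1) using assms(2) by simp

lemma inj_on_lookup_two:
  fixes vx vy :: "'v::finite"
  assumes vars: "UNIV = {vx, vy}" "vx \<noteq> vy"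
  shows "inj_on (\<lambda>m. Poly_Mapping.lookup m vx) {m. int (mdeg m) = d}"
proof (rule inj_onI, rule poly_mapping_eqI)
  fix m m' :: "'v \<Rightarrow>\<^sub>0 nat" and v :: 'v
  assume "m \<in> {m. int (mdeg m) = d}" "m' \<in> {m. int (mdeg m) = d}"
    "Poly_Mapping.lookup m vx = Poly_Mapping.lookup m' vx"
  moreover have "v = vx \<or> v = vy"
    using vars by auto
  ultimately show "Poly_Mapping.lookup m v = Poly_Mapping.lookup m' v"
    by (auto simp: mdeg_two[OF vars])
qed

lemma card_monomials_two:
  fixes vx vy :: "'v::finite"
  assumes vars: "UNIV = {vx, vy}" "vx \<noteq> vy"
  shows "card {m :: 'v \<Rightarrow>\<^sub>0 nat. int (mdeg m) = d} = nat (d + 1)"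
proof -
  have "(\<lambda>m. Poly_Mapping.lookup m vx) ` {m. int (mdeg m) = d} = {i. int i \<le> d}"
  proof (intro equalityI subsetI)
    fix i assume "i \<in> {i. int i \<le> d}"
    then show "i \<in> (\<lambda>m. Poly_Mapping.lookup m vx) ` {m. int (mdeg m) = d}"
      using vars by (intro image_eqI[of _ _ "Poly_Mapping.single vx i + Poly_Mapping.single vy (nat d - i)"])
        (auto simp: mdeg_two[OF vars] lookup_add lookup_single)
  qed (auto simp: mdeg_two[OF vars])
  then have "card {m :: 'v \<Rightarrow>\<^sub>0 nat. int (mdeg m) = d} = card {i. int i \<le> d}"
    using card_image[OF inj_on_lookup_two[OF vars, of d]] by simp
  also have "{i. int i \<le> d} = {..<nat (d + 1)}"
    by auto
  finally show ?thesis
    by simp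
qed

lemma card_gens_le:
  assumes "finite {j. b j \<noteq> 0}" and lo: "\<And>j. b j \<noteq> 0 \<Longrightarrow> lo \<le> j"
  shows "card {e \<in> gens b. fst e \<le> t} = (\<Sum>j\<in>{lo..t}. b j)"
proof -
  have "{e \<in> gens b. fst e \<le> t} = (SIGMA j:{lo..t}. {..<b j})"
    using lo by fastforce
  then show ?thesis
    by simp
qed

text \<open>In one variable a generator of degree at most \<open>t\<close> contributes exactly one monomial to the strand of degree \<open>t\<close>,
  and a nontrivial one precisely if its degree is below \<open>t\<close>. So minimality turns \<open>\<le> t\<close> into \<open>\<le> t - 1\<close> on the
  right-hand side.\<close>

lemma strand_inequality_one:
  fixes vx :: "'v::finite" and \<phi> :: "(int \<times> nat \<Rightarrow> ('k::field, 'v::finite) mpol) \<Rightarrow> int \<times> nat \<Rightarrow> ('k, 'v) mpol"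
  assumes vx: "UNIV = {vx}"
    and fin: "finite {j. b0 j \<noteq> 0}" "finite {j. b1 j \<noteq> 0}"
    and \<phi>: "\<phi> \<in> graded_hom (graded_free b1) (graded_free b0)"
    and inj: "\<And>x. x \<in> carrier (graded_free b1) \<Longrightarrow> \<phi> x = (\<lambda>_. 0) \<Longrightarrow> x = (\<lambda>_. 0)"
    and minimal: "\<And>x e. x \<in> carrier (graded_free b1) \<Longrightarrow> \<phi> x e \<in> irrelevant_ideal"
  shows "card {e \<in> gens b1. fst e \<le> t} \<le> card {e \<in> gens b0. fst e \<le> t - 1}"
proof -
  have zero: "(\<lambda>_ _. 0) \<in> graded_hom (graded_free (\<lambda>_. 0)) (graded_free b1)"
    by (auto simp: graded_hom_def mod_hom_def graded_free_simps component_graded_free homog_polys_0)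
  have "card (strand b1 t :: (_ \<times> ('v \<Rightarrow>\<^sub>0 nat)) set) \<le>
    card (strand (\<lambda>_. 0) t :: (_ \<times> ('v \<Rightarrow>\<^sub>0 nat)) set) +
    card {s \<in> strand b0 t :: (_ \<times> ('v \<Rightarrow>\<^sub>0 nat)) set. snd s \<noteq> 0}"
    by (rule strand_inequality[OF fin _ \<phi> zero _ minimal])
      (use inj graded_free_0 in auto)
  also have "card (strand (\<lambda>_. 0) t :: (_ \<times> ('v \<Rightarrow>\<^sub>0 nat)) set) = 0"
    by (simp add: strand_def)
  also have "card {s \<in> strand b0 t :: (_ \<times> ('v \<Rightarrow>\<^sub>0 nat)) set. snd s \<noteq> 0}
      \<le> card {e \<in> gens b0. fst e \<le> t - 1}"
  proof (rule card_inj_on_le[of fst])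
    show "inj_on fst {s \<in> strand b0 t :: (_ \<times> ('v \<Rightarrow>\<^sub>0 nat)) set. snd s \<noteq> 0}"
    proof (rule inj_onI)
      fix s s' :: "_ \<times> ('v \<Rightarrow>\<^sub>0 nat)"
      assume "s \<in> {s \<in> strand b0 t. snd s \<noteq> 0}" "s' \<in> {s \<in> strand b0 t. snd s \<noteq> 0}"
        and eq: "fst s = fst s'"
      then have "snd s \<in> {m. int (mdeg m) = t - fst (fst s)}" "snd s' \<in> {m. int (mdeg m) = t - fst (fst s)}"
        by (auto simp: strand_def)
      then show "s = s'"
        unfolding monomial_one[OF vx] using eq by (auto simp: prod_eq_iff split: if_splits)
    qed
    show "fst ` {s \<in> strand b0 t :: (_ \<times> ('v \<Rightarrow>\<^sub>0 nat)) set. snd s \<noteq> 0} \<subseteq> {e \<in> gens b0. fst e \<le> t - 1}"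
    proof (rule image_subsetI)
      fix s :: "_ \<times> ('v \<Rightarrow>\<^sub>0 nat)"
      assume s: "s \<in> {s \<in> strand b0 t. snd s \<noteq> 0}"
      then have "mdeg (snd s) \<noteq> 0"
        by (simp add: mdeg_eq_0_iff)
      with s show "fst s \<in> {e \<in> gens b0. fst e \<le> t - 1}"
        by (auto simp: strand_def)
    qed
  qed (use finite_gens[OF fin(1)] in simp)
  also have "card (strand b1 t :: (_ \<times> ('v \<Rightarrow>\<^sub>0 nat)) set) = card {e \<in> gens b1. fst e \<le> t}"
  proof -
    have "card (strand b1 t :: (_ \<times> ('v \<Rightarrow>\<^sub>0 nat)) set) = (\<Sum>e\<in>gens b1. if fst e \<le> t then 1 else 0)"
      unfolding card_strand[OF fin(2)] monomial_one[OF vx] by (intro sum.cong) auto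
    then show ?thesis
      using finite_gens[OF fin(2)] by (simp add: sum.If_cases Int_def)
  qed
  finally show ?thesis
    by simp
qed

text \<open>In two variables a generator of degree \<open>j\<close> contributes \<open>t - j + 1\<close> to the dimension in degree \<open>t\<close>. The strand
  inequality is therefore an inequality between affine functions of \<open>t\<close>, valid for all large \<open>t\<close>, and comparing slopes gives the claim.\<close>

lemma rank_inequality:
  fixes vx vy :: "'v::finite"
    and \<phi>0 \<phi>1 :: "(int \<times> nat \<Rightarrow> ('k::field, 'v) mpol) \<Rightarrow> int \<times> nat \<Rightarrow> ('k, 'v) mpol"
  assumes vars: "UNIV = {vx, vy}" "vx \<noteq> vy"
    and fin: "finite {j. b0 j \<noteq> 0}" "finite {j. b1 j \<noteq> 0}" "finite {j. b2 j \<noteq> 0}"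
    and \<phi>0: "\<phi>0 \<in> graded_hom (graded_free b1) (graded_free b0)"
    and \<phi>1: "\<phi>1 \<in> graded_hom (graded_free b2) (graded_free b1)"
    and exact: "\<And>x. x \<in> carrier (graded_free b1) \<Longrightarrow> \<phi>0 x = (\<lambda>_. 0) \<Longrightarrow>
       \<exists>y\<in>carrier (graded_free b2). x = \<phi>1 y"
    and minimal: "\<And>x e. x \<in> carrier (graded_free b1) \<Longrightarrow> \<phi>0 x e \<in> irrelevant_ideal"
  shows "card (gens b1) \<le> card (gens b2) + card (gens b0)"
proof -
  note fin_gens = fin[THEN finite_gens]
  define E where "E = gens b0 \<union> gens b1 \<union> gens b2"
  define N where "N = (\<Sum>e\<in>E. \<bar>fst e\<bar>)"
  have sub: "gens b0 \<subseteq> E" "gens b1 \<subseteq> E" "gens b2 \<subseteq> E"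
    unfolding E_def by blast+
  have fin_E: "finite E"
    unfolding E_def using fin_gens by blast
  have N: "\<bar>fst e\<bar> \<le> N" if "e \<in> E" for e
    unfolding N_def using fin_E that by (intro member_le_sum) auto
  have N_0: "0 \<le> N"
    by (simp add: N_def sum_nonneg)
  define n0 n1 n2 where "n0 = int (card (gens b0))" "n1 = int (card (gens b1))" "n2 = int (card (gens b2))"
\<comment> \<open>large enough for the slopes to decide: a violation would force \<open>t - N + 1 \<le> 2 * N * (n0 + n2)\<close>\<close>
  define t where "t = N + 2 * N * (n0 + n2)"
  have N_t: "N \<le> t"
    unfolding t_def using N_0 by (simp add: n0_n1_n2_def)
  have strand_card: "int (card (strand b t :: (_ \<times> ('v \<Rightarrow>\<^sub>0 nat)) set)) = (\<Sum>e\<in>gens b. t - fst e + 1)"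
    if "finite {j. b j \<noteq> 0}" "gens b \<subseteq> E" for b
  proof -
    have "int (nat (t - fst e + 1)) = t - fst e + 1" if "e \<in> gens b" for e
    proof -
      have "\<bar>fst e\<bar> \<le> N"
        using N that \<open>gens b \<subseteq> E\<close> by blast
      then show ?thesis
        using N_t by simp
    qed
    then show ?thesis
      unfolding card_strand[OF that(1)] card_monomials_two[OF vars] of_nat_sum by simp
  qed
  have "int (card (strand b1 t :: (_ \<times> ('v \<Rightarrow>\<^sub>0 nat)) set)) \<le>
      int (card (strand b2 t :: (_ \<times> ('v \<Rightarrow>\<^sub>0 nat)) set)) +
      int (card {s \<in> strand b0 t :: (_ \<times> ('v \<Rightarrow>\<^sub>0 nat)) set. snd s \<noteq> 0})"
    using strand_inequality[OF fin \<phi>0 \<phi>1 exact minimal, of t] by linarith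
  also have "card {s \<in> strand b0 t :: (_ \<times> ('v \<Rightarrow>\<^sub>0 nat)) set. snd s \<noteq> 0}
      \<le> card (strand b0 t :: (_ \<times> ('v \<Rightarrow>\<^sub>0 nat)) set)"
    by (intro card_mono finite_strand fin) auto
  finally have "(\<Sum>e\<in>gens b1. t - fst e + 1) \<le> (\<Sum>e\<in>gens b2. t - fst e + 1) + (\<Sum>e\<in>gens b0. t - fst e + 1)"
    using strand_card[OF fin(1) sub(1)] strand_card[OF fin(2) sub(2)] strand_card[OF fin(3) sub(3)]
    by linarith
  moreover have "n1 * (t - N + 1) \<le> (\<Sum>e\<in>gens b1. t - fst e + 1)"
  proof -
    have "(\<Sum>e\<in>gens b1. t - N + 1) \<le> (\<Sum>e\<in>gens b1. t - fst e + 1)"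
    proof (rule sum_mono)
      fix e assume "e \<in> gens b1"
      then have "\<bar>fst e\<bar> \<le> N"
        using N sub(2) by blast
      then show "t - N + 1 \<le> t - fst e + 1"
        by linarith
    qed
    then show ?thesis
      by (simp add: n0_n1_n2_def)
  qed
  moreover have upper: "(\<Sum>e\<in>gens b. t - fst e + 1) \<le> int (card (gens b)) * (t + N + 1)"
    if "gens b \<subseteq> E" for b
  proof -
    have "(\<Sum>e\<in>gens b. t - fst e + 1) \<le> (\<Sum>e\<in>gens b. t + N + 1)"
    proof (rule sum_mono)
      fix e assume "e \<in> gens b"
      then have "\<bar>fst e\<bar> \<le> N"
        using N that by blast
      then show "t - fst e + 1 \<le> t + N + 1"
        by linarith
    qed
    then show ?thesis
      by simp
  qed
  ultimately have "n1 * (t - N + 1) \<le> (n0 + n2) * (t + N + 1)"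
    using upper[OF sub(1)] upper[OF sub(3)] unfolding n0_n1_n2_def distrib_right by linarith
  also have "\<dots> < (n0 + n2 + 1) * (t - N + 1)"
    by (simp add: t_def algebra_simps)
  finally have "n1 < n0 + n2 + 1"
    using N_t by (simp add: mult_less_cancel_right)
  then show ?thesis
    by (simp add: n0_n1_n2_def)
qed

section \<open>The degree inequality\<close>

lemma component_lookup_0:
  assumes "x \<in> component (graded_free b) t" "(e, m) \<notin> strand b t"
  shows "Poly_Mapping.lookup (x e) m = 0"
proof (rule ccontr)
  assume nz: "Poly_Mapping.lookup (x e) m \<noteq> 0"
  then have "x e \<noteq> 0"
    by auto
  then have "e \<in> gens b"
    using assms(1) unfolding component_graded_free graded_free_simps by blast
  moreover have "int (mdeg m) = t - fst e"
    using assms(1) nz unfolding component_graded_free homog_polys_iff by blast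
  ultimately show False
    using assms(2) by (auto simp: strand_def)
qed

text \<open>The monomials of \<open>p\<close> divisible by \<open>m\<close>, divided by \<open>m\<close>; the other monomials are dropped.\<close>

definition mono_quot :: "('v \<Rightarrow>\<^sub>0 nat) \<Rightarrow> ('k::field, 'v::finite) mpol \<Rightarrow> ('k, 'v) mpol" where
  "mono_quot m p = Poly_Mapping.map_key (\<lambda>k. k + m) p"

lemma lookup_mono_quot: "Poly_Mapping.lookup (mono_quot m p) k = Poly_Mapping.lookup p (k + m)"
  by (simp add: mono_quot_def map_key.rep_eq inj_on_def)

lemma mono_quot_0: "mono_quot m 0 = 0"
  by (rule poly_mapping_eqI) (simp add: lookup_mono_quot)

text \<open>If the inequality failed, there would be more coefficients in an element \<open>\<omega>\<close> of \<open>F\<^sub>2\<close> of degree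
  \<open>c + m - 1\<close>, \<open>m = c - a\<close>, than conditions for its image \<open>w\<close> in \<open>F\<^sub>1\<close> to have all coordinates in the ideal
  \<open>(x\<^sup>m, y\<^sup>m)\<close>: a generator of degree \<open>j\<close> gives at most \<open>j - a\<close> monomials outside this ideal. So some \<open>\<omega> \<noteq> 0\<close> has
  \<open>w = y\<^sup>m u + x\<^sup>m v\<close>. Then \<open>y\<^sup>m \<phi>\<^sub>0 u = - x\<^sup>m \<phi>\<^sub>0 v\<close>, so \<open>x\<^sup>m\<close> divides the coordinates of \<open>\<phi>\<^sub>0 u\<close>, which have degree
  \<open>m - 1\<close>; hence \<open>\<phi>\<^sub>0 u = 0\<close> and \<open>\<phi>\<^sub>0 v = 0\<close>. By exactness \<open>u\<close> and \<open>v\<close> come from \<open>F\<^sub>2\<close>, and by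
  injectivity \<open>\<omega>\<close> is a combination of multiples of \<open>x\<^sup>m\<close> and \<open>y\<^sup>m\<close>, impossible in degree \<open>m - 1\<close>.\<close>

lemma degree_inequality:
  fixes vx vy :: "'v::finite"
    and \<phi>0 \<phi>1 :: "(int \<times> nat \<Rightarrow> ('k::field, 'v) mpol) \<Rightarrow> int \<times> nat \<Rightarrow> ('k, 'v) mpol"
  assumes vars: "UNIV = {vx, vy}" "vx \<noteq> vy"
    and fin: "finite {j. b0 j \<noteq> 0}" "finite {j. b1 j \<noteq> 0}" "finite {j. b2 j \<noteq> 0}"
    and b0: "\<And>j. b0 j \<noteq> 0 \<Longrightarrow> j = a" and b1: "\<And>j. b1 j \<noteq> 0 \<Longrightarrow> a \<le> j"
    and b2: "\<And>j. b2 j \<noteq> 0 \<Longrightarrow> j = c" and ac: "a < c"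
    and \<phi>0: "\<phi>0 \<in> graded_hom (graded_free b1) (graded_free b0)"
    and \<phi>1: "\<phi>1 \<in> graded_hom (graded_free b2) (graded_free b1)"
    and complex: "\<And>y. y \<in> carrier (graded_free b2) \<Longrightarrow> \<phi>0 (\<phi>1 y) = (\<lambda>_. 0)"
    and exact: "\<And>x. x \<in> carrier (graded_free b1) \<Longrightarrow> \<phi>0 x = (\<lambda>_. 0) \<Longrightarrow>
       \<exists>y\<in>carrier (graded_free b2). x = \<phi>1 y"
    and inj: "\<And>y. y \<in> carrier (graded_free b2) \<Longrightarrow> \<phi>1 y = (\<lambda>_. 0) \<Longrightarrow> y = (\<lambda>_. 0)"
  shows "nat (c - a) * b2 c \<le> (\<Sum>e\<in>gens b1. nat (fst e - a))"
proof (rule ccontr)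
  assume contra: "\<not> ?thesis"
  define m where "m = nat (c - a)"
  define t where "t = c + int m - 1"
  have m: "int m = c - a"
    using ac by (simp add: m_def)
  define J where "J = (strand b2 t :: ((int \<times> nat) \<times> ('v \<Rightarrow>\<^sub>0 nat)) set)"
  define K where "K = (SIGMA e:gens b1. {\<mu> :: 'v \<Rightarrow>\<^sub>0 nat. int (mdeg \<mu>) = t - fst e \<and>
    Poly_Mapping.lookup \<mu> vx < m \<and> Poly_Mapping.lookup \<mu> vy < m})"
  have fin_J: "finite J"
    unfolding J_def by (rule finite_strand[OF fin(3)])
  have fin_K: "finite K"
    unfolding K_def
    by (intro finite_SigmaI finite_gens fin finite_subset[OF _ finite_mdeg[of "t - fst _"]]) auto
  have J_gens: "fst s \<in> gens b2" if "s \<in> J" for s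
    using that by (auto simp: J_def strand_def)
  have J_deg: "mdeg (snd s) < m" if "s \<in> J" for s
    using that b2[of "fst (fst s)"] ac by (auto simp: J_def strand_def t_def m_def)
  have "card J = m * b2 c"
  proof -
    have "card J = (\<Sum>j | b2 j \<noteq> 0. b2 j * nat (t - j + 1))"
      unfolding J_def card_strand[OF fin(3)] card_monomials_two[OF vars]
      using sum_gens[OF fin(3), of "\<lambda>j. nat (t - j + 1)"] by simp
    also have "\<dots> = (\<Sum>j\<in>{c}. b2 j * nat (t - j + 1))"
      using fin(3) b2 by (intro sum.mono_neutral_left) auto
    finally show ?thesis
      by (simp add: t_def)
  qed
  moreover have "card K \<le> (\<Sum>e\<in>gens b1. nat (fst e - a))"
  proof -
    have "card {\<mu> :: 'v \<Rightarrow>\<^sub>0 nat. int (mdeg \<mu>) = t - fst e \<and>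
        Poly_Mapping.lookup \<mu> vx < m \<and> Poly_Mapping.lookup \<mu> vy < m} \<le> nat (fst e - a)" (is "card ?M \<le> _")
      if "e \<in> gens b1" for e
    proof -
      have "card ?M \<le> card {m - nat (fst e - a)..<m}"
      proof (rule card_inj_on_le)
        show "inj_on (\<lambda>\<mu>. Poly_Mapping.lookup \<mu> vx) ?M"
          by (rule inj_on_subset[OF inj_on_lookup_two[OF vars, of "t - fst e"]]) auto
        show "(\<lambda>\<mu>. Poly_Mapping.lookup \<mu> vx) ` ?M \<subseteq> {m - nat (fst e - a)..<m}"
          using m by (auto simp: mdeg_two[OF vars] t_def)
      qed simp
      also have "\<dots> \<le> nat (fst e - a)"
        by simp
      finally show ?thesis .
    qed
    then have "(\<Sum>e\<in>gens b1. card {\<mu> :: 'v \<Rightarrow>\<^sub>0 nat. int (mdeg \<mu>) = t - fst e \<and>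
        Poly_Mapping.lookup \<mu> vx < m \<and> Poly_Mapping.lookup \<mu> vy < m}) \<le> (\<Sum>e\<in>gens b1. nat (fst e - a))"
      by (rule sum_mono)
    then show ?thesis
      unfolding K_def
      by (subst card_SigmaI)
        (auto intro: finite_gens[OF fin(2)] finite_subset[OF _ finite_mdeg[of "t - fst _"]])
  qed
  ultimately have "card K < card J"
    using contra by (simp add: m_def)
  then obtain z where z_nz: "\<exists>s\<in>J. z s \<noteq> 0" and z:
      "\<And>c. c \<in> K \<Longrightarrow> (\<Sum>s\<in>J. Poly_Mapping.lookup (\<phi>1 (mono_vec s) (fst c)) (snd c) * z s) = 0"
    using homogeneous_system_nontrivial[OF fin_K fin_J,
        of "\<lambda>c s. Poly_Mapping.lookup (\<phi>1 (mono_vec s) (fst c)) (snd c)"] by blast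
  define \<omega> where "\<omega> = lin_comb J z"
  define w where "w = \<phi>1 \<omega>"
  note \<phi>0' = graded_hom_D(1)[OF \<phi>0] and \<phi>1' = graded_hom_D(1)[OF \<phi>1]
  have \<omega>: "\<omega> \<in> component (graded_free b2) t"
    unfolding \<omega>_def by (rule lin_comb_component) (simp add: J_def)
  have w: "w \<in> component (graded_free b1) t"
    unfolding w_def by (rule graded_hom_D(2)[OF \<phi>1 \<omega>])
  have w_0: "Poly_Mapping.lookup (w e) \<mu> = 0"
    if "Poly_Mapping.lookup \<mu> vx < m" "Poly_Mapping.lookup \<mu> vy < m" for e \<mu>
  proof (cases "(e, \<mu>) \<in> strand b1 t")
    case True
    then have "(e, \<mu>) \<in> K"
      using that by (auto simp: K_def strand_def)
    then show ?thesis
      using z[of "(e, \<mu>)"] lookup_hom_lin_comb[OF \<phi>1' J_gens, of J z e \<mu>] by (simp add: w_def \<omega>_def)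
  next
    case False
    then show ?thesis
      by (rule component_lookup_0[OF w])
  qed

  define x y where "x = Poly_Mapping.single vx m" "y = Poly_Mapping.single vy m"
  define xm ym :: "('k, 'v) mpol" where "xm = Poly_Mapping.single x 1" "ym = Poly_Mapping.single y 1"
  have div_iff: "(\<forall>v. Poly_Mapping.lookup (Poly_Mapping.single V m) v \<le> Poly_Mapping.lookup k v) \<longleftrightarrow>
      m \<le> Poly_Mapping.lookup k V" for V :: 'v and k
    by (auto simp: lookup_single when_def)
  have lookup_xm: "Poly_Mapping.lookup (xm * p) k =
      (if m \<le> Poly_Mapping.lookup k vx then Poly_Mapping.lookup p (k - x) else 0)" for p k
    unfolding xm_ym_def x_y_def lookup_single_times div_iff by simp
  have lookup_ym: "Poly_Mapping.lookup (ym * p) k =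
      (if m \<le> Poly_Mapping.lookup k vy then Poly_Mapping.lookup p (k - y) else 0)" for p k
    unfolding xm_ym_def x_y_def lookup_single_times div_iff by simp
  have add_x: "k - x + x = k" if "m \<le> Poly_Mapping.lookup k vx" for k
    using that by (intro poly_mapping_eqI) (auto simp: lookup_add lookup_minus x_y_def lookup_single when_def)
  have add_y: "k - y + y = k" if "m \<le> Poly_Mapping.lookup k vy" for k
    using that by (intro poly_mapping_eqI) (auto simp: lookup_add lookup_minus x_y_def lookup_single when_def)
\<comment> \<open>monomials divisible by both powers are put into the multiple of \<open>y\<^sup>m\<close>\<close>
  define u where "u = (\<lambda>e. mono_quot y (w e))"
  define v where "v = (\<lambda>e. mono_quot x (w e - ym * u e))"
  have w_split: "w = (\<lambda>e. ym * u e + xm * v e)"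
  proof (intro ext poly_mapping_eqI)
    fix e k
    show "Poly_Mapping.lookup (w e) k = Poly_Mapping.lookup (ym * u e + xm * v e) k"
      using w_0[of k e] add_x[of k] add_y[of k]
      by (auto simp: lookup_add lookup_xm lookup_ym u_def v_def lookup_mono_quot lookup_minus not_le)
  qed
  have w_gens: "w e = 0" if "e \<notin> gens b1" for e
    using w that unfolding component_graded_free graded_free_simps by blast
  have u: "u \<in> component (graded_free b1) (c - 1)"
    unfolding component_graded_free
  proof (intro CollectI conjI allI)
    show "u \<in> carrier (graded_free b1)"
    proof -
      have "u e = 0" if "e \<notin> gens b1" for e
        using w_gens[OF that] by (simp add: u_def mono_quot_0)
      then show ?thesis
        unfolding carrier_graded_free[OF fin(2)] by blast
    qed
    show "u e \<in> homog_polys (c - 1 - fst e)" for e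
      unfolding homog_polys_iff
    proof (intro allI impI)
      fix k assume "Poly_Mapping.lookup (u e) k \<noteq> 0"
      then have "Poly_Mapping.lookup (w e) (k + y) \<noteq> 0"
        by (simp add: u_def lookup_mono_quot)
      then have "(e, k + y) \<in> strand b1 t"
        using component_lookup_0[OF w] by blast
      moreover have "mdeg y = m"
        using vars by (simp add: mdeg_two[OF vars] x_y_def lookup_single)
      ultimately show "int (mdeg k) = c - 1 - fst e"
        by (auto simp: strand_def mdeg_add t_def)
    qed
  qed
  have v: "v \<in> carrier (graded_free b1)"
  proof -
    have "v e = 0" if "e \<notin> gens b1" for e
      using w_gens[OF that] by (simp add: v_def u_def mono_quot_0)
    then show ?thesis
      unfolding carrier_graded_free[OF fin(2)] by blast
  qed
  note u' = component_sub_carrier[OF u]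
  have "\<phi>0 w = (\<lambda>_. 0)"
    unfolding w_def by (rule complex[OF component_sub_carrier[OF \<omega>]])
  then have "ym * \<phi>0 u e + xm * \<phi>0 v e = 0" for e
    unfolding w_split
    by (simp add: mod_hom_add[OF \<phi>0' graded_free_smult[OF u'] graded_free_smult[OF v]]
      mod_hom_smult[OF \<phi>0' u'] mod_hom_smult[OF \<phi>0' v] fun_eq_iff)
  then have cancel: "Poly_Mapping.lookup (ym * \<phi>0 u e) k + Poly_Mapping.lookup (xm * \<phi>0 v e) k = 0" for e k
    by (metis lookup_add lookup_zero)
  have "Poly_Mapping.lookup (\<phi>0 u e) k = 0" for e k
  proof (cases "(e, k) \<in> strand b0 (c - 1)")
    case True
    then have "mdeg k < m"
      using b0[of "fst e"] ac by (auto simp: strand_def m_def)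
    then have "Poly_Mapping.lookup (k + y) vx < m"
      using vars by (simp add: mdeg_two[OF vars] x_y_def lookup_add lookup_single)
    then show ?thesis
      using cancel[of e "k + y"] by (simp add: lookup_xm lookup_ym lookup_add x_y_def)
  next
    case False
    then show ?thesis
      by (rule component_lookup_0[OF graded_hom_D(2)[OF \<phi>0 u]])
  qed
  then have \<phi>0_u: "\<phi>0 u = (\<lambda>_. 0)"
    by (intro ext poly_mapping_eqI) simp
  have "Poly_Mapping.lookup (\<phi>0 v e) k = 0" for e k
    using cancel[of e "k + x"] by (simp add: \<phi>0_u lookup_xm lookup_add x_y_def)
  then have \<phi>0_v: "\<phi>0 v = (\<lambda>_. 0)"
    by (intro ext poly_mapping_eqI) simp
  obtain u2 v2 where u2: "u2 \<in> carrier (graded_free b2)" "u = \<phi>1 u2"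
    and v2: "v2 \<in> carrier (graded_free b2)" "v = \<phi>1 v2"
    using exact[OF u' \<phi>0_u] exact[OF v \<phi>0_v] by blast
  define \<omega>' where "\<omega>' = (\<lambda>e. ym * u2 e + xm * v2 e)"
  have \<omega>': "\<omega>' \<in> carrier (graded_free b2)"
    unfolding \<omega>'_def by (intro graded_free_add graded_free_smult u2 v2)
  have "\<phi>1 \<omega>' = \<phi>1 \<omega>"
    unfolding \<omega>'_def w_def[symmetric] w_split
    by (simp add: mod_hom_add[OF \<phi>1' graded_free_smult[OF u2(1)] graded_free_smult[OF v2(1)]]
      mod_hom_smult[OF \<phi>1' u2(1)] mod_hom_smult[OF \<phi>1' v2(1)] u2(2) v2(2))
  then have "\<phi>1 (\<lambda>e. \<omega> e + (- 1) * \<omega>' e) = (\<lambda>_. 0)"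
    by (subst mod_hom_add[OF \<phi>1' component_sub_carrier[OF \<omega>] graded_free_smult[OF \<omega>']])
      (subst mod_hom_smult[OF \<phi>1' \<omega>'], simp)
  then have "(\<lambda>e. \<omega> e + (- 1) * \<omega>' e) = (\<lambda>_. 0)"
    by (rule inj[OF graded_free_add[OF component_sub_carrier[OF \<omega>] graded_free_smult[OF \<omega>']]])
  then have \<omega>_eq: "\<omega> e = \<omega>' e" for e
    by (simp add: fun_eq_iff)
  have "z s = 0" if "s \<in> J" for s
  proof -
    have "z s = Poly_Mapping.lookup (\<omega> (fst s)) (snd s)"
      using that by (simp add: \<omega>_def lookup_lin_comb[OF fin_J])
    also have "\<dots> = 0"
      using J_deg[OF that] by (simp add: \<omega>_eq \<omega>'_def lookup_add lookup_xm lookup_ym mdeg_two[OF vars])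
    finally show ?thesis .
  qed
  then show False
    using z_nz by blast
qed

section \<open>Quotients of graded free modules\<close>

lemma vpart_diff: "vpart t (\<lambda>e. x e - y e) = (\<lambda>e. vpart t x e - vpart t y e)"
  by (intro ext poly_mapping_eqI) (simp add: vpart_def lookup_hpart lookup_minus)

lemma component_0: "(\<lambda>_. 0) \<in> component (graded_free b) t"
  by (simp add: component_graded_free graded_free_0 homog_polys_0)

lemma component_add:
  "x \<in> component (graded_free b) t \<Longrightarrow> y \<in> component (graded_free b) t \<Longrightarrow>
   (\<lambda>e. x e + y e) \<in> component (graded_free b) t"
  by (simp add: component_graded_free graded_free_add homog_polys_add)

lemma component_smult:
  assumes "r \<in> homog_polys d" "x \<in> component (graded_free b) t"
  shows "(\<lambda>e. r * x e) \<in> component (graded_free b) (t + d)"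
proof -
  have "r * x e \<in> homog_polys (t + d - fst e)" for e
    using homog_polys_mult[OF assms(1), of "x e" "t - fst e"] assms(2)
    by (simp add: component_graded_free algebra_simps)
  then show ?thesis
    using assms(2) by (simp add: component_graded_free graded_free_smult)
qed

lemma component_uminus:
  assumes "x \<in> component (graded_free b) t"
  shows "(\<lambda>e. - x e) \<in> component (graded_free b) t"
  using component_smult[of "- 1" 0 x b t] assms by (simp add: homog_polys_iff lookup_one when_def mdeg_def)

text \<open>The elements congruent to \<open>x\<close> modulo \<open>N\<close>. The operations on cosets are defined through representatives chosen by \<open>rep\<close>;
  \<open>coset_add\<close> and \<open>coset_smult\<close> show that the choice is immaterial.\<close>

definition coset ::
  "(int \<times> nat \<Rightarrow> ('k::field, 'v::finite) mpol) set \<Rightarrow> (int \<times> nat \<Rightarrow> ('k, 'v) mpol) \<Rightarrow>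
   (int \<times> nat \<Rightarrow> ('k, 'v) mpol) set" where
  "coset N x = {y. (\<lambda>e. y e - x e) \<in> N}"

definition rep :: "'a set \<Rightarrow> 'a" where
  "rep c = (SOME y. y \<in> c)"

definition quotient ::
  "(int \<Rightarrow> nat) \<Rightarrow> (int \<times> nat \<Rightarrow> ('k::field, 'v::finite) mpol) set \<Rightarrow>
   (('k, 'v) mpol, (int \<times> nat \<Rightarrow> ('k, 'v) mpol) set) graded_module" where
  "quotient b N =
    \<lparr>carrier = coset N ` carrier (graded_free b),
     monoid.mult = undefined, monoid.one = undefined,
     ring.zero = coset N (\<lambda>_. 0),
     ring.add = (\<lambda>c c'. coset N (\<lambda>e. rep c e + rep c' e)),
     module.smult = (\<lambda>r c. coset N (\<lambda>e. r * rep c e)),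
     component = (\<lambda>t. coset N ` component (graded_free b) t)\<rparr>"

text \<open>The assumption \<open>vpart\<close> says that \<open>N\<close> is homogeneous, which is what the quotient needs in order to inherit a grading.\<close>

locale graded_submodule =
  fixes b :: "int \<Rightarrow> nat" and N :: "(int \<times> nat \<Rightarrow> ('k::field, 'v::finite) mpol) set"
  assumes fin: "finite {j. b j \<noteq> 0}"
    and sub: "x \<in> N \<Longrightarrow> x \<in> carrier (graded_free b)"
    and zero: "(\<lambda>_. 0) \<in> N"
    and add: "x \<in> N \<Longrightarrow> y \<in> N \<Longrightarrow> (\<lambda>e. x e + y e) \<in> N"
    and smult: "x \<in> N \<Longrightarrow> (\<lambda>e. r * x e) \<in> N"
    and vpart: "x \<in> N \<Longrightarrow> vpart t x \<in> N"
begin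

abbreviation "M \<equiv> quotient b N"

lemma uminus: "x \<in> N \<Longrightarrow> (\<lambda>e. - x e) \<in> N"
  using smult[of x "- 1"] by simp

lemma sum: "(\<And>i. i \<in> A \<Longrightarrow> f i \<in> N) \<Longrightarrow> (\<lambda>e. \<Sum>i\<in>A. f i e) \<in> N"
proof (induction A rule: infinite_finite_induct)
  case (insert i A)
  then show ?case
    using add[of "f i" "\<lambda>e. \<Sum>i\<in>A. f i e"] by simp
qed (simp_all add: zero)

lemma coset_eq_iff: "coset N x = coset N y \<longleftrightarrow> (\<lambda>e. x e - y e) \<in> N"
proof
  assume "coset N x = coset N y"
  moreover have "x \<in> coset N x"
    by (simp add: coset_def zero)
  ultimately show "(\<lambda>e. x e - y e) \<in> N"
    by (simp add: coset_def)
next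
  assume xy: "(\<lambda>e. x e - y e) \<in> N"
  have "(\<lambda>e. z e - x e) \<in> N \<longleftrightarrow> (\<lambda>e. z e - y e) \<in> N" for z
    using add[OF _ xy, of "\<lambda>e. z e - x e"] add[OF _ uminus[OF xy], of "\<lambda>e. z e - y e"] by auto
  then show "coset N x = coset N y"
    by (simp add: coset_def)
qed

lemma rep_coset: "(\<lambda>e. rep (coset N x) e - x e) \<in> N"
proof -
  have "x \<in> coset N x"
    by (simp add: coset_def zero)
  then have "rep (coset N x) \<in> coset N x"
    unfolding rep_def by (rule someI[of "\<lambda>y. y \<in> coset N x"])
  then show ?thesis
    by (simp add: coset_def)
qed

lemma quotient_simps:
  "carrier M = coset N ` carrier (graded_free b)"
  "\<zero>\<^bsub>M\<^esub> = coset N (\<lambda>_. 0)"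
  "component M t = coset N ` component (graded_free b) t"
  by (simp_all add: quotient_def)

lemma coset_add: "coset N x \<oplus>\<^bsub>M\<^esub> coset N y = coset N (\<lambda>e. x e + y e)"
proof -
  have "coset N (\<lambda>e. rep (coset N x) e + rep (coset N y) e) = coset N (\<lambda>e. x e + y e)"
    unfolding coset_eq_iff using add[OF rep_coset[of x] rep_coset[of y]] by (simp add: algebra_simps)
  then show ?thesis
    by (simp add: quotient_def)
qed

lemma coset_smult: "r \<odot>\<^bsub>M\<^esub> coset N x = coset N (\<lambda>e. r * x e)"
proof -
  have "coset N (\<lambda>e. r * rep (coset N x) e) = coset N (\<lambda>e. r * x e)"
    unfolding coset_eq_iff using smult[OF rep_coset[of x], of r] by (simp add: algebra_simps)
  then show ?thesis
    by (simp add: quotient_def)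
qed

lemma abelian_group_quotient: "abelian_group M"
proof (rule abelian_groupI)
  show "x \<oplus>\<^bsub>M\<^esub> y \<in> carrier M" if "x \<in> carrier M" "y \<in> carrier M" for x y
    using that graded_free_add unfolding quotient_simps by (force simp: coset_add)
  show "\<zero>\<^bsub>M\<^esub> \<in> carrier M"
    by (simp add: quotient_simps graded_free_0)
  show "\<exists>y\<in>carrier M. y \<oplus>\<^bsub>M\<^esub> x = \<zero>\<^bsub>M\<^esub>" if x: "x \<in> carrier M" for x
  proof -
    obtain y where "y \<in> carrier (graded_free b)" "x = coset N y"
      using x unfolding quotient_simps by blast
    then show ?thesis
      using graded_free_smult[of y b "- 1"]
      by (intro bexI[of _ "coset N (\<lambda>e. - y e)"]) (simp_all add: quotient_simps coset_add)
  qed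
qed (auto simp: quotient_simps coset_add algebra_simps)

lemma module_quotient: "module ring_of_type_algebra M"
proof (rule moduleI[OF cring_from_type_algebra abelian_group_quotient])
  show "r \<odot>\<^bsub>M\<^esub> x \<in> carrier M" if "x \<in> carrier M" for r x
    using that graded_free_smult unfolding quotient_simps by (force simp: coset_smult)
qed (auto simp: quotient_simps(1) coset_add coset_smult ring_of_type_algebra_def algebra_simps)

lemma coset_finsum:
  assumes "finite A" "\<And>i. i \<in> A \<Longrightarrow> f i \<in> carrier (graded_free b)"
  shows "(\<Oplus>\<^bsub>M\<^esub>i\<in>A. coset N (f i)) = coset N (\<lambda>e. \<Sum>i\<in>A. f i e)"
  using assms
proof (induction A rule: finite_induct)
  interpret M: abelian_group M
    by (rule abelian_group_quotient)
  {
    case empty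
    then show ?case
      by (simp add: quotient_simps)
  next
    case (insert i A)
    have "(\<Oplus>\<^bsub>M\<^esub>i\<in>insert i A. coset N (f i)) = coset N (f i) \<oplus>\<^bsub>M\<^esub> (\<Oplus>\<^bsub>M\<^esub>i\<in>A. coset N (f i))"
      using insert.hyps insert.prems by (intro M.finsum_insert) (auto simp: quotient_simps)
    with insert show ?case
      by (simp add: coset_add)
  }
qed

lemma subgroup_component: "subgroup (component M t) (add_monoid M)"
proof (rule group.subgroupI)
  interpret M: abelian_group M
    by (rule abelian_group_quotient)
  show grp: "group (add_monoid M)"
    by (rule M.a_group)
  show "component M t \<subseteq> carrier (add_monoid M)"
    by (auto simp: quotient_simps component_graded_free)
  show "component M t \<noteq> {}"
    using component_0 by (auto simp: quotient_simps)
  show "a \<otimes>\<^bsub>add_monoid M\<^esub> c \<in> component M t" if "a \<in> component M t" "c \<in> component M t" for a c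
    using that component_add by (force simp: quotient_simps coset_add)
  show "inv\<^bsub>add_monoid M\<^esub> a \<in> component M t" if a: "a \<in> component M t" for a
  proof -
    obtain x where x: "x \<in> component (graded_free b) t" "a = coset N x"
      using a by (auto simp: quotient_simps)
    have "inv\<^bsub>add_monoid M\<^esub> a = coset N (\<lambda>e. - x e)"
      using x component_uminus[OF x(1)]
      by (intro group.inv_equality[OF grp]) (auto simp: quotient_simps coset_add component_graded_free)
    then show ?thesis
      using component_uminus[OF x(1)] by (simp add: quotient_simps)
  qed
qed

text \<open>The components of a coset are the cosets of the components of any representative. Uniqueness: a second
  decomposition can be lifted to representatives, and two representatives of the same element differ by an element of \<open>N\<close>,
  all of whose components lie in \<open>N\<close>.\<close>

lemma decomposition:
  assumes m: "m \<in> carrier M"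
  shows "\<exists>!c. (\<forall>j. c j \<in> component M j) \<and> finite {j. c j \<noteq> \<zero>\<^bsub>M\<^esub>} \<and>
        m = (\<Oplus>\<^bsub>M\<^esub>j\<in>{j. c j \<noteq> \<zero>\<^bsub>M\<^esub>}. c j)"
proof -
  obtain x where x: "x \<in> carrier (graded_free b)" "m = coset N x"
    using m by (auto simp: quotient_simps)
  obtain T where T: "finite T" "\<And>t. t \<notin> T \<Longrightarrow> vpart t x = (\<lambda>_. 0)" "x = (\<lambda>e. \<Sum>t\<in>T. vpart t x e)"
    using sum_vpart[OF x(1)] by blast
  define c where "c = (\<lambda>t. coset N (vpart t x))"
  define S where "S = {j. c j \<noteq> \<zero>\<^bsub>M\<^esub>}"
  have S_T: "S \<subseteq> T"
    using T(2) by (auto simp: S_def c_def quotient_simps)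
  have carr: "vpart t x \<in> carrier (graded_free b)" for t
    by (rule component_sub_carrier[OF vpart_component[OF x(1)]])
  have "m = (\<Oplus>\<^bsub>M\<^esub>j\<in>S. c j)"
  proof -
    have "vpart t x \<in> N" if "t \<in> T - S" for t
    proof -
      have "coset N (vpart t x) = coset N (\<lambda>_. 0)"
        using that by (simp add: S_def c_def quotient_simps)
      then show ?thesis
        by (simp add: coset_eq_iff)
    qed
    then have "(\<lambda>e. \<Sum>t\<in>T - S. vpart t x e) \<in> N"
      by (rule sum)
    moreover have "x e - (\<Sum>t\<in>S. vpart t x e) = (\<Sum>t\<in>T - S. vpart t x e)" for e
      by (subst fun_cong[OF T(3)]) (use T(1) S_T in \<open>simp add: sum_diff\<close>)
    ultimately have "m = coset N (\<lambda>e. \<Sum>t\<in>S. vpart t x e)"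
      by (simp add: x(2) coset_eq_iff)
    then show ?thesis
      unfolding c_def using coset_finsum[of S "\<lambda>t. vpart t x"] finite_subset[OF S_T T(1)] carr by simp
  qed
  moreover have "c j \<in> component M j" for j
    unfolding c_def quotient_simps using vpart_component[OF x(1)] by blast
  moreover have "finite S"
    by (rule finite_subset[OF S_T T(1)])
  moreover have "c' = c"
    if c': "\<And>j. c' j \<in> component M j" "finite {j. c' j \<noteq> \<zero>\<^bsub>M\<^esub>}"
      "m = (\<Oplus>\<^bsub>M\<^esub>j\<in>{j. c' j \<noteq> \<zero>\<^bsub>M\<^esub>}. c' j)" for c'
  proof
    fix t
    define S' where "S' = {j. c' j \<noteq> \<zero>\<^bsub>M\<^esub>}"
    obtain y where y: "\<And>j. y j \<in> component (graded_free b) j" "\<And>j. c' j = coset N (y j)"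
      using c'(1) unfolding quotient_simps image_iff Bex_def by metis
    have "coset N x = coset N (\<lambda>e. \<Sum>j\<in>S'. y j e)"
      using c'(2,3) coset_finsum[of S' y] component_sub_carrier[OF y(1)] y(2) x(2) by (simp add: S'_def)
    then have "vpart t (\<lambda>e. x e - (\<Sum>j\<in>S'. y j e)) \<in> N"
      unfolding coset_eq_iff by (rule vpart)
    then have "c t = coset N (vpart t (\<lambda>e. \<Sum>j\<in>S'. y j e))"
      unfolding c_def vpart_diff by (simp add: coset_eq_iff)
    also have "vpart t (\<lambda>e. \<Sum>j\<in>S'. y j e) = (\<lambda>e. \<Sum>j\<in>S'. if j = t then y t e else 0)"
      unfolding vpart_sum by (intro ext sum.cong) (auto simp: vpart_of_component[OF y(1)])
    also have "\<dots> = (if t \<in> S' then y t else (\<lambda>_. 0))"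
      using c'(2) by (auto simp: S'_def)
    also have "coset N \<dots> = c' t"
      using y(2) by (auto simp: S'_def quotient_simps)
    finally show "c' t = c t" ..
  qed
  ultimately show ?thesis
    unfolding S_def by (intro ex1I[of _ c]) auto
qed

lemma is_graded_module_quotient: "is_graded_module M"
  unfolding is_graded_module_def
proof (intro conjI allI ballI)
  show "s \<odot>\<^bsub>M\<^esub> m \<in> component M (j + d)" if "s \<in> homog_polys d" "m \<in> component M j" for s m d j
    using that component_smult by (force simp: quotient_simps coset_smult)
qed (simp_all add: module_quotient subgroup_component decomposition)

text \<open>The cosets of the basis elements generate. Two basis elements may have the same coset, so the coefficient of
  a generator is the sum of the coordinates over all basis elements in that coset.\<close>

lemma fin_gen_quotient: "fin_gen M"
proof -
  define \<delta> where "\<delta> = (\<lambda>e e' :: int \<times> nat. if e' = e then 1 else (0 :: ('k, 'v) mpol))"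
  define A where "A = (\<lambda>e. coset N (\<delta> e)) ` gens b"
  have \<delta>: "\<delta> e \<in> carrier (graded_free b)" if "e \<in> gens b" for e
    using that by (auto simp: \<delta>_def graded_free_simps)
  have fin_A: "finite A"
    unfolding A_def using finite_gens[OF fin] by (rule finite_imageI)
  have A_sub: "A \<subseteq> carrier M"
    unfolding A_def quotient_simps using \<delta> by blast
  have "\<exists>c. m = (\<Oplus>\<^bsub>M\<^esub>a\<in>A. c a \<odot>\<^bsub>M\<^esub> a)" if m: "m \<in> carrier M" for m
  proof -
    obtain x where x: "x \<in> carrier (graded_free b)" "m = coset N x"
      using m by (auto simp: quotient_simps)
    define c where "c = (\<lambda>a. \<Sum>e | e \<in> gens b \<and> coset N (\<delta> e) = a. x e)"
    have rep_A: "coset N (rep a) = a" "rep a \<in> carrier (graded_free b)" if a: "a \<in> A" for a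
    proof -
      obtain e where e: "e \<in> gens b" "a = coset N (\<delta> e)"
        using a unfolding A_def by blast
      have d: "(\<lambda>i. rep a i - \<delta> e i) \<in> N"
        unfolding e(2) by (rule rep_coset)
      then show "coset N (rep a) = a"
        using e by (simp add: coset_eq_iff)
      show "rep a \<in> carrier (graded_free b)"
        using graded_free_add[OF sub[OF d] \<delta>[OF e(1)]] by simp
    qed
    have "(\<Oplus>\<^bsub>M\<^esub>a\<in>A. c a \<odot>\<^bsub>M\<^esub> a) = (\<Oplus>\<^bsub>M\<^esub>a\<in>A. coset N (\<lambda>i. c a * rep a i))"
    proof -
      interpret M: abelian_group M
        by (rule abelian_group_quotient)
      show ?thesis
      proof (rule M.finsum_cong'[OF refl])
        have "coset N (\<lambda>i. c a * rep a i) \<in> carrier M" if "a \<in> A" for a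
          unfolding quotient_simps by (intro imageI graded_free_smult rep_A that)
        then show "(\<lambda>a. coset N (\<lambda>i. c a * rep a i)) \<in> A \<rightarrow> carrier M"
          by blast
        show "c a \<odot>\<^bsub>M\<^esub> a = coset N (\<lambda>i. c a * rep a i)" if "a \<in> A" for a
          by (subst (2) rep_A(1)[OF that, symmetric]) (rule coset_smult)
      qed
    qed
    also have "\<dots> = coset N (\<lambda>i. \<Sum>a\<in>A. c a * rep a i)"
      by (intro coset_finsum fin_A graded_free_smult rep_A)
    also have "\<dots> = coset N (\<lambda>i. \<Sum>e\<in>gens b. x e * rep (coset N (\<delta> e)) i)"
    proof -
      have "(\<Sum>a\<in>A. c a * rep a i) = (\<Sum>e\<in>gens b. x e * rep (coset N (\<delta> e)) i)" for i
      proof -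
        have "(\<Sum>a\<in>A. c a * rep a i)
            = (\<Sum>a\<in>A. \<Sum>e | e \<in> gens b \<and> coset N (\<delta> e) = a. x e * rep (coset N (\<delta> e)) i)"
          unfolding c_def sum_distrib_right by (intro sum.cong refl) simp
        also have "\<dots> = (\<Sum>e\<in>gens b. x e * rep (coset N (\<delta> e)) i)"
          using finite_gens[OF fin] fin_A by (intro sum.group) (auto simp: A_def)
        finally show ?thesis .
      qed
      then show ?thesis
        by simp
    qed
    also have "\<dots> = coset N x"
    proof -
      have "(\<lambda>i. \<Sum>e\<in>gens b. x e * (rep (coset N (\<delta> e)) i - \<delta> e i)) \<in> N"
        by (intro sum smult rep_coset)
      moreover have "(\<Sum>e\<in>gens b. x e * \<delta> e i) = x i" for i
      proof -
        have "(\<Sum>e\<in>gens b. x e * \<delta> e i) = (\<Sum>e\<in>gens b. if e = i then x e else 0)"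
          by (intro sum.cong) (auto simp: \<delta>_def)
        also have "\<dots> = (if i \<in> gens b then x i else 0)"
          using finite_gens[OF fin] by simp
        also have "\<dots> = x i"
          using x(1) unfolding carrier_graded_free[OF fin] by auto
        finally show ?thesis .
      qed
      ultimately show ?thesis
        unfolding coset_eq_iff by (simp add: right_diff_distrib sum_subtractf)
    qed
    finally have "m = (\<Oplus>\<^bsub>M\<^esub>a\<in>A. c a \<odot>\<^bsub>M\<^esub> a)"
      unfolding x(2) by (rule sym)
    then show ?thesis
      by blast
  qed
  then show ?thesis
    unfolding fin_gen_def using fin_A A_sub by blast
qed

lemma coset_hom: "coset N \<in> graded_hom (graded_free b) M"
  by (auto simp: graded_hom_def mod_hom_def quotient_simps(1,3) graded_free_simps(3,4) coset_add coset_smult)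

lemma coset_kernel: "mod_ker (graded_free b) M (coset N) = N"
  using sub by (auto simp: mod_ker_def quotient_simps(2) coset_eq_iff)

end

section \<open>Betti diagrams from minimal complexes\<close>

lemma projective_free_module:
  "projective (free_module B :: ('r::comm_ring_1, int \<times> nat \<Rightarrow> 'r) module)"
  unfolding projective_def
proof (intro conjI exI bexI ballI)
  show "id \<in> mod_hom (free_module B) (free_module B)"
    by (auto simp: mod_hom_def)
  then show "id \<in> mod_hom (free_module B) (free_module B)" .
qed (simp_all add: module_free_module)

text \<open>A projective resolution is given by ungraded modules; these equations let the graded free resolution serve as one.\<close>

lemma free_module_graded_free:
  "carrier (free_module (gens b)) = carrier (graded_free b)"
  "mod_hom L (free_module (gens b)) = mod_hom L (graded_free b)"
  "mod_hom (free_module (gens b)) M = mod_hom (graded_free b) M"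
  "mod_ker L (free_module (gens b)) f = mod_ker L (graded_free b) f"
  "mod_ker (free_module (gens b)) M g = mod_ker (graded_free b) M g"
  by (simp_all add: mod_hom_def mod_ker_def graded_free_simps free_module_simps)

text \<open>The module is the cokernel of \<open>\<phi> 0\<close>, and the given complex is its minimal graded free resolution. It also bounds the
  projective dimension by \<open>p\<close>, since its terms beyond \<open>p\<close> vanish.\<close>

lemma betti_in_B_mod:
  fixes \<phi> :: "nat \<Rightarrow> (int \<times> nat \<Rightarrow> ('k::field, 'v::finite) mpol) \<Rightarrow> int \<times> nat \<Rightarrow> ('k, 'v) mpol"
  assumes fin_b: "\<And>i. finite {j. b i j \<noteq> 0}"
    and bounds: "\<And>i j. b i j \<noteq> 0 \<Longrightarrow> i \<le> p \<and> int (dl i) \<le> j \<and> j \<le> int (du i)"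
    and \<phi>: "\<And>i. \<phi> i \<in> graded_hom (graded_free (b (Suc i))) (graded_free (b i))"
    and exact: "\<And>i. mod_ker (graded_free (b (Suc i))) (graded_free (b i)) (\<phi> i)
      = \<phi> (Suc i) ` carrier (graded_free (b (Suc (Suc i))))"
    and minimal: "\<And>i x e. x \<in> carrier (graded_free (b (Suc i))) \<Longrightarrow> \<phi> i x e \<in> irrelevant_ideal"
  shows "(\<lambda>i j. of_nat (b i j)) \<in> B_mod TYPE(('k, 'v) mpol) p dl du"
proof -
  define N where "N = \<phi> 0 ` carrier (graded_free (b 1))"
  have \<phi>0: "\<phi> 0 \<in> graded_hom (graded_free (b 1)) (graded_free (b 0))"
    using \<phi>[of 0] by simp
  note \<phi>0' = graded_hom_D(1)[OF \<phi>0]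
  interpret graded_submodule "b 0" N
  proof
    fix x y :: "int \<times> nat \<Rightarrow> ('k, 'v) mpol" and r t
    show "(\<lambda>_. 0) \<in> N"
      unfolding N_def using mod_hom_0[OF \<phi>0'] graded_free_0 by (metis image_eqI)
    assume "x \<in> N"
    then obtain x' where x': "x' \<in> carrier (graded_free (b 1))" "x = \<phi> 0 x'"
      by (auto simp: N_def)
    show "x \<in> carrier (graded_free (b 0))"
      unfolding x'(2) by (rule mod_hom_closed[OF \<phi>0' x'(1)])
    show "(\<lambda>e. r * x e) \<in> N"
      unfolding N_def x'(2) mod_hom_smult[OF \<phi>0' x'(1), symmetric]
      by (intro imageI graded_free_smult x')
    show "vpart t x \<in> N"
      unfolding N_def x'(2) graded_hom_vpart[OF \<phi>0 x'(1), symmetric]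
      by (intro imageI component_sub_carrier[OF vpart_component] x')
    assume "y \<in> N"
    then obtain y' where y': "y' \<in> carrier (graded_free (b 1))" "y = \<phi> 0 y'"
      by (auto simp: N_def)
    show "(\<lambda>e. x e + y e) \<in> N"
      unfolding N_def x'(2) y'(2) mod_hom_add[OF \<phi>0' x'(1) y'(1), symmetric]
      by (intro imageI graded_free_add x' y')
  qed (rule fin_b)
  have res: "resolves (\<lambda>i. graded_free (b i)) \<phi> (coset N) M"
    unfolding resolves_def coset_kernel exact
  proof (intro conjI allI refl)
    show "\<phi> i \<in> mod_hom (graded_free (b (Suc i))) (graded_free (b i))" for i
      by (rule graded_hom_D(1)[OF \<phi>])
    show "coset N \<in> mod_hom (graded_free (b 0)) M"
      using coset_hom by (simp add: graded_hom_def)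
    show "coset N ` carrier (graded_free (b 0)) = carrier M"
      by (simp add: quotient_simps)
    show "N = \<phi> 0 ` carrier (graded_free (b 1))"
      by (rule N_def)
  qed
  have "has_betti_numbers M b"
    unfolding has_betti_numbers_def using fin_b res coset_hom \<phi> minimal by blast
  moreover have "proj_dim M \<le> enat p"
  proof -
    have "has_projective_resolution M p"
      unfolding has_projective_resolution_def
    proof (intro exI conjI allI impI)
      show "resolves (\<lambda>i. free_module (gens (b i))) \<phi> (coset N) M"
        using res unfolding resolves_def free_module_graded_free .
      show "projective (free_module (gens (b i)) :: (('k, 'v) mpol, int \<times> nat \<Rightarrow> ('k, 'v) mpol) module)" for i
        by (rule projective_free_module)
      show "carrier (free_module (gens (b i)) :: (('k, 'v) mpol, int \<times> nat \<Rightarrow> ('k, 'v) mpol) module)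
          = {\<zero>\<^bsub>free_module (gens (b i))\<^esub>}" if "i > p" for i
      proof -
        have "b i j = 0" for j
          using bounds[of i j] that by fastforce
        then show ?thesis
          by (auto simp: free_module_simps)
      qed
    qed
    then show ?thesis
      unfolding proj_dim_def by (intro INF_lower) simp
  qed
  ultimately show ?thesis
    unfolding B_mod_def using bounds is_graded_module_quotient fin_gen_quotient by blast
qed

section \<open>Multigraded complexes\<close>

text \<open>The monomial with exponent vector \<open>d\<close>; negative exponents are cut off at zero.\<close>

definition mexp :: "('v::finite \<Rightarrow> int) \<Rightarrow> 'v \<Rightarrow>\<^sub>0 nat" where
  "mexp d = Poly_Mapping.Abs_poly_mapping (\<lambda>v. nat (d v))"

lemma lookup_mexp: "Poly_Mapping.lookup (mexp d) v = nat (d v)"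
  by (simp add: mexp_def)

lemma mdeg_mexp:
  assumes "\<And>v. 0 \<le> d v"
  shows "int (mdeg (mexp d)) = (\<Sum>v\<in>UNIV. d v)"
  using assms by (simp add: mdeg_def lookup_mexp)

text \<open>When the generator \<open>e\<close> is given the multidegree \<open>D e\<close>, this is the coefficient of \<open>e\<close> in the component of \<open>x\<close> of
  multidegree \<open>u\<close>.\<close>

definition coefficient ::
  "(int \<times> nat \<Rightarrow> 'v \<Rightarrow> int) \<Rightarrow> (int \<times> nat \<Rightarrow> ('k::field, 'v::finite) mpol) \<Rightarrow> int \<times> nat \<Rightarrow>
   ('v \<Rightarrow> int) \<Rightarrow> 'k" where
  "coefficient D x e u =
    (if D e \<le> u then Poly_Mapping.lookup (x e) (mexp (\<lambda>v. u v - D e v)) else 0)"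

text \<open>The homomorphism of free modules with matrix entries \<open>C e' e\<close> times the monomial of multidegree
  \<open>D' e' - D e\<close>.\<close>

definition mono_hom ::
  "(int \<times> nat) set \<Rightarrow> (int \<times> nat \<Rightarrow> 'v \<Rightarrow> int) \<Rightarrow> (int \<times> nat) set \<Rightarrow> (int \<times> nat \<Rightarrow> 'v \<Rightarrow> int) \<Rightarrow>
   (int \<times> nat \<Rightarrow> int \<times> nat \<Rightarrow> 'k) \<Rightarrow>
   (int \<times> nat \<Rightarrow> ('k::field, 'v::finite) mpol) \<Rightarrow> int \<times> nat \<Rightarrow> ('k, 'v) mpol" where
  "mono_hom B' D' B D C x = (\<lambda>e. if e \<in> B then
     (\<Sum>e'\<in>B'. Poly_Mapping.single (mexp (\<lambda>v. D' e' v - D e v)) (C e' e) * x e') else 0)"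

lemma coefficient_shift:
  "coefficient D x e (\<lambda>v. D e v + int (Poly_Mapping.lookup m v)) = Poly_Mapping.lookup (x e) m"
proof -
  have "mexp (\<lambda>v. D e v + int (Poly_Mapping.lookup m v) - D e v) = m"
    by (rule poly_mapping_eqI) (simp add: lookup_mexp)
  then show ?thesis
    by (simp add: coefficient_def le_fun_def)
qed

lemma eq_of_coefficients:
  assumes "\<And>u. coefficient D x e u = coefficient D y e u"
  shows "x e = y e"
  using assms by (intro poly_mapping_eqI) (metis coefficient_shift)

text \<open>In each multidegree a monomial matrix acts through its matrix \<open>C\<close> of scalars. A source generator with
  \<open>C e' e \<noteq> 0\<close> that occurs in multidegree \<open>u\<close> has \<open>D e \<le> D' e' \<le> u\<close>, so the target generator occurs there as well.\<close>

lemma coefficient_mono_hom: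
  assumes "e \<in> B" and le: "\<And>e'. e' \<in> B' \<Longrightarrow> C e' e \<noteq> 0 \<Longrightarrow> D e \<le> D' e'"
  shows "coefficient D (mono_hom B' D' B D C x) e u = (\<Sum>e'\<in>B'. C e' e * coefficient D' x e' u)"
proof (cases "D e \<le> u")
  case True
  have "Poly_Mapping.lookup
      (Poly_Mapping.single (mexp (\<lambda>v. D' e' v - D e v)) (C e' e) * x e') (mexp (\<lambda>v. u v - D e v))
    = C e' e * coefficient D' x e' u" if "e' \<in> B'" for e'
  proof (cases "C e' e = 0")
    case False
    then have ge: "D e v \<le> D' e' v" for v
      using le[OF that] by (simp add: le_fun_def)
    have ge': "D e v \<le> u v" for v
      using True by (simp add: le_fun_def)
    have "(\<forall>v. nat (D' e' v - D e v) \<le> nat (u v - D e v)) \<longleftrightarrow> D' e' \<le> u"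
      unfolding le_fun_def using ge' by (intro iff_allI) (simp add: nat_le_eq_zle)
    moreover have "mexp (\<lambda>v. u v - D e v) - mexp (\<lambda>v. D' e' v - D e v) = mexp (\<lambda>v. u v - D' e' v)"
      if "D' e' \<le> u"
    proof (rule poly_mapping_eqI)
      fix k
      have "D' e' k \<le> u k"
        using that by (simp add: le_fun_def)
      with ge[of k] show "Poly_Mapping.lookup (mexp (\<lambda>v. u v - D e v) - mexp (\<lambda>v. D' e' v - D e v)) k
          = Poly_Mapping.lookup (mexp (\<lambda>v. u v - D' e' v)) k"
        unfolding lookup_minus lookup_mexp by linarith
    qed
    ultimately show ?thesis
      by (simp add: lookup_single_times lookup_mexp coefficient_def)
  qed simp
  then show ?thesis
    using True assms(1) by (simp add: coefficient_def[of D] mono_hom_def lookup_sum)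
next
  case False
  have "C e' e * coefficient D' x e' u = 0" if "e' \<in> B'" for e'
    using False le[OF that] order_trans[of "D e" "D' e'" u] by (auto simp: coefficient_def)
  then have "(\<Sum>e'\<in>B'. C e' e * coefficient D' x e' u) = 0"
    by (intro sum.neutral) blast
  then show ?thesis
    using False by (simp add: coefficient_def[of D])
qed

lemma exists_coefficients:
  assumes fin: "finite {j. b j \<noteq> 0}"
    and supp: "\<And>e u. g e u \<noteq> 0 \<Longrightarrow> e \<in> gens b \<and> D e \<le> u"
    and fin_g: "finite {u. \<exists>e. g e u \<noteq> 0}"
  obtains x :: "int \<times> nat \<Rightarrow> ('k::field, 'v::finite) mpol"
  where "x \<in> carrier (graded_free b)" "\<And>e u. coefficient D x e u = g e u"
proof
  define x :: "int \<times> nat \<Rightarrow> ('k, 'v) mpol" where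
    "x = (\<lambda>e. Poly_Mapping.Abs_poly_mapping (\<lambda>m. g e (\<lambda>v. D e v + int (Poly_Mapping.lookup m v))))"
  have lookup_x: "Poly_Mapping.lookup (x e) m = g e (\<lambda>v. D e v + int (Poly_Mapping.lookup m v))" for e m
  proof -
    have "finite {m. g e (\<lambda>v. D e v + int (Poly_Mapping.lookup m v)) \<noteq> 0}"
    proof (rule inj_on_finite)
      show "inj_on (\<lambda>m v. D e v + int (Poly_Mapping.lookup m v))
          {m. g e (\<lambda>v. D e v + int (Poly_Mapping.lookup m v)) \<noteq> 0}"
        by (intro inj_onI poly_mapping_eqI) (simp add: fun_eq_iff)
      show "(\<lambda>m v. D e v + int (Poly_Mapping.lookup m v)) `
          {m. g e (\<lambda>v. D e v + int (Poly_Mapping.lookup m v)) \<noteq> 0} \<subseteq> {u. \<exists>e. g e u \<noteq> 0}"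
        by blast
    qed (rule fin_g)
    then show ?thesis
      by (simp add: x_def)
  qed
  have "x e = 0" if "e \<notin> gens b" for e
    using supp that by (intro poly_mapping_eqI) (metis lookup_x lookup_zero)
  then show "x \<in> carrier (graded_free b)"
    unfolding carrier_graded_free[OF fin] by blast
  show "coefficient D x e u = g e u" for e u
  proof (cases "D e \<le> u")
    case True
    then have "(\<lambda>v. D e v + int (Poly_Mapping.lookup (mexp (\<lambda>v. u v - D e v)) v)) = u"
      by (simp add: lookup_mexp le_fun_def fun_eq_iff)
    then show ?thesis
      using True by (simp add: coefficient_def lookup_x)
  qed (use supp[of e u] in \<open>auto simp: coefficient_def\<close>)
qed

lemma finite_coefficients:
  assumes "x \<in> carrier (graded_free b)"
  shows "finite {u. \<exists>e. coefficient D x e u \<noteq> 0}"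
proof (rule finite_subset)
  show "{u. \<exists>e. coefficient D x e u \<noteq> 0} \<subseteq> (\<Union>e\<in>{e. x e \<noteq> 0}.
      (\<lambda>m v. D e v + int (Poly_Mapping.lookup m v)) ` Poly_Mapping.keys (x e))"
  proof
    fix u assume "u \<in> {u. \<exists>e. coefficient D x e u \<noteq> 0}"
    then obtain e where e: "D e \<le> u" "Poly_Mapping.lookup (x e) (mexp (\<lambda>v. u v - D e v)) \<noteq> 0"
      by (auto simp: coefficient_def split: if_splits)
    then have "u = (\<lambda>v. D e v + int (Poly_Mapping.lookup (mexp (\<lambda>v. u v - D e v)) v))"
      by (simp add: lookup_mexp le_fun_def fun_eq_iff)
    moreover have "x e \<noteq> 0"
      using e(2) by auto
    moreover have "mexp (\<lambda>v. u v - D e v) \<in> Poly_Mapping.keys (x e)"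
      using e(2) by (simp add: in_keys_iff)
    ultimately show "u \<in> (\<Union>e\<in>{e. x e \<noteq> 0}.
        (\<lambda>m v. D e v + int (Poly_Mapping.lookup m v)) ` Poly_Mapping.keys (x e))"
      by blast
  qed
  show "finite (\<Union>e\<in>{e. x e \<noteq> 0}.
      (\<lambda>m v. D e v + int (Poly_Mapping.lookup m v)) ` Poly_Mapping.keys (x e))"
    using assms by (simp add: graded_free_simps)
qed

lemma mono_hom_graded_hom:
  assumes fin: "finite {j. b j \<noteq> 0}" "finite {j. b' j \<noteq> 0}"
    and total: "\<And>e. e \<in> gens b \<Longrightarrow> (\<Sum>v\<in>UNIV. D e v) = fst e"
      "\<And>e. e \<in> gens b' \<Longrightarrow> (\<Sum>v\<in>UNIV. D' e v) = fst e"
    and le: "\<And>e e'. e' \<in> gens b' \<Longrightarrow> e \<in> gens b \<Longrightarrow> C e' e \<noteq> 0 \<Longrightarrow> D e \<le> D' e'"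
  shows "(mono_hom (gens b') D' (gens b) D C :: (_ \<Rightarrow> ('k::field, 'v::finite) mpol) \<Rightarrow> _)
    \<in> graded_hom (graded_free b') (graded_free b)"
proof -
  let ?f = "mono_hom (gens b') D' (gens b) D C :: (_ \<Rightarrow> ('k, 'v) mpol) \<Rightarrow> _"
  have carr: "?f x \<in> carrier (graded_free b)" for x
    unfolding carrier_graded_free[OF fin(1)] by (simp add: mono_hom_def)
  have "?f x \<in> component (graded_free b) t" if x: "x \<in> component (graded_free b') t" for x t
    unfolding component_graded_free
  proof (intro CollectI conjI allI carr)
    fix e
    have "Poly_Mapping.single (mexp (\<lambda>v. D' e' v - D e v)) (C e' e) * x e' \<in> homog_polys (t - fst e)"
      if e: "e \<in> gens b" "e' \<in> gens b'" for e'
    proof (cases "C e' e = 0")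
      case False
      then have "int (mdeg (mexp (\<lambda>v. D' e' v - D e v))) = (\<Sum>v\<in>UNIV. D' e' v - D e v)"
        using le[OF e(2,1)] by (intro mdeg_mexp) (simp add: le_fun_def)
      also have "\<dots> = fst e' - fst e"
        using total(1)[OF e(1)] total(2)[OF e(2)] by (simp add: sum_subtractf)
      finally have "Poly_Mapping.single (mexp (\<lambda>v. D' e' v - D e v)) (C e' e) * x e'
          \<in> homog_polys ((fst e' - fst e) + (t - fst e'))"
        using x by (intro homog_polys_mult homog_polys_single) (simp_all add: component_graded_free)
      then show ?thesis
        by simp
    qed (simp add: homog_polys_0)
    then show "?f x e \<in> homog_polys (t - fst e)"
      unfolding mono_hom_def by (cases "e \<in> gens b") (simp_all only: if_True if_False homog_polys_sum homog_polys_0)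
  qed
  moreover have "?f \<in> mod_hom (graded_free b') (graded_free b)"
    unfolding mod_hom_def graded_free_simps(3,4) using carr
    by (auto simp: mono_hom_def fun_eq_iff distrib_left sum.distrib sum_distrib_left mult.left_commute)
  ultimately show ?thesis
    unfolding graded_hom_def by blast
qed

text \<open>Exactness of a complex of monomial matrices is a statement about scalars: in multidegree \<open>u\<close> it says that each \<open>z\<close>
  supported on the generators of multidegree at most \<open>u\<close> and killed by \<open>C i\<close> is the image of some \<open>w\<close> with the same support
  condition. Solutions for the single multidegrees are assembled to a preimage over the polynomial ring.\<close>

lemma multigraded_in_B_mod:
  fixes C :: "nat \<Rightarrow> int \<times> nat \<Rightarrow> int \<times> nat \<Rightarrow> 'k::field" and D :: "nat \<Rightarrow> int \<times> nat \<Rightarrow> 'v::finite \<Rightarrow> int"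
  assumes fin: "\<And>i. finite {j. b i j \<noteq> 0}"
    and bounds: "\<And>i j. b i j \<noteq> 0 \<Longrightarrow> i \<le> p \<and> int (dl i) \<le> j \<and> j \<le> int (du i)"
    and total: "\<And>i e. e \<in> gens (b i) \<Longrightarrow> (\<Sum>v\<in>UNIV. D i e v) = fst e"
    and le: "\<And>i e' e. e' \<in> gens (b (Suc i)) \<Longrightarrow> e \<in> gens (b i) \<Longrightarrow> C i e' e \<noteq> 0 \<Longrightarrow>
      D i e \<le> D (Suc i) e' \<and> fst e < fst e'"
    and comp: "\<And>i e'' e. e'' \<in> gens (b (Suc (Suc i))) \<Longrightarrow> e \<in> gens (b i) \<Longrightarrow>
      (\<Sum>e'\<in>gens (b (Suc i)). C (Suc i) e'' e' * C i e' e) = 0"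
    and exact: "\<And>i u z. (\<And>e'. z e' \<noteq> 0 \<Longrightarrow> e' \<in> gens (b (Suc i)) \<and> D (Suc i) e' \<le> u) \<Longrightarrow>
      (\<And>e. e \<in> gens (b i) \<Longrightarrow> (\<Sum>e'\<in>gens (b (Suc i)). C i e' e * z e') = 0) \<Longrightarrow>
      \<exists>w. (\<forall>e''. w e'' \<noteq> 0 \<longrightarrow> e'' \<in> gens (b (Suc (Suc i))) \<and> D (Suc (Suc i)) e'' \<le> u) \<and>
          (\<forall>e'\<in>gens (b (Suc i)). z e' = (\<Sum>e''\<in>gens (b (Suc (Suc i))). C (Suc i) e'' e' * w e''))"
  shows "(\<lambda>i j. of_nat (b i j)) \<in> B_mod TYPE(('k, 'v) mpol) p dl du"
proof -
  define \<phi> :: "nat \<Rightarrow> (int \<times> nat \<Rightarrow> ('k, 'v) mpol) \<Rightarrow> int \<times> nat \<Rightarrow> ('k, 'v) mpol" where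
    "\<phi> = (\<lambda>i. mono_hom (gens (b (Suc i))) (D (Suc i)) (gens (b i)) (D i) (C i))"
  have hom: "\<phi> i \<in> graded_hom (graded_free (b (Suc i))) (graded_free (b i))" for i
    unfolding \<phi>_def by (rule mono_hom_graded_hom[OF fin fin total total]) (use le in blast)+
  have coeff: "coefficient (D i) (\<phi> i x) e u
      = (\<Sum>e'\<in>gens (b (Suc i)). C i e' e * coefficient (D (Suc i)) x e' u)"
    if "e \<in> gens (b i)" for i x e u
    unfolding \<phi>_def using that le[OF _ that] by (intro coefficient_mono_hom) blast+
  have outside: "\<phi> i x e = 0" if "e \<notin> gens (b i)" for i x e
    unfolding \<phi>_def mono_hom_def using that by simp
  show ?thesis
  proof (rule betti_in_B_mod[where b = b and \<phi> = \<phi>])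
    fix i
    show "mod_ker (graded_free (b (Suc i))) (graded_free (b i)) (\<phi> i)
      = \<phi> (Suc i) ` carrier (graded_free (b (Suc (Suc i))))"
    proof (intro equalityI subsetI)
      fix x assume "x \<in> \<phi> (Suc i) ` carrier (graded_free (b (Suc (Suc i))))"
      then obtain y where y: "y \<in> carrier (graded_free (b (Suc (Suc i))))" "x = \<phi> (Suc i) y"
        by blast
      have "\<phi> i x e = 0" for e
      proof (cases "e \<in> gens (b i)")
        case True
        have "coefficient (D i) (\<phi> i x) e u = coefficient (D i) (\<lambda>_. 0) e u" for u
        proof -
          have "coefficient (D i) (\<phi> i x) e u = (\<Sum>e'\<in>gens (b (Suc i)). \<Sum>e''\<in>gens (b (Suc (Suc i))).
              coefficient (D (Suc (Suc i))) y e'' u * (C (Suc i) e'' e' * C i e' e))"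
            unfolding coeff[OF True] y(2) by (intro sum.cong refl) (simp only: coeff sum_distrib_left mult_ac)
          also have "\<dots> = (\<Sum>e''\<in>gens (b (Suc (Suc i))). coefficient (D (Suc (Suc i))) y e'' u *
              (\<Sum>e'\<in>gens (b (Suc i)). C (Suc i) e'' e' * C i e' e))"
            by (subst sum.swap) (simp add: sum_distrib_left)
          also have "\<dots> = 0"
            by (intro sum.neutral ballI) (simp only: comp[OF _ True] mult_zero_right)
          finally show ?thesis
            by (simp add: coefficient_def)
        qed
        then show ?thesis
          by (rule eq_of_coefficients)
      qed (rule outside)
      moreover have "x \<in> carrier (graded_free (b (Suc i)))"
        unfolding y(2) by (rule mod_hom_closed[OF graded_hom_D(1)[OF hom] y(1)])
      ultimately show "x \<in> mod_ker (graded_free (b (Suc i))) (graded_free (b i)) (\<phi> i)"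
        by (auto simp: mod_ker_def graded_free_simps(2))
    next
      fix x assume "x \<in> mod_ker (graded_free (b (Suc i))) (graded_free (b i)) (\<phi> i)"
      then have x: "x \<in> carrier (graded_free (b (Suc i)))" "\<phi> i x = (\<lambda>_. 0)"
        by (simp_all add: mod_ker_def graded_free_simps(2))
      define z where "z = (\<lambda>u e'. coefficient (D (Suc i)) x e' u)"
      have z_supp: "e' \<in> gens (b (Suc i)) \<and> D (Suc i) e' \<le> u" if "z u e' \<noteq> 0" for u e'
      proof -
        have "D (Suc i) e' \<le> u" "x e' \<noteq> 0"
          using that by (auto simp: z_def coefficient_def split: if_splits)
        then show ?thesis
          using x(1) unfolding carrier_graded_free[OF fin] by blast
      qed
\<comment> \<open>the zero solution is chosen where \<open>z\<close> vanishes, so that only finitely many multidegrees contribute\<close>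
      define lifts where "lifts = (\<lambda>u w.
          (\<forall>e''. w e'' \<noteq> 0 \<longrightarrow> e'' \<in> gens (b (Suc (Suc i))) \<and> D (Suc (Suc i)) e'' \<le> u) \<and>
          (\<forall>e'\<in>gens (b (Suc i)). z u e' = (\<Sum>e''\<in>gens (b (Suc (Suc i))). C (Suc i) e'' e' * w e'')) \<and>
          ((\<forall>e'. z u e' = 0) \<longrightarrow> w = (\<lambda>_. 0)))"
      have "\<exists>w. lifts u w" for u
      proof (cases "\<forall>e'. z u e' = 0")
        case True
        then show ?thesis
          unfolding lifts_def by (intro exI[of _ "\<lambda>_. 0"]) simp
      next
        case False
        have "(\<Sum>e'\<in>gens (b (Suc i)). C i e' e * z u e') = 0" if "e \<in> gens (b i)" for e
          unfolding z_def coeff[OF that, symmetric] x(2) by (simp add: coefficient_def)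
        from exact[OF z_supp this] show ?thesis
          unfolding lifts_def using False by blast
      qed
      then obtain w where lifts: "\<And>u. lifts u (w u)"
        by metis
      have w: "w u e'' \<noteq> 0 \<Longrightarrow> e'' \<in> gens (b (Suc (Suc i))) \<and> D (Suc (Suc i)) e'' \<le> u"
          "e' \<in> gens (b (Suc i)) \<Longrightarrow>
            z u e' = (\<Sum>e''\<in>gens (b (Suc (Suc i))). C (Suc i) e'' e' * w u e'')"
          "(\<And>e'. z u e' = 0) \<Longrightarrow> w u = (\<lambda>_. 0)" for u e' e''
        using lifts[of u] unfolding lifts_def by blast+
      have "finite {u. \<exists>e''. w u e'' \<noteq> 0}"
        by (rule finite_subset[OF _ finite_coefficients[OF x(1), of "D (Suc i)"]])
          (use w(3) in \<open>force simp: z_def\<close>)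
      then obtain y :: "int \<times> nat \<Rightarrow> ('k, 'v) mpol" where y: "y \<in> carrier (graded_free (b (Suc (Suc i))))"
          "\<And>e u. coefficient (D (Suc (Suc i))) y e u = w u e"
        using exists_coefficients[OF fin, of "\<lambda>e u. w u e" "Suc (Suc i)" "D (Suc (Suc i))"] w(1) by blast
      have "\<phi> (Suc i) y e = x e" for e
      proof (cases "e \<in> gens (b (Suc i))")
        case True
        have "coefficient (D (Suc i)) (\<phi> (Suc i) y) e u = coefficient (D (Suc i)) x e u" for u
          using w(2)[OF True, of u] by (simp add: coeff[OF True] y(2) z_def)
        then show ?thesis
          by (rule eq_of_coefficients)
      next
        case False
        then show ?thesis
          using x(1) outside[OF False] unfolding carrier_graded_free[OF fin] by auto
      qed
      then have "x = \<phi> (Suc i) y"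
        by auto
      with y(1) show "x \<in> \<phi> (Suc i) ` carrier (graded_free (b (Suc (Suc i))))"
        by blast
    qed
  next
    fix i e and x :: "int \<times> nat \<Rightarrow> ('k, 'v) mpol"
    show "\<phi> i x e \<in> irrelevant_ideal"
    proof (cases "e \<in> gens (b i)")
      case True
      have "Poly_Mapping.lookup
          (Poly_Mapping.single (mexp (\<lambda>v. D (Suc i) e' v - D i e v)) (C i e' e) * x e') 0 = 0"
        if e': "e' \<in> gens (b (Suc i))" for e'
      proof (cases "C i e' e = 0")
        case False
        then have ge: "D i e \<le> D (Suc i) e'" "fst e < fst e'"
          using le[OF e' True] by auto
        have "(\<Sum>v\<in>UNIV. D i e v) < (\<Sum>v\<in>UNIV. D (Suc i) e' v)"
          using ge(2) total[OF True] total[OF e'] by simp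
        then obtain v where "D i e v < D (Suc i) e' v"
          by (meson linorder_not_le sum_mono)
        then have "\<not> (\<forall>v. Poly_Mapping.lookup (mexp (\<lambda>v. D (Suc i) e' v - D i e v)) v
            \<le> Poly_Mapping.lookup 0 v)"
          unfolding lookup_mexp lookup_zero by (metis diff_gt_0_iff_gt leD zero_less_nat_eq)
        then show ?thesis
          unfolding lookup_single_times by (rule if_not_P)
      qed simp
      then show ?thesis
        using True by (simp add: irrelevant_ideal_def \<phi>_def mono_hom_def lookup_sum)
    next
      case False
      then show ?thesis
        by (simp add: outside irrelevant_ideal_def)
    qed
  qed (fact fin bounds hom)+
qed

section \<open>Zigzags\<close>

lemma all_zero_iff_partial_sums_zero:
  fixes f :: "nat \<Rightarrow> 'a::ab_group_add"
  assumes "finite V"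
  shows "(\<forall>p\<in>V. f p = 0) \<longleftrightarrow> (\<forall>p\<in>V. (\<Sum>p' | p' \<in> V \<and> p' \<le> p. f p') = 0)"
proof (intro iffI ballI)
  fix p assume zero: "\<forall>p\<in>V. (\<Sum>p' | p' \<in> V \<and> p' \<le> p. f p') = 0" and "p \<in> V"
  then show "f p = 0"
  proof (induction p rule: less_induct)
    case (less p)
    have "(\<Sum>p' | p' \<in> V \<and> p' \<le> p. f p') = f p + (\<Sum>p' \<in> {p' \<in> V. p' \<le> p} - {p}. f p')"
      using assms less.prems by (intro sum.remove) auto
    also have "(\<Sum>p' \<in> {p' \<in> V. p' \<le> p} - {p}. f p') = 0"
      using less by (intro sum.neutral) auto
    finally show ?case
      using less.prems by simp
  qed
qed (simp add: sum.neutral)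

lemma partial_summation:
  fixes a y :: "nat \<Rightarrow> 'k::comm_ring_1"
  shows "(\<Sum>l<q. (a l - a (Suc l)) * (\<Sum>l'\<le>l. y l'))
    = (\<Sum>l\<le>q. a l * y l) - a q * (\<Sum>l\<le>q. y l)"
  by (induction q) (simp_all add: algebra_simps)

text \<open>Intervals of lengths \<open>e 0, \<dots>, e (n - 1)\<close> are laid end to end on a line, and the multiples \<open>0, m, \<dots>, q m\<close> of \<open>m\<close>
  fall on them. Interval \<open>i\<close> stands for generator number \<open>i\<close> of \<open>F\<^sub>1\<close>, the gap between \<open>l m\<close> and \<open>(l + 1) m\<close> for
  generator number \<open>l\<close> of \<open>F\<^sub>2\<close>. An interval that has been selected by a multiple of \<open>m\<close> is called a cut. Contracting the cuts leaves a
  chain of intervals; its vertices, which stand for generators of \<open>F\<^sub>0\<close>, are labelled by the interval that starts there, and by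
  \<open>n\<close> for the last one. In homological terms the complex of scalars is the relative chain complex of this chain of edges, with each cut an edge
  from a vertex to the base point; its cycles are spanned by the paths from one cut to the next.\<close>

locale zigzag =
  fixes e :: "nat \<Rightarrow> nat" and n m q :: nat
  assumes e_pos: "i < n \<Longrightarrow> 0 < e i"
    and e_less: "i < n \<Longrightarrow> e i < m"
    and total: "q * m \<le> (\<Sum>i<n. e i)"
    and n_pos: "0 < n"
begin

text \<open>The left end of interval \<open>i\<close>.\<close>

definition pos :: "nat \<Rightarrow> nat" where
  "pos i = (\<Sum>j<i. e j)"

text \<open>The leftmost interval that contains \<open>l m\<close>, end points included. Thus \<open>cut 0 = 0\<close>, although \<open>0\<close> is a left end, while any
  other multiple of \<open>m\<close> at a common end point selects the interval to its left; in particular \<open>q m\<close> is served when it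
  is the right end of the last interval.\<close>

definition cut :: "nat \<Rightarrow> nat" where
  "cut l = (LEAST i. l * m \<le> pos (Suc i))"

definition cuts :: "nat set" where
  "cuts = cut ` {..q}"

definition verts :: "nat set" where
  "verts = {p. p \<le> n \<and> p \<notin> cuts}"

text \<open>The vertex at which interval \<open>i\<close> starts, or to which it is attached if it is a cut.\<close>

definition vert :: "nat \<Rightarrow> nat" where
  "vert i = (LEAST p. i \<le> p \<and> p \<notin> cuts)"

text \<open>The position of the vertex \<open>vert i\<close> on the line from which the cuts have been removed.\<close>

definition height :: "nat \<Rightarrow> nat" where
  "height i = (\<Sum>j | j < i \<and> j \<notin> cuts. e j)"

lemma pos_mono: "i \<le> j \<Longrightarrow> pos i \<le> pos j"
  unfolding pos_def by (intro sum_mono2) auto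

lemma pos_Suc: "pos (Suc i) = pos i + e i"
  by (simp add: pos_def)

lemma cut_upper: "l \<le> q \<Longrightarrow> l * m \<le> pos (Suc (cut l))"
  and cut_less: "l \<le> q \<Longrightarrow> cut l < n"
proof -
  assume "l \<le> q"
  then have "l * m \<le> q * m"
    by (rule mult_le_mono1)
  also have "\<dots> \<le> pos (Suc (n - 1))"
    using total n_pos by (simp add: pos_def)
  finally have *: "l * m \<le> pos (Suc (n - 1))" .
  show "l * m \<le> pos (Suc (cut l))"
    unfolding cut_def by (rule LeastI[of _ "n - 1"]) (rule *)
  have "cut l \<le> n - 1"
    unfolding cut_def by (rule Least_le) (rule *)
  then show "cut l < n"
    using n_pos by simp
qed

lemma cut_lower: "pos (cut l) \<le> l * m"
proof (cases "cut l")
  case (Suc i)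
  then have "\<not> l * m \<le> pos (Suc i)"
    unfolding cut_def using not_less_Least[of i "\<lambda>i. l * m \<le> pos (Suc i)"] by simp
  then show ?thesis
    using Suc by simp
qed (simp add: pos_def)

text \<open>Distinct multiples select distinct intervals because every interval is shorter than \<open>m\<close>.\<close>

lemma cut_Suc:
  assumes "l < q"
  shows "cut l < cut (Suc l)"
proof (rule ccontr)
  assume "\<not> cut l < cut (Suc l)"
  then have "pos (Suc (cut (Suc l))) \<le> pos (Suc (cut l))"
    by (intro pos_mono) simp
  then have "Suc l * m \<le> pos (cut l) + e (cut l)"
    using cut_upper[of "Suc l"] assms by (simp add: pos_Suc)
  then show False
    using cut_lower[of l] e_less[of "cut l"] cut_less[of l] assms by simp
qed

lemma cut_strict_mono: "l < l' \<Longrightarrow> l' \<le> q \<Longrightarrow> cut l < cut l'"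
proof (induction l')
  case (Suc l')
  then show ?case
    using cut_Suc[of l'] by (cases "l = l'") auto
qed simp

lemma cut_less_iff: "l \<le> q \<Longrightarrow> l' \<le> q \<Longrightarrow> cut l < cut l' \<longleftrightarrow> l < l'"
  by (metis cut_strict_mono linorder_neqE_nat order_less_asym order_less_irrefl)

lemma cut_eq_iff: "l \<le> q \<Longrightarrow> l' \<le> q \<Longrightarrow> cut l = cut l' \<longleftrightarrow> l = l'"
  by (metis cut_strict_mono linorder_neqE_nat order_less_irrefl)

lemma between_cuts:
  assumes "l < q" "cut l < i" "i < cut (Suc l)"
  shows "i \<notin> cuts"
proof
  assume "i \<in> cuts"
  then obtain l' where "l' \<le> q" "i = cut l'"
    by (auto simp: cuts_def)
  then show False
    using assms cut_less_iff[of l l'] cut_less_iff[of l' "Suc l"] by simp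
qed

lemma cut_in_cuts: "l \<le> q \<Longrightarrow> cut l \<in> cuts"
  by (simp add: cuts_def)

lemma cuts_less: "i \<in> cuts \<Longrightarrow> i < n"
  using cut_less by (auto simp: cuts_def)

lemma finite_cuts: "finite cuts"
  by (simp add: cuts_def)

lemma finite_verts: "finite verts"
  by (simp add: verts_def)

lemma n_in_verts: "n \<in> verts"
  using cuts_less by (auto simp: verts_def)

lemma card_cuts: "card cuts = Suc q"
proof -
  have "inj_on cut {..q}"
    using cut_eq_iff by (auto simp: inj_on_def)
  then show ?thesis
    by (simp add: cuts_def card_image)
qed

lemma card_verts: "card verts = n - q"
proof -
  have "verts = {..n} - cuts"
    by (auto simp: verts_def)
  moreover have "cuts \<subseteq> {..n}"
    using cuts_less by (auto simp: less_imp_le)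
  ultimately show ?thesis
    using finite_cuts card_cuts by (simp add: card_Diff_subset)
qed

lemma vert_props:
  assumes "i \<le> n"
  shows "i \<le> vert i" "vert i \<in> verts"
proof -
  have n: "i \<le> n \<and> n \<notin> cuts"
    using assms n_in_verts by (simp add: verts_def)
  then have *: "i \<le> vert i \<and> vert i \<notin> cuts"
    unfolding vert_def by (rule LeastI)
  have "vert i \<le> n"
    unfolding vert_def by (rule Least_le) (rule n)
  with * show "i \<le> vert i" "vert i \<in> verts"
    by (auto simp: verts_def)
qed

lemma vert_le_iff:
  assumes "i \<le> n" "p \<in> verts"
  shows "vert i \<le> p \<longleftrightarrow> i \<le> p"
proof
  assume "i \<le> p"
  then show "vert i \<le> p"
    unfolding vert_def using assms(2) by (intro Least_le) (simp add: verts_def)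
qed (use vert_props(1)[OF assms(1)] in simp)

lemma before_vert: "i \<le> j \<Longrightarrow> j < vert i \<Longrightarrow> j \<in> cuts"
  unfolding vert_def using not_less_Least[of j "\<lambda>p. i \<le> p \<and> p \<notin> cuts"] by auto

lemma height_Suc: "height (Suc i) = (if i \<in> cuts then height i else height i + e i)"
proof -
  have "{j. j < Suc i \<and> j \<notin> cuts}
      = (if i \<in> cuts then {j. j < i \<and> j \<notin> cuts} else insert i {j. j < i \<and> j \<notin> cuts})"
    by (auto simp: less_Suc_eq)
  then show ?thesis
    by (simp add: height_def)
qed

lemma height_mono: "i \<le> j \<Longrightarrow> height i \<le> height j"
  unfolding height_def by (intro sum_mono2) auto

lemma height_vert:
  assumes "i \<le> n"
  shows "height (vert i) = height i"
proof -
  have "{j. j < vert i \<and> j \<notin> cuts} = {j. j < i \<and> j \<notin> cuts}"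
    using before_vert[of i] vert_props(1)[OF assms] by (auto simp: not_le[symmetric])
  then show ?thesis
    by (simp add: height_def)
qed

text \<open>Between two consecutive cuts nothing is removed, so distances agree in \<open>pos\<close> and in \<open>height\<close>.\<close>

lemma height_between:
  assumes "l < q" "cut l < i" "i \<le> cut (Suc l)"
  shows "height i + pos (Suc (cut l)) = height (cut l) + pos i"
  using assms(2,3)
proof (induction i)
  case (Suc i)
  show ?case
  proof (cases "i = cut l")
    case True
    then show ?thesis
      using cut_in_cuts[of l] assms(1) by (simp add: height_Suc)
  next
    case False
    then have "i \<notin> cuts"
      using Suc.prems assms(1) by (intro between_cuts[of l]) auto
    then show ?thesis
      using Suc False by (simp add: height_Suc pos_Suc)
  qed
qed simp

text \<open>The scalars of \<open>F\<^sub>1 \<rightarrow> F\<^sub>0\<close>: an interval of the chain goes to the difference of its two end vertices, a cut to the vertex to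
  which it is attached.\<close>

definition coeff0 :: "nat \<Rightarrow> nat \<Rightarrow> 'k::field" where
  "coeff0 i p = (if i \<in> cuts then of_bool (p = vert i) else of_bool (p = i) - of_bool (p = vert (Suc i)))"

text \<open>The scalars of \<open>F\<^sub>2 \<rightarrow> F\<^sub>1\<close>: the cycle that enters at \<open>cut l\<close>, runs along the intervals in between and leaves at
  \<open>cut (Suc l)\<close>. The entry is \<open>1\<close> at the first cut and \<open>- 1\<close> at all later intervals up to and including the second one.\<close>

definition coeff1 :: "nat \<Rightarrow> nat \<Rightarrow> 'k::field" where
  "coeff1 l i = of_bool (i = cut l) - (of_bool (cut l < i) - of_bool (cut (Suc l) < i))"

lemma sum_cuts: "(\<Sum>i | i \<in> cuts \<and> i < p. z i) = (\<Sum>l\<le>q. of_bool (cut l < p) * z (cut l))"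
  for z :: "nat \<Rightarrow> 'k::comm_ring_1"
proof -
  have "(\<Sum>i | i \<in> cuts \<and> i < p. z i) = (\<Sum>i\<in>cuts. of_bool (i < p) * z i)"
    using finite_cuts by (simp add: sum.inter_filter[symmetric] of_bool_def if_distrib[of "\<lambda>x. x * _"] cong: if_cong)
  also have "\<dots> = (\<Sum>l\<le>q. of_bool (cut l < p) * z (cut l))"
    unfolding cuts_def by (subst sum.reindex) (auto simp: inj_on_def cut_eq_iff)
  finally show ?thesis .
qed

text \<open>Adding up the equations at all vertices up to \<open>p\<close> telescopes: the chain contributes only the interval that starts at
  \<open>p\<close>, together with the cuts to the left of \<open>p\<close>.\<close>

lemma coeff0_partial_sum:
  fixes z :: "nat \<Rightarrow> 'k::field"
  assumes p: "p \<in> verts"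
  shows "(\<Sum>p' | p' \<in> verts \<and> p' \<le> p. \<Sum>i<n. coeff0 i p' * z i)
    = (if p < n then z p else 0) + (\<Sum>l\<le>q. of_bool (cut l < p) * z (cut l))"
proof -
  define W where "W = {p' \<in> verts. p' \<le> p}"
  have fin_W: "finite W"
    using finite_verts by (simp add: W_def)
  have delta: "(\<Sum>p'\<in>W. of_bool (p' = r)) = (of_bool (r \<in> W) :: 'k)" for r
    using fin_W by (simp add: of_bool_def)
  have inner: "(\<Sum>p'\<in>W. coeff0 i p') = (if i \<in> cuts then of_bool (i < p) else of_bool (i = p) :: 'k)"
    if i: "i < n" for i
  proof (cases "i \<in> cuts")
    case True
    have "i \<noteq> p"
      using True p by (auto simp: verts_def)
    then have "vert i \<in> W \<longleftrightarrow> i < p"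
      using vert_le_iff[OF less_imp_le[OF i] p] vert_props(2)[of i] i by (auto simp: W_def)
    then show ?thesis
      using True by (simp add: coeff0_def delta)
  next
    case False
    have "i \<in> W \<longleftrightarrow> i \<le> p"
      using False i by (auto simp: W_def verts_def)
    moreover have "vert (Suc i) \<in> W \<longleftrightarrow> Suc i \<le> p"
      using vert_le_iff[of "Suc i" p] vert_props(2)[of "Suc i"] i p by (auto simp: W_def)
    ultimately show ?thesis
      using False by (auto simp: coeff0_def sum_subtractf delta)
  qed
  have "(\<Sum>p'\<in>W. \<Sum>i<n. coeff0 i p' * z i) = (\<Sum>i<n. (\<Sum>p'\<in>W. coeff0 i p') * z i)"
    by (subst sum.swap) (simp add: sum_distrib_right)
  also have "\<dots> = (\<Sum>i<n. (if i = p then z i else 0) + (if i \<in> cuts \<and> i < p then z i else 0))"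
    using p by (intro sum.cong) (auto simp: inner verts_def)
  also have "\<dots> = (if p < n then z p else 0) + (\<Sum>i<n. if i \<in> cuts \<and> i < p then z i else 0)"
    by (simp add: sum.distrib)
  also have "(\<Sum>i<n. if i \<in> cuts \<and> i < p then z i else 0) = (\<Sum>i | i \<in> cuts \<and> i < p. z i)"
    using cuts_less by (intro sum.mono_neutral_cong_right) auto
  finally show ?thesis
    unfolding W_def sum_cuts .
qed

lemma coeff0_kernel_iff:
  fixes z :: "nat \<Rightarrow> 'k::field"
  shows "(\<forall>p\<in>verts. (\<Sum>i<n. coeff0 i p * z i) = 0) \<longleftrightarrow>
    (\<forall>p\<in>verts. (if p < n then z p else 0) + (\<Sum>l\<le>q. of_bool (cut l < p) * z (cut l)) = 0)"
  using all_zero_iff_partial_sums_zero[OF finite_verts, of "\<lambda>p. \<Sum>i<n. coeff0 i p * z i"]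
    coeff0_partial_sum[of _ z] by auto

lemma coeff1_cut: "l < q \<Longrightarrow> l' \<le> q \<Longrightarrow> coeff1 l (cut l') = of_bool (l' = l) - of_bool (l' = Suc l)"
  by (auto simp: coeff1_def cut_eq_iff cut_less_iff)

lemma coeff1_complex:
  assumes "l < q" "p \<in> verts"
  shows "(\<Sum>i<n. coeff1 l i * coeff0 i p) = (0 :: 'k::field)"
proof -
  have "(if p < n then coeff1 l p else 0) + (\<Sum>l'\<le>q. of_bool (cut l' < p) * coeff1 l (cut l')) = (0 :: 'k)"
    if p: "p \<in> verts" for p
  proof -
    have "(\<Sum>l'\<le>q. of_bool (cut l' < p) * coeff1 l (cut l'))
        = (\<Sum>l'\<le>q. (if l' = l then of_bool (cut l < p) else 0) -
                  (if l' = Suc l then of_bool (cut (Suc l) < p) else (0 :: 'k)))"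
      using assms(1) by (intro sum.cong refl) (auto simp: coeff1_cut)
    also have "\<dots> = of_bool (cut l < p) - of_bool (cut (Suc l) < p)"
      using assms(1) by (simp add: sum_subtractf)
    finally have sum: "(\<Sum>l'\<le>q. of_bool (cut l' < p) * coeff1 l (cut l'))
        = (of_bool (cut l < p) - of_bool (cut (Suc l) < p) :: 'k)" .
    show ?thesis
    proof (cases "p < n")
      case True
      have "p \<noteq> cut l"
        using p cut_in_cuts[of l] assms(1) by (auto simp: verts_def)
      then show ?thesis
        unfolding sum using True by (simp add: coeff1_def)
    next
      case False
      then have "cut l < p" "cut (Suc l) < p"
        using cut_less[of l] cut_less[of "Suc l"] assms(1) by auto
      then show ?thesis
        unfolding sum using False by simp
    qed
  qed
  then have "(\<Sum>i<n. coeff0 i p * coeff1 l i) = (0 :: 'k)"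
    using coeff0_kernel_iff[of "coeff1 l :: nat \<Rightarrow> 'k"] assms(2) by blast
  then show ?thesis
    by (simp add: mult.commute)
qed

text \<open>The partial sums over the cuts are the coefficients of the cycles. By the telescoped equations, an interval of the chain
  carries minus the partial sum over the cuts to its left, and the sum over all cuts vanishes.\<close>

lemma coeff1_exact:
  fixes z :: "nat \<Rightarrow> 'k::field"
  assumes ker: "\<And>p. p \<in> verts \<Longrightarrow> (\<Sum>i<n. coeff0 i p * z i) = 0" and i: "i < n"
  shows "z i = (\<Sum>l<q. coeff1 l i * (\<Sum>l'\<le>l. z (cut l')))"
    and "(\<Sum>l\<le>q. z (cut l)) = 0"
proof -
  have eq: "(if p < n then z p else 0) + (\<Sum>l\<le>q. of_bool (cut l < p) * z (cut l)) = 0"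
    if "p \<in> verts" for p
    using coeff0_kernel_iff[of z] ker that by blast
  have "(\<Sum>l\<le>q. of_bool (cut l < n) * z (cut l)) = (\<Sum>l\<le>q. z (cut l))"
    using cut_less by (intro sum.cong) auto
  then show total_0: "(\<Sum>l\<le>q. z (cut l)) = 0"
    using eq[OF n_in_verts] by simp
  define S where "S = (\<lambda>l. \<Sum>l'\<le>l. z (cut l'))"
  have "(\<Sum>l<q. coeff1 l i * S l) = (\<Sum>l<q. of_bool (i = cut l) * S l)
      - (\<Sum>l<q. (of_bool (cut l < i) - of_bool (cut (Suc l) < i)) * S l)"
    by (simp add: coeff1_def left_diff_distrib sum_subtractf)
  also have "(\<Sum>l<q. (of_bool (cut l < i) - of_bool (cut (Suc l) < i)) * S l)
      = (\<Sum>l\<le>q. of_bool (cut l < i) * z (cut l))"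
    unfolding S_def
    using partial_summation[of "\<lambda>l. of_bool (cut l < i)" "\<lambda>l. z (cut l)" q] total_0 by simp
  also have "(\<Sum>l<q. of_bool (i = cut l) * S l) - (\<Sum>l\<le>q. of_bool (cut l < i) * z (cut l)) = z i"
  proof (cases "i \<in> cuts")
    case True
    then obtain k where k: "k \<le> q" "i = cut k"
      by (auto simp: cuts_def)
    have "(\<Sum>l<q. of_bool (i = cut l) * S l) = (\<Sum>l<q. if l = k then S k else 0)"
      using k by (intro sum.cong) (auto simp: cut_eq_iff)
    also have "\<dots> = S k"
      using k total_0 by (auto simp: S_def)
    finally have 1: "(\<Sum>l<q. of_bool (i = cut l) * S l) = S k" .
    have 2: "(\<Sum>l\<le>q. of_bool (cut l < i) * z (cut l)) = (\<Sum>l<k. z (cut l))"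
      using k by (intro sum.mono_neutral_cong_right) (auto simp: cut_less_iff)
    have "S k = (\<Sum>l<k. z (cut l)) + z (cut k)"
      by (simp add: S_def lessThan_Suc_atMost[symmetric])
    then show ?thesis
      unfolding 1 2 using k(2) by simp
  next
    case False
    then have "i \<noteq> cut l" if "l < q" for l
      using cut_in_cuts[of l] that by auto
    then have "(\<Sum>l<q. of_bool (i = cut l) * S l) = 0"
      by (intro sum.neutral) auto
    moreover have "i \<in> verts"
      using False i by (simp add: verts_def)
    ultimately show ?thesis
      using eq[of i] i by (simp add: add_eq_0_iff)
  qed
  finally show "z i = (\<Sum>l<q. coeff1 l i * (\<Sum>l'\<le>l. z (cut l')))"
    unfolding S_def ..
qed

lemma coeff1_injective:
  fixes w :: "nat \<Rightarrow> 'k::field"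
  assumes zero: "\<And>i. i < n \<Longrightarrow> (\<Sum>l<q. coeff1 l i * w l) = 0" and "k < q"
  shows "w k = 0"
  using assms(2)
proof (induction k)
  case (Suc k)
  have "(\<Sum>l<q. coeff1 l (cut (Suc k)) * w l)
      = (\<Sum>l<q. (if l = Suc k then w l else 0) - (if l = k then w l else 0))"
    using Suc.prems by (intro sum.cong refl) (auto simp: coeff1_cut)
  then show ?case
    using zero[OF cut_less[of "Suc k"]] Suc by (simp add: sum_subtractf)
next
  case 0
  have "(\<Sum>l<q. coeff1 l (cut 0) * w l) = (\<Sum>l<q. if l = 0 then w l else 0)"
    by (intro sum.cong refl) (auto simp: coeff1_cut)
  then show ?case
    using zero[OF cut_less[of 0]] 0 by simp
qed

text \<open>Multidegrees, as pairs of exponents of the two variables, in terms of the line without cuts: an interval \<open>[s, t]\<close> has multidegree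
  \<open>(a - s, t)\<close>, hence total degree \<open>a\<close> plus its length, and multidegrees increase with intervals. Vertices are points. A cut, which the
  multiple \<open>l m\<close> divides into a left part of length \<open>v\<close> and a right part of length \<open>u\<close>, is the interval
  \<open>[h - u, h + v]\<close> around its vertex at height \<open>h\<close>. The interval of a cycle runs from the start of its first cut to the end of its second cut.
  It is made up of the right part of the first cut, the chain in between and the left part of the second cut, so it has length
  \<open>m\<close> (\<open>deg2_total\<close>).\<close>

definition deg0 :: "int \<Rightarrow> nat \<Rightarrow> int \<times> int" where
  "deg0 a p = (a - int (height p), int (height p))"

definition deg1 :: "int \<Rightarrow> nat \<Rightarrow> int \<times> int" where
  "deg1 a i = (if i \<in> cuts
     then let s = int (inv_into {..q} cut i * m)
       in (a - int (height i) + int (pos (Suc i)) - s, int (height i) + s - int (pos i))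
     else (a - int (height i), int (height i + e i)))"

definition deg2 :: "int \<Rightarrow> nat \<Rightarrow> int \<times> int" where
  "deg2 a l = (fst (deg1 a (cut l)), snd (deg1 a (cut (Suc l))))"

lemma deg1_cut:
  assumes "l \<le> q"
  shows "deg1 a (cut l) = (a - int (height (cut l)) + int (pos (Suc (cut l))) - int (l * m),
    int (height (cut l)) + int (l * m) - int (pos (cut l)))"
proof -
  have "inv_into {..q} cut (cut l) = l"
    using assms by (intro inv_into_f_f) (auto simp: inj_on_def cut_eq_iff)
  then show ?thesis
    using cut_in_cuts[OF assms] by (simp add: deg1_def Let_def)
qed

lemma deg0_total: "fst (deg0 a p) + snd (deg0 a p) = a"
  by (simp add: deg0_def)

lemma deg1_total: "fst (deg1 a i) + snd (deg1 a i) = a + int (e i)"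
  by (simp add: deg1_def Let_def pos_Suc)

lemma deg2_total:
  assumes "l < q"
  shows "fst (deg2 a l) + snd (deg2 a l) = a + int m"
proof -
  have "int (height (cut (Suc l))) + int (pos (Suc (cut l))) = int (height (cut l)) + int (pos (cut (Suc l)))"
    using height_between[OF assms cut_Suc[OF assms]] by linarith
  then show ?thesis
    using assms by (simp add: deg2_def deg1_cut algebra_simps)
qed

text \<open>The intervals of consecutive cuts move to the right at both ends. Indeed the end of the later one exceeds the start of
  the earlier one by \<open>m\<close>, which is more than the length of either.\<close>

lemma deg1_cut_step:
  assumes "l < q"
  shows "fst (deg1 a (cut (Suc l))) < fst (deg1 a (cut l))"
    and "snd (deg1 a (cut l)) < snd (deg1 a (cut (Suc l)))"
  using deg2_total[OF assms, of a] deg1_total[of a "cut l"] deg1_total[of a "cut (Suc l)"]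
    e_less[OF cut_less[of l]] e_less[OF cut_less[of "Suc l"]] assms
  by (auto simp: deg2_def)

lemma deg1_cut_mono:
  assumes "l \<le> l'" "l' \<le> q"
  shows "fst (deg1 a (cut l')) \<le> fst (deg1 a (cut l)) \<and> snd (deg1 a (cut l)) \<le> snd (deg1 a (cut l'))"
  using assms
proof (induction l')
  case (Suc l')
  then show ?case
    using deg1_cut_step[of l' a] by (cases "l = Suc l'") auto
qed simp

lemma deg0_le_deg1:
  assumes i: "i < n" and nz: "coeff0 i p \<noteq> (0 :: 'k::field)"
  shows "fst (deg0 a p) \<le> fst (deg1 a i) \<and> snd (deg0 a p) \<le> snd (deg1 a i)"
proof (cases "i \<in> cuts")
  case True
  then obtain l where l: "l \<le> q" "i = cut l"
    by (auto simp: cuts_def)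
  have "p = vert i"
    using True nz by (auto simp: coeff0_def split: if_splits)
  then have "height p = height i"
    using height_vert[of i] i by simp
  then show ?thesis
    using cut_upper[OF l(1)] cut_lower[of l] by (simp add: deg0_def l(2) deg1_cut[OF l(1)] del: of_nat_mult)
next
  case False
  then have "p = i \<or> p = vert (Suc i)"
    using nz by (auto simp: coeff0_def)
  then have "height p = height i \<or> height p = height i + e i"
    using height_vert[of "Suc i"] i False by (auto simp: height_Suc)
  then show ?thesis
    using False by (auto simp: deg0_def deg1_def)
qed

lemma deg1_le_deg2:
  assumes l: "l < q" and nz: "coeff1 l i \<noteq> (0 :: 'k::field)"
  shows "fst (deg1 a i) \<le> fst (deg2 a l) \<and> snd (deg1 a i) \<le> snd (deg2 a l)"
proof -
  have "i = cut l \<or> i = cut (Suc l) \<or> cut l < i \<and> i < cut (Suc l)"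
    using nz cut_Suc[OF l] by (force simp: coeff1_def of_bool_def split: if_splits)
  then consider "i = cut l" | "i = cut (Suc l)" | "cut l < i" "i < cut (Suc l)"
    by blast
  then show ?thesis
  proof cases
    case 3
    then have "i \<notin> cuts"
      by (rule between_cuts[OF l])
    moreover have "height (cut l) \<le> height i" "height (Suc i) \<le> height (cut (Suc l))"
      using 3 by (intro height_mono; simp)+
    ultimately show ?thesis
      using l cut_upper[of l] cut_lower[of "Suc l"]
      by (simp add: deg1_def[of _ i] deg2_def deg1_cut height_Suc del: of_nat_mult mult_Suc)
  qed (use deg1_cut_step[OF l, of a] in \<open>simp_all add: deg2_def\<close>)
qed

text \<open>If the partial sum up to \<open>l\<close> is not zero, some cut up to \<open>l\<close> occurs in \<open>z\<close>, and as the total sum is zero, some cut after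
  \<open>l\<close> occurs as well. The first bounds one exponent of the multidegree of the cycle, the second the other.\<close>

lemma deg2_support:
  fixes z :: "nat \<Rightarrow> 'k::field"
  assumes total: "(\<Sum>l\<le>q. z (cut l)) = 0" and l: "l < q" and nz: "(\<Sum>l'\<le>l. z (cut l')) \<noteq> 0"
    and supp: "\<And>i. z i \<noteq> 0 \<Longrightarrow> fst (deg1 a i) \<le> s \<and> snd (deg1 a i) \<le> t"
  shows "fst (deg2 a l) \<le> s \<and> snd (deg2 a l) \<le> t"
proof
  obtain l' where "l' \<le> l" "z (cut l') \<noteq> 0"
    using nz by (meson atMost_iff sum.neutral)
  then show "fst (deg2 a l) \<le> s"
    using supp[of "cut l'"] deg1_cut_mono[of l' l a] l by (simp add: deg2_def)
  have "{..q} = {..l} \<union> {Suc l..q}"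
    using l by auto
  then have "(\<Sum>l'\<le>q. z (cut l')) = (\<Sum>l'\<le>l. z (cut l')) + (\<Sum>l'\<in>{Suc l..q}. z (cut l'))"
    by (simp add: sum.union_disjoint)
  then have "(\<Sum>l'\<in>{Suc l..q}. z (cut l')) \<noteq> 0"
    using total nz by auto
  then obtain l'' where "l'' \<in> {Suc l..q}" "z (cut l'') \<noteq> 0"
    by (meson sum.neutral)
  then show "snd (deg2 a l) \<le> t"
    using supp[of "cut l''"] deg1_cut_mono[of "Suc l" l'' a] by (simp add: deg2_def)
qed

end

section \<open>Realising diagrams in one variable\<close>

text \<open>Elements are matched in order of increasing \<open>f\<close>. When \<open>x\<close> comes last, fewer elements of \<open>B\<close> are in use than there are
  candidates with value below \<open>f x\<close>.\<close>

lemma exists_matching: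
  fixes f :: "'a \<Rightarrow> int" and g :: "'b \<Rightarrow> int"
  assumes "finite A" "finite B"
    and "\<And>t. card {x \<in> A. f x \<le> t} \<le> card {y \<in> B. g y \<le> t - 1}"
  shows "\<exists>\<mu>. inj_on \<mu> A \<and> (\<forall>x\<in>A. \<mu> x \<in> B \<and> g (\<mu> x) < f x)"
  using assms(1,3)
proof (induction A rule: finite_ranking_induct[where f = f])
  case (insert x A)
  have fin: "finite {z \<in> insert x A. f z \<le> t}" for t
    using insert.hyps by simp
  have "card {z \<in> A. f z \<le> t} \<le> card {y \<in> B. g y \<le> t - 1}" for t
    using card_mono[OF fin[of t], of "{z \<in> A. f z \<le> t}"] insert.prems[of t] by fastforce
  then obtain \<mu> where \<mu>: "inj_on \<mu> A" "\<And>z. z \<in> A \<Longrightarrow> \<mu> z \<in> B \<and> g (\<mu> z) < f z"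
    using insert.IH by blast
  show ?case
  proof (cases "x \<in> A")
    case True
    then show ?thesis
      using \<mu> by (auto simp: insert_absorb)
  next
    case False
    have "card (\<mu> ` A) < card (insert x A)"
      using False insert.hyps \<mu>(1) by (simp add: card_image)
    also have "insert x A = {z \<in> insert x A. f z \<le> f x}"
      using insert.hyps by auto
    also have "card \<dots> \<le> card {y \<in> B. g y \<le> f x - 1}"
      by (rule insert.prems)
    finally have "\<not> {y \<in> B. g y \<le> f x - 1} \<subseteq> \<mu> ` A"
      using insert.hyps by (meson card_mono finite_imageI leD)
    then obtain y where y: "y \<in> B" "g y < f x" "y \<notin> \<mu> ` A"
      by auto
    then show ?thesis
      using \<mu> False by (intro exI[of _ "\<mu>(x := y)"]) (auto simp: inj_on_def)
  qed
qed simp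

text \<open>The map \<open>F\<^sub>1 \<rightarrow> F\<^sub>0\<close> sends each generator to a power of the variable times its partner in the matching.\<close>

lemma one_variable_in_B_mod:
  fixes vx :: "'v::finite"
  assumes UNIV: "UNIV = {vx}"
    and fin: "\<And>i. finite {j. b i j \<noteq> 0}"
    and bounds: "\<And>i j. b i j \<noteq> 0 \<Longrightarrow> i \<le> 1 \<and> int (dl i) \<le> j \<and> j \<le> int (du i)"
    and ineq: "\<And>t. card {e \<in> gens (b 1). fst e \<le> t} \<le> card {e \<in> gens (b 0). fst e \<le> t - 1}"
  shows "(\<lambda>i j. of_nat (b i j)) \<in> B_mod TYPE(('k::field, 'v) mpol) 1 dl du"
proof -
  obtain \<mu> where inj: "inj_on \<mu> (gens (b 1))"
    and matched: "\<forall>e\<in>gens (b 1). \<mu> e \<in> gens (b 0) \<and> fst (\<mu> e) < fst e"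
    using exists_matching[OF finite_gens[OF fin] finite_gens[OF fin] ineq] by blast
  have \<mu>: "\<mu> e \<in> gens (b 0)" "fst (\<mu> e) < fst e" if "e \<in> gens (b 1)" for e
    using bspec[OF matched that] by (rule conjunct1, rule conjunct2)
  define C :: "nat \<Rightarrow> int \<times> nat \<Rightarrow> int \<times> nat \<Rightarrow> 'k" where
    "C = (\<lambda>i e' e. of_bool (i = 0 \<and> e = \<mu> e'))"
  define D :: "nat \<Rightarrow> int \<times> nat \<Rightarrow> 'v \<Rightarrow> int" where "D = (\<lambda>i e v. fst e)"
  have empty: "gens (b (Suc i)) = {}" if "i > 0" for i
    using bounds[of "Suc i"] that by fastforce
  show ?thesis
  proof (rule multigraded_in_B_mod[where b = b and C = C and D = D])
    show "(\<Sum>v\<in>UNIV. D i e v) = fst e" for i e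
      by (simp add: UNIV D_def)
    show "D i e \<le> D (Suc i) e' \<and> fst e < fst e'"
      if "e' \<in> gens (b (Suc i))" "e \<in> gens (b i)" "C i e' e \<noteq> 0" for i e e'
    proof -
      have "i = 0" "e = \<mu> e'"
        using that(3) by (auto simp: C_def split: if_splits)
      then show ?thesis
        using \<mu>(2)[of e'] that(1) by (simp add: D_def le_fun_def)
    qed
    show "(\<Sum>e'\<in>gens (b (Suc i)). C (Suc i) e'' e' * C i e' e) = 0" for i e e''
      by (simp add: C_def)
    fix i u and z :: "int \<times> nat \<Rightarrow> 'k"
    assume supp: "\<And>e'. z e' \<noteq> 0 \<Longrightarrow> e' \<in> gens (b (Suc i)) \<and> D (Suc i) e' \<le> u"
      and ker: "\<And>e. e \<in> gens (b i) \<Longrightarrow> (\<Sum>e'\<in>gens (b (Suc i)). C i e' e * z e') = 0"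
    have "z e' = 0" for e'
    proof (cases "i = 0 \<and> e' \<in> gens (b 1)")
      case True
      then have e': "e' \<in> gens (b 1)"
        by simp
      have "(\<Sum>e\<in>gens (b 1). C 0 e (\<mu> e') * z e) = (\<Sum>e\<in>gens (b 1). if e = e' then z e else 0)"
      proof (rule sum.cong[OF refl])
        fix e assume "e \<in> gens (b 1)"
        then have "\<mu> e' = \<mu> e \<longleftrightarrow> e = e'"
          using inj_on_eq_iff[OF inj e'] by blast
        then show "C 0 e (\<mu> e') * z e = (if e = e' then z e else 0)"
          by (simp add: C_def)
      qed
      also have "\<dots> = z e'"
        using finite_gens[OF fin[of 1]] e' by simp
      finally show ?thesis
        using ker[of "\<mu> e'"] \<mu>(1)[OF e'] True by simp
    next
      case False
      then show ?thesis
        using supp[of e'] empty[of i] by (cases "i = 0") auto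
    qed
    then show "\<exists>w. (\<forall>e''. w e'' \<noteq> 0 \<longrightarrow> e'' \<in> gens (b (Suc (Suc i))) \<and> D (Suc (Suc i)) e'' \<le> u) \<and>
        (\<forall>e'\<in>gens (b (Suc i)). z e' = (\<Sum>e''\<in>gens (b (Suc (Suc i))). C (Suc i) e'' e' * w e''))"
      by (intro exI[of _ "\<lambda>_. 0"]) simp
  qed (fact fin bounds)+
qed

lemma gens_single_degree:
  assumes "\<And>j. b j \<noteq> 0 \<Longrightarrow> j = a"
  shows "gens b = Pair a ` {..<b a}"
proof (intro equalityI subsetI)
  fix e assume "e \<in> gens b"
  then have "snd e < b (fst e)"
    by auto
  moreover from this have "fst e = a"
    using assms[of "fst e"] by simp
  ultimately show "e \<in> Pair a ` {..<b a}"
    by (intro image_eqI[of _ _ "snd e"]) (auto simp: prod_eq_iff)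
qed auto

section \<open>Realising level diagrams in two variables\<close>

text \<open>The generators of \<open>F\<^sub>1\<close>, in any order, with the lengths \<open>j - a\<close> form a zigzag. It uses \<open>n - q\<close> generators of \<open>F\<^sub>0\<close>;
  the remaining ones split off as free summands, and their multidegree only needs to have total degree \<open>a\<close>.\<close>

lemma level_in_B_mod:
  fixes vx vy :: "'v::finite"
  assumes vars: "UNIV = {vx, vy}" "vx \<noteq> vy"
    and fin: "\<And>i. finite {j. b i j \<noteq> 0}"
    and bounds: "\<And>i j. b i j \<noteq> 0 \<Longrightarrow> i \<le> 2 \<and> int (dl i) \<le> j \<and> j \<le> int (du i)"
    and b0: "\<And>j. b 0 j \<noteq> 0 \<Longrightarrow> j = a" and b1: "\<And>j. b 1 j \<noteq> 0 \<Longrightarrow> a < j \<and> j < c"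
    and b2: "\<And>j. b 2 j \<noteq> 0 \<Longrightarrow> j = c" and ac: "a < c"
    and rank: "card (gens (b 1)) \<le> b 2 c + b 0 a"
    and degree: "nat (c - a) * b 2 c \<le> (\<Sum>e\<in>gens (b 1). nat (fst e - a))"
  shows "(\<lambda>i j. of_nat (b i j)) \<in> B_mod TYPE(('k::field, 'v) mpol) 2 dl du"
proof -
  define n where "n = card (gens (b 1))"
  define q where "q = b 2 c"
  define m where "m = nat (c - a)"
  have empty: "gens (b i) = {}" if "i > 2" for i
    using bounds[of i] that by fastforce
  have gens0: "gens (b 0) = Pair a ` {..<b 0 a}"
    by (rule gens_single_degree) (rule b0)
  have gens2: "gens (b 2) = Pair c ` {..<q}"
    unfolding q_def by (rule gens_single_degree) (rule b2)
  have fin1: "finite (gens (b 1))"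
    by (rule finite_gens[OF fin])
  show ?thesis
  proof (cases "n = 0")
\<comment> \<open>without relations there are no syzygies either, and the module is free\<close>
    case True
    then have empty1: "gens (b 1) = {}"
      using fin1 by (simp only: n_def card_0_eq)
    moreover have "q = 0"
      using degree ac unfolding empty1 by (simp add: q_def)
    ultimately have empty': "gens (b (Suc i)) = {}" for i
      using empty[of "Suc i"] gens2 by (cases "i = 0 \<or> i = 1") (auto simp: numeral_2_eq_2)
    show ?thesis
    proof (rule multigraded_in_B_mod[where b = b and C = "\<lambda>_ _ _. 0"
          and D = "\<lambda>_ e v. if v = vx then fst e else 0"])
      show "(\<Sum>v\<in>UNIV. if v = vx then fst e else 0) = fst e" for e :: "int \<times> nat"
        using vars by simp
    qed ((fact fin bounds)+, use empty' in auto)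
  next
    case False
    have "\<exists>col. bij_betw col {..<n} (gens (b 1))"
      using ex_bij_betw_nat_finite[OF fin1] unfolding n_def atLeast0LessThan .
    then obtain col where col: "bij_betw col {..<n} (gens (b 1))" ..
    have col_gens: "col i \<in> gens (b 1)" if "i < n" for i
      by (rule bij_betw_apply[OF col]) (use that in simp)
    have col_surj: "\<exists>j<n. e = col j" if "e \<in> gens (b 1)" for e
    proof -
      have "e \<in> col ` {..<n}"
        unfolding bij_betw_imp_surj_on[OF col] by (rule that)
      then show ?thesis
        by blast
    qed
    have sum_col: "(\<Sum>e\<in>gens (b 1). f e) = (\<Sum>i<n. f (col i))" for f :: "_ \<Rightarrow> 'b::comm_monoid_add"
      by (rule sum.reindex_bij_betw[OF col, symmetric])
    define len where "len = (\<lambda>i. nat (fst (col i) - a))"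
    have len: "a + int (len i) = fst (col i)" "0 < len i" "len i < m" if "i < n" for i
      using b1[of "fst (col i)"] col_gens[OF that] by (auto simp: len_def m_def)
    interpret zigzag len n m q
      using len(2,3) degree False unfolding sum_col by unfold_locales (auto simp: len_def m_def q_def mult.commute)
    have "card verts \<le> card (gens (b 0))"
      using rank unfolding gens0 card_verts by (simp add: card_image inj_on_def n_def q_def)
    then obtain \<nu> where \<nu>: "\<nu> ` verts \<subseteq> gens (b 0)" "inj_on \<nu> verts"
      using card_le_inj[OF finite_verts finite_gens[OF fin[of 0]]] by blast
    define row where "row = inv_into {..<n} col"
    have row: "row (col i) = i" if "i < n" for i
      unfolding row_def using col that by (intro inv_into_f_f) (auto simp: bij_betw_def)
    define vt where "vt = inv_into verts \<nu>"
    have vt: "vt (\<nu> p) = p" if "p \<in> verts" for p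
      unfolding vt_def using \<nu>(2) that by (rule inv_into_f_f)
    define C :: "nat \<Rightarrow> int \<times> nat \<Rightarrow> int \<times> nat \<Rightarrow> 'k" where
      "C = (\<lambda>i e' e. if i = 0 then if e \<in> \<nu> ` verts then coeff0 (row e') (vt e) else 0
         else if i = 1 then coeff1 (snd e') (row e) else 0)"
    define d :: "nat \<Rightarrow> int \<times> nat \<Rightarrow> int \<times> int" where
      "d = (\<lambda>i e. if i = 0 then if e \<in> \<nu> ` verts then deg0 a (vt e) else (a, 0)
         else if i = 1 then deg1 a (row e) else deg2 a (snd e))"
    define D :: "nat \<Rightarrow> int \<times> nat \<Rightarrow> 'v \<Rightarrow> int" where
      "D = (\<lambda>i e v. if v = vx then fst (d i e) else snd (d i e))"
    have D_le: "D i e \<le> u \<longleftrightarrow> fst (d i e) \<le> u vx \<and> snd (d i e) \<le> u vy" for i e u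
    proof -
      have "(\<forall>v. P v) \<longleftrightarrow> P vx \<and> P vy" for P :: "'v \<Rightarrow> bool"
        using vars(1) by (metis UNIV_I empty_iff insert_iff)
      then show ?thesis
        using vars(2) by (simp add: le_fun_def D_def)
    qed
    have d_col: "d (Suc 0) (col i) = deg1 a i" if "i < n" for i
      by (simp add: d_def row[OF that])
    have d_top: "d 2 (c, l) = deg2 a l" for l
      by (simp add: d_def)
    have C0: "C 0 (col i) (\<nu> p) = coeff0 i p" if "i < n" "p \<in> verts" for i p
      using that by (simp add: C_def row vt)
    have C1: "C 1 (c, l) (col i) = coeff1 l i" if "i < n" for i l
      by (simp add: C_def row[OF that])
    have sum_top: "(\<Sum>e\<in>gens (b 2). f e) = (\<Sum>l<q. f (c, l))" for f :: "_ \<Rightarrow> 'k"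
      unfolding gens2 by (subst sum.reindex) (auto simp: inj_on_def)
    show ?thesis
    proof (rule multigraded_in_B_mod[where b = b and C = C and D = D])
      show "(\<Sum>v\<in>UNIV. D i e v) = fst e" if e: "e \<in> gens (b i)" for i e
      proof -
        have "(\<Sum>v\<in>UNIV. D i e v) = fst (d i e) + snd (d i e)"
          unfolding vars(1) using vars(2) by (simp add: D_def)
        also have "\<dots> = fst e"
        proof -
          have "\<not> 2 < i"
            using e empty[of i] by blast
          then consider "i = 0" | "i = 1" | "i = 2"
            by linarith
          then show ?thesis
          proof cases
            case 1
            then have "fst e = a"
              using e gens0 by auto
            then show ?thesis
              using 1 by (simp add: d_def deg0_total)
          next
            case 2
            then have "e \<in> gens (b 1)"
              using e by simp
            then obtain j where "j < n" "e = col j"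
              using col_surj by blast
            then show ?thesis
              using 2 len(1)[of j] deg1_total[of a j] by (simp add: d_col)
          next
            case 3
            then have "e \<in> gens (b 2)"
              using e by simp
            then obtain l where "l < q" "e = (c, l)"
              unfolding gens2 by blast
            then show ?thesis
              using 3 deg2_total[of l a] ac by (simp add: d_top m_def)
          qed
        qed
        finally show ?thesis .
      qed
    next
      fix i e e'
      assume e': "e' \<in> gens (b (Suc i))" and e: "e \<in> gens (b i)" and nz: "C i e' e \<noteq> 0"
      have "\<not> 2 < Suc i"
        using e' empty[of "Suc i"] by blast
      then consider "i = 0" | "i = 1"
        by linarith
      then show "D i e \<le> D (Suc i) e' \<and> fst e < fst e'"
      proof cases
        case 1
        then have "e' \<in> gens (b 1)"
          using e' by simp
        then obtain j where j: "j < n" "e' = col j"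
          using col_surj by blast
        obtain p where p: "p \<in> verts" "e = \<nu> p"
          using nz 1 by (auto simp: C_def split: if_splits)
        have "coeff0 j p \<noteq> (0 :: 'k)"
          using nz 1 j p C0 by simp
        from deg0_le_deg1[OF j(1) this, of a] have "D 0 e \<le> D 1 e'"
          unfolding D_le using j p vars(2) by (simp add: D_def d_def row vt)
        moreover have "fst e = a" "a < fst e'"
          using e e' 1 gens0 b1 by auto
        ultimately show ?thesis
          using 1 by simp
      next
        case 2
        then have "e \<in> gens (b 1)"
          using e by simp
        then obtain j where j: "j < n" "e = col j"
          using col_surj by blast
        have "e' \<in> gens (b 2)"
          using e' 2 by (simp add: numeral_2_eq_2)
        then obtain l where l: "l < q" "e' = (c, l)"
          unfolding gens2 by blast
        have "coeff1 l j \<noteq> (0 :: 'k)"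
          using nz 2 j l C1 by simp
        from deg1_le_deg2[OF l(1) this, of a] have "D 1 e \<le> D 2 e'"
          unfolding D_le using j l vars(2) by (simp add: D_def d_def row)
        moreover have "fst e < c"
          using e 2 b1 by auto
        ultimately show ?thesis
          using 2 l by (simp add: numeral_2_eq_2)
      qed
    next
      fix i e'' e
      assume e'': "e'' \<in> gens (b (Suc (Suc i)))" and e: "e \<in> gens (b i)"
      have "\<not> 2 < Suc (Suc i)"
        using e'' empty[of "Suc (Suc i)"] by blast
      then have i: "i = 0"
        by linarith
      have "e'' \<in> gens (b 2)"
        using e'' by (simp add: i numeral_2_eq_2)
      then obtain l where l: "l < q" "e'' = (c, l)"
        unfolding gens2 by blast
      have "(\<Sum>e'\<in>gens (b 1). C 1 e'' e' * C 0 e' e) = 0"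
      proof (cases "e \<in> \<nu> ` verts")
        case True
        then obtain p where p: "p \<in> verts" "e = \<nu> p"
          by blast
        have "(\<Sum>e'\<in>gens (b 1). C 1 e'' e' * C 0 e' e) = (\<Sum>i<n. coeff1 l i * coeff0 i p)"
          unfolding sum_col l(2) p(2) by (intro sum.cong refl) (simp only: lessThan_iff C0[OF _ p(1)] C1)
        then show ?thesis
          using coeff1_complex[OF l(1) p(1)] by simp
      qed (simp add: C_def)
      then show "(\<Sum>e'\<in>gens (b (Suc i)). C (Suc i) e'' e' * C i e' e) = 0"
        by (simp add: i)
    next
      fix i u and z :: "int \<times> nat \<Rightarrow> 'k"
      assume supp: "\<And>e'. z e' \<noteq> 0 \<Longrightarrow> e' \<in> gens (b (Suc i)) \<and> D (Suc i) e' \<le> u"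
        and ker: "\<And>e. e \<in> gens (b i) \<Longrightarrow> (\<Sum>e'\<in>gens (b (Suc i)). C i e' e * z e') = 0"
      let ?goal = "\<exists>w. (\<forall>e''. w e'' \<noteq> 0 \<longrightarrow> e'' \<in> gens (b (Suc (Suc i))) \<and> D (Suc (Suc i)) e'' \<le> u) \<and>
          (\<forall>e'\<in>gens (b (Suc i)). z e' = (\<Sum>e''\<in>gens (b (Suc (Suc i))). C (Suc i) e'' e' * w e''))"
      have trivial: ?goal if "\<And>e'. z e' = 0"
        using that by (intro exI[of _ "\<lambda>_. 0"]) simp
      consider "i = 0" | "i = 1" | "i \<ge> 2"
        by linarith
      then show ?goal
      proof cases
        case 1
        define y where "y = (\<lambda>i. if i < n then z (col i) else 0)"
        have y_ker: "(\<Sum>i<n. coeff0 i p * y i) = 0" if p: "p \<in> verts" for p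
        proof -
          have "(\<Sum>i<n. coeff0 i p * y i) = (\<Sum>e'\<in>gens (b 1). C 0 e' (\<nu> p) * z e')"
            unfolding sum_col by (intro sum.cong refl) (simp add: C0[OF _ p] y_def)
          also have "\<dots> = 0"
            using ker[of "\<nu> p"] \<nu>(1) p 1 by auto
          finally show ?thesis .
        qed
        have y_supp: "fst (deg1 a i) \<le> u vx \<and> snd (deg1 a i) \<le> u vy" if "y i \<noteq> 0" for i
        proof -
          have "i < n" "z (col i) \<noteq> 0"
            using that by (auto simp: y_def split: if_splits)
          then show ?thesis
            using supp[of "col i"] 1 d_col[of i] by (simp add: D_le)
        qed
        have y_total: "(\<Sum>l\<le>q. y (cut l)) = 0"
          by (rule coeff1_exact(2)[OF y_ker]) (use n_pos in auto)
        define w where "w = (\<lambda>e''. if e'' \<in> gens (b 2) then \<Sum>l\<le>snd e''. y (cut l) else 0)"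
        have "e'' \<in> gens (b 2) \<and> D 2 e'' \<le> u" if nz: "w e'' \<noteq> 0" for e''
        proof -
          have in_gens: "e'' \<in> gens (b 2)" and nz': "(\<Sum>l\<le>snd e''. y (cut l)) \<noteq> 0"
            using nz unfolding w_def by presburger+
          then obtain l where l: "l < q" "e'' = (c, l)"
            unfolding gens2 by blast
          have "D 2 e'' \<le> u"
            using deg2_support[OF y_total l(1) _ y_supp] nz' by (simp add: D_le l(2) d_top)
          with in_gens show ?thesis
            by blast
        qed
        moreover have "z e' = (\<Sum>e''\<in>gens (b 2). C 1 e'' e' * w e'')" if e': "e' \<in> gens (b 1)" for e'
        proof -
          obtain j where j: "j < n" "e' = col j"
            using col_surj[OF e'] by blast
          have "(\<Sum>e''\<in>gens (b 2). C 1 e'' e' * w e'') = (\<Sum>l<q. coeff1 l j * (\<Sum>l'\<le>l. y (cut l')))"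
            unfolding sum_top j(2) C1[OF j(1)] by (intro sum.cong refl) (auto simp: w_def gens2)
          also have "\<dots> = y j"
            using coeff1_exact(1)[OF y_ker j(1)] by simp
          finally show ?thesis
            using j by (simp add: y_def)
        qed
        ultimately show ?thesis
          unfolding 1 by (intro exI[of _ w]) (auto simp: numeral_2_eq_2)
      next
        case 2
        have "(\<Sum>l<q. coeff1 l i * z (c, l)) = 0" if "i < n" for i
        proof -
          have "(\<Sum>l<q. coeff1 l i * z (c, l)) = (\<Sum>e'\<in>gens (b 2). C 1 e' (col i) * z e')"
            unfolding sum_top C1[OF that] ..
          also have "\<dots> = 0"
            using ker[of "col i"] col_gens[OF that] 2 by (simp add: numeral_2_eq_2)
          finally show ?thesis .
        qed
        then have z_top: "z (c, l) = 0" if "l < q" for l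
          using coeff1_injective[of "\<lambda>l. z (c, l)"] that by blast
        have "z e' = 0" for e'
        proof (rule ccontr)
          assume nz: "z e' \<noteq> 0"
          then have "e' \<in> gens (b 2)"
            using supp[of e'] 2 by (simp add: numeral_2_eq_2)
          then show False
            using nz z_top unfolding gens2 by auto
        qed
        then show ?thesis
          by (rule trivial)
      next
        case 3
        then have "z e' = 0" for e'
          using supp[of e'] empty[of "Suc i"] by auto
        then show ?thesis
          by (rule trivial)
      qed
    qed (fact fin bounds)+
  qed
qed

section \<open>The cone\<close>

lemma rational_cone_induct:
  assumes "v \<in> rational_cone G" and "P (\<lambda>_ _. 0)"
    and step: "\<And>r g x. g \<in> G \<Longrightarrow> 0 \<le> r \<Longrightarrow> P x \<Longrightarrow> P (\<lambda>i j. r * g i j + x i j)"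
  shows "P v"
proof -
  obtain A r where A: "finite A" "A \<subseteq> G" "\<forall>g\<in>A. 0 \<le> r g" and v: "v = (\<lambda>i j. \<Sum>g\<in>A. r g * g i j)"
    using assms(1) unfolding rational_cone_def by blast
  have "P (\<lambda>i j. \<Sum>g\<in>A. r g * g i j)"
    using A
  proof (induction A rule: finite_induct)
    case empty
    then show ?case
      using assms(2) by simp
  next
    case (insert g A)
    then show ?case
      using step[of g "r g" "\<lambda>i j. \<Sum>g\<in>A. r g * g i j"] by simp
  qed
  then show ?thesis
    by (simp add: v)
qed

lemma B_mod_subset_B_N: "B_mod S p dl du \<subseteq> B_N S p dl du"
proof
  fix v assume v: "v \<in> B_mod S p dl du"
  then have "v \<in> B_Q S p dl du"
    unfolding B_Q_def rational_cone_def
    by (intro CollectI exI[of _ "{v}"] exI[of _ "\<lambda>_. 1"]) simp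
  moreover have "v i j \<in> \<int>" for i j
    using v by (auto simp: B_mod_def)
  ultimately show "v \<in> B_N S p dl du"
    by (simp add: B_N_def)
qed

lemma B_mod_resolution:
  assumes "v \<in> B_mod TYPE(('k::field, 'v::finite) mpol) p dl du"
  obtains b and \<phi> :: "nat \<Rightarrow> (int \<times> nat \<Rightarrow> ('k::field, 'v::finite) mpol) \<Rightarrow> int \<times> nat \<Rightarrow> ('k, 'v) mpol"
  where "v = (\<lambda>i j. of_nat (b i j))" "\<And>i. finite {j. b i j \<noteq> 0}"
    "\<And>i j. b i j \<noteq> 0 \<Longrightarrow> i \<le> p \<and> int (dl i) \<le> j \<and> j \<le> int (du i)"
    "\<And>i. \<phi> i \<in> graded_hom (graded_free (b (Suc i))) (graded_free (b i))"
    "\<And>i x. x \<in> carrier (graded_free (b (Suc i))) \<Longrightarrow>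
      \<phi> i x = (\<lambda>_. 0) \<longleftrightarrow> (\<exists>y\<in>carrier (graded_free (b (Suc (Suc i)))). x = \<phi> (Suc i) y)"
    "\<And>i x e. x \<in> carrier (graded_free (b (Suc i))) \<Longrightarrow> \<phi> i x e \<in> irrelevant_ideal"
proof -
  obtain b and M :: "(('k, 'v) mpol, (int \<times> nat \<Rightarrow> ('k, 'v) mpol) set) graded_module"
    where v: "v = (\<lambda>i j. of_nat (b i j))" and betti: "has_betti_numbers M b"
      and bounds: "\<And>i j. b i j \<noteq> 0 \<Longrightarrow> i \<le> p \<and> int (dl i) \<le> j \<and> j \<le> int (du i)"
    using assms unfolding B_mod_def by blast
  obtain \<phi> \<epsilon> where res: "resolves (\<lambda>i. graded_free (b i)) \<phi> \<epsilon> M"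
    and \<phi>: "\<And>i. \<phi> i \<in> graded_hom (graded_free (b (Suc i))) (graded_free (b i))"
      "\<And>i x e. x \<in> carrier (graded_free (b (Suc i))) \<Longrightarrow> \<phi> i x e \<in> irrelevant_ideal"
    using betti unfolding has_betti_numbers_def by blast
  have "mod_ker (graded_free (b (Suc i))) (graded_free (b i)) (\<phi> i)
      = \<phi> (Suc i) ` carrier (graded_free (b (Suc (Suc i))))" for i
    using res unfolding resolves_def by blast
  then have "\<phi> i x = (\<lambda>_. 0) \<longleftrightarrow> (\<exists>y\<in>carrier (graded_free (b (Suc (Suc i)))). x = \<phi> (Suc i) y)"
    if "x \<in> carrier (graded_free (b (Suc i)))" for i x
    using that by (auto simp: mod_ker_def graded_free_simps(2) set_eq_iff)
  moreover have "finite {j. b i j \<noteq> 0}" for i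
    using betti unfolding has_betti_numbers_def by blast
  ultimately show ?thesis
    using that v bounds \<phi> by blast
qed

lemma carrier_graded_free_trivial:
  assumes "\<And>j. b j = 0"
  shows "carrier (graded_free b) = {\<lambda>_. 0}"
  using assms by (auto simp: graded_free_simps)

lemma integral_diagram:
  fixes v :: "nat \<Rightarrow> int \<Rightarrow> rat"
  assumes "\<And>i j. v i j \<in> \<int>" "\<And>i j. 0 \<le> v i j"
  obtains b :: "nat \<Rightarrow> int \<Rightarrow> nat" where "v = (\<lambda>i j. of_nat (b i j))"
proof
  show "v = (\<lambda>i j. of_nat (nat \<lfloor>v i j\<rfloor>))"
  proof (intro ext)
    fix i j
    obtain k where k: "v i j = of_int k"
      by (rule Ints_cases[OF assms(1)])
    then have "0 \<le> k"
      using assms(2)[of i j] by simp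
    with k show "v i j = of_nat (nat \<lfloor>v i j\<rfloor>)"
      by simp
  qed
qed

lemma one_variable:
  fixes vx :: "'v::finite"
  assumes UNIV: "UNIV = {vx}"
  shows "B_N TYPE(('k::field, 'v) mpol) 1 dl du = B_mod TYPE(('k, 'v) mpol) 1 dl du"
proof (intro equalityI B_mod_subset_B_N subsetI)
  fix v assume v: "v \<in> B_N TYPE(('k, 'v) mpol) 1 dl du"
  define P where "P = (\<lambda>v :: nat \<Rightarrow> int \<Rightarrow> rat. (\<forall>i j. 0 \<le> v i j) \<and>
    (\<forall>i j. v i j \<noteq> 0 \<longrightarrow> i \<le> 1 \<and> int (dl i) \<le> j \<and> j \<le> int (du i)) \<and>
    (\<forall>t. (\<Sum>j\<in>{int (dl 1)..t}. v 1 j) \<le> (\<Sum>j\<in>{int (dl 0)..t - 1}. v 0 j)))"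
  have P_mod: "P g" if "g \<in> B_mod TYPE(('k, 'v) mpol) 1 dl du" for g
    using that
  proof (rule B_mod_resolution)
    fix b and \<phi> :: "nat \<Rightarrow> (int \<times> nat \<Rightarrow> ('k, 'v) mpol) \<Rightarrow> int \<times> nat \<Rightarrow> ('k, 'v) mpol"
    assume g: "g = (\<lambda>i j. of_nat (b i j))" and fin: "\<And>i. finite {j. b i j \<noteq> 0}"
      and bounds: "\<And>i j. b i j \<noteq> 0 \<Longrightarrow> i \<le> 1 \<and> int (dl i) \<le> j \<and> j \<le> int (du i)"
      and \<phi>: "\<And>i. \<phi> i \<in> graded_hom (graded_free (b (Suc i))) (graded_free (b i))"
      and exact: "\<And>i x. x \<in> carrier (graded_free (b (Suc i))) \<Longrightarrow>
        \<phi> i x = (\<lambda>_. 0) \<longleftrightarrow> (\<exists>y\<in>carrier (graded_free (b (Suc (Suc i)))). x = \<phi> (Suc i) y)"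
      and minimal: "\<And>i x e. x \<in> carrier (graded_free (b (Suc i))) \<Longrightarrow> \<phi> i x e \<in> irrelevant_ideal"
    have triv: "carrier (graded_free (b 2)) = {\<lambda>_. 0 :: ('k, 'v) mpol}"
      using bounds[of 2] by (intro carrier_graded_free_trivial) fastforce
    have "card {e \<in> gens (b 1). fst e \<le> t} \<le> card {e \<in> gens (b 0). fst e \<le> t - 1}" for t
    proof (rule strand_inequality_one[OF UNIV fin fin, of "\<phi> 0"])
      show "\<phi> 0 \<in> graded_hom (graded_free (b 1)) (graded_free (b 0))"
        using \<phi>[of 0] by simp
      show "\<phi> 0 x e \<in> irrelevant_ideal" if "x \<in> carrier (graded_free (b 1))" for x e
        using minimal[of x 0] that by simp
      show "x = (\<lambda>_. 0)" if "x \<in> carrier (graded_free (b 1))" "\<phi> 0 x = (\<lambda>_. 0)" for x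
        using exact[of x 0] that triv mod_hom_0[OF graded_hom_D(1)[OF \<phi>[of 1]]]
        by (simp add: numeral_2_eq_2)
    qed
    moreover have lo: "int (dl i) \<le> j" if "b i j \<noteq> 0" for i j
      using bounds[OF that] by simp
    ultimately have "(\<Sum>j\<in>{int (dl 1)..t}. b 1 j) \<le> (\<Sum>j\<in>{int (dl 0)..t - 1}. b 0 j)" for t
      by (simp only: card_gens_le[OF fin lo])
    then show "P g"
      unfolding P_def g using bounds by (auto simp: of_nat_sum[symmetric] simp del: of_nat_sum)
  qed
  have "v \<in> rational_cone (B_mod TYPE(('k, 'v) mpol) 1 dl du)"
    using v by (simp add: B_N_def B_Q_def)
  then have "P v"
  proof (rule rational_cone_induct)
    show "P (\<lambda>_ _. 0)"
      by (simp add: P_def)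
    fix r :: rat and g x
    assume "g \<in> B_mod TYPE(('k, 'v) mpol) 1 dl du" and r: "0 \<le> r" and x: "P x"
    then have g: "P g"
      using P_mod by blast
    have "0 \<le> r * g i j + x i j" for i j
      using g x r by (simp add: P_def)
    moreover have "i \<le> 1 \<and> int (dl i) \<le> j \<and> j \<le> int (du i)" if "r * g i j + x i j \<noteq> 0" for i j
    proof -
      have "g i j \<noteq> 0 \<or> x i j \<noteq> 0"
        using that by auto
      then show ?thesis
        using g x unfolding P_def by blast
    qed
    moreover have "(\<Sum>j\<in>{int (dl 1)..t}. r * g 1 j + x 1 j) \<le> (\<Sum>j\<in>{int (dl 0)..t - 1}. r * g 0 j + x 0 j)" for t
      using g x r unfolding P_def sum.distrib sum_distrib_left[symmetric]
      by (intro add_mono mult_left_mono) auto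
    ultimately show "P (\<lambda>i j. r * g i j + x i j)"
      unfolding P_def by blast
  qed
  then have nonneg: "\<And>i j. 0 \<le> v i j"
    and supp: "\<And>i j. v i j \<noteq> 0 \<Longrightarrow> i \<le> 1 \<and> int (dl i) \<le> j \<and> j \<le> int (du i)"
    and ineq: "\<And>t. (\<Sum>j\<in>{int (dl 1)..t}. v 1 j) \<le> (\<Sum>j\<in>{int (dl 0)..t - 1}. v 0 j)"
    unfolding P_def by blast+
  obtain b where b: "v = (\<lambda>i j. of_nat (b i j))"
    using integral_diagram[of v] v nonneg unfolding B_N_def by blast
  have bounds: "i \<le> 1 \<and> int (dl i) \<le> j \<and> j \<le> int (du i)" if "b i j \<noteq> 0" for i j
    using supp[of i j] that by (simp add: b)
  have fin: "finite {j. b i j \<noteq> 0}" for i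
    by (rule finite_subset[of _ "{int (dl i)..int (du i)}"]) (use bounds in auto)
  have "(\<Sum>j\<in>{int (dl 1)..t}. b 1 j) \<le> (\<Sum>j\<in>{int (dl 0)..t - 1}. b 0 j)" for t
    using ineq[of t] by (simp add: b of_nat_sum[symmetric] del: of_nat_sum)
  moreover have lo: "int (dl i) \<le> j" if "b i j \<noteq> 0" for i j
    using bounds[OF that] by simp
  ultimately have card: "card {e \<in> gens (b 1). fst e \<le> t} \<le> card {e \<in> gens (b 0). fst e \<le> t - 1}" for t
    by (simp only: card_gens_le[OF fin lo])
  show "v \<in> B_mod TYPE(('k, 'v) mpol) 1 dl du"
    unfolding b by (rule one_variable_in_B_mod[where b = b]) (fact UNIV fin bounds card)+
qed

text \<open>The bounds \<open>a < j < c\<close> for the degrees of the generators of \<open>F\<^sub>1\<close>, on which the construction depends, come from the degree sequences.\<close>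

lemma two_variables_level:
  fixes vx vy :: "'v::finite"
  assumes vars: "UNIV = {vx, vy}" "vx \<noteq> vy"
    and dl: "degree_sequence 2 dl" and du: "degree_sequence 2 du"
    and level: "dl 0 = du 0" "dl 2 = du 2"
  shows "B_N TYPE(('k::field, 'v) mpol) 2 dl du = B_mod TYPE(('k, 'v) mpol) 2 dl du"
proof (intro equalityI B_mod_subset_B_N subsetI)
  fix v assume v: "v \<in> B_N TYPE(('k, 'v) mpol) 2 dl du"
  define a c where "a = int (dl 0)" "c = int (dl 2)"
  define I where "I = {int (dl 1)..int (du 1)}"
  have increasing: "dl 0 < dl 1" "dl 1 < dl 2" "du 1 < du 2"
    using dl[unfolded degree_sequence_def, rule_format, of 0]
      dl[unfolded degree_sequence_def, rule_format, of 1]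
      du[unfolded degree_sequence_def, rule_format, of 1] by (simp_all add: numeral_2_eq_2)
  then have lo: "a < int (dl 1)" and hi: "int (du 1) < c" and ac: "a < c"
    using level by (simp_all add: a_c_def)
  define P where "P = (\<lambda>v :: nat \<Rightarrow> int \<Rightarrow> rat. (\<forall>i j. 0 \<le> v i j) \<and>
    (\<forall>i j. v i j \<noteq> 0 \<longrightarrow> i \<le> 2 \<and> int (dl i) \<le> j \<and> j \<le> int (du i)) \<and>
    (\<Sum>j\<in>I. v 1 j) \<le> v 2 c + v 0 a \<and>
    of_nat (nat (c - a)) * v 2 c \<le> (\<Sum>j\<in>I. of_nat (nat (j - a)) * v 1 j))"
  have counts: "card (gens (b 1)) = (\<Sum>j\<in>I. b 1 j)"
      "(\<Sum>e\<in>gens (b 1). nat (fst e - a)) = (\<Sum>j\<in>I. nat (j - a) * b 1 j)"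
      "card (gens (b 0)) = b 0 a" "card (gens (b 2)) = b 2 c"
      "b 0 j \<noteq> 0 \<Longrightarrow> j = a" "b 1 j \<noteq> 0 \<Longrightarrow> a < j \<and> j < c" "b 2 j \<noteq> 0 \<Longrightarrow> j = c"
    if fin: "\<And>i. finite {j. b i j \<noteq> 0}"
      and bounds: "\<forall>i j. b i j \<noteq> 0 \<longrightarrow> i \<le> 2 \<and> int (dl i) \<le> j \<and> j \<le> int (du i)"
    for b :: "nat \<Rightarrow> int \<Rightarrow> nat" and j
  proof -
    have I: "{j. b 1 j \<noteq> 0} \<subseteq> I"
      using bounds by (auto simp: I_def)
    show "card (gens (b 1)) = (\<Sum>j\<in>I. b 1 j)"
    proof -
      have "card (gens (b 1)) = (\<Sum>j\<in>{j. b 1 j \<noteq> 0}. b 1 j)"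
        using sum_gens[OF fin[of 1], of "\<lambda>_. 1 :: nat"] by simp
      also have "\<dots> = (\<Sum>j\<in>I. b 1 j)"
        using I by (intro sum.mono_neutral_left) (auto simp: I_def)
      finally show ?thesis .
    qed
    show "(\<Sum>e\<in>gens (b 1). nat (fst e - a)) = (\<Sum>j\<in>I. nat (j - a) * b 1 j)"
    proof -
      have "(\<Sum>e\<in>gens (b 1). nat (fst e - a)) = (\<Sum>j\<in>{j. b 1 j \<noteq> 0}. nat (j - a) * b 1 j)"
        using sum_gens[OF fin[of 1], of "\<lambda>j. nat (j - a)"] by (simp add: mult.commute)
      also have "\<dots> = (\<Sum>j\<in>I. nat (j - a) * b 1 j)"
        using I by (intro sum.mono_neutral_left) (auto simp: I_def)
      finally show ?thesis .
    qed
    show b0: "b 0 j \<noteq> 0 \<Longrightarrow> j = a" for j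
      using bounds[rule_format, of 0 j] level by (simp add: a_c_def)
    show b2: "b 2 j \<noteq> 0 \<Longrightarrow> j = c" for j
      using bounds[rule_format, of 2 j] level by (simp add: a_c_def)
    show "b 1 j \<noteq> 0 \<Longrightarrow> a < j \<and> j < c"
      using bounds[rule_format, of 1 j] lo hi by auto
    have "gens (b 0) = Pair a ` {..<b 0 a}" "gens (b 2) = Pair c ` {..<b 2 c}"
      by (rule gens_single_degree; rule b0 b2; assumption)+
    then show "card (gens (b 0)) = b 0 a" "card (gens (b 2)) = b 2 c"
      by (simp_all add: card_image inj_on_def)
  qed
  have P_mod: "P g" if "g \<in> B_mod TYPE(('k, 'v) mpol) 2 dl du" for g
    using that
  proof (rule B_mod_resolution)
    fix b and \<phi> :: "nat \<Rightarrow> (int \<times> nat \<Rightarrow> ('k, 'v) mpol) \<Rightarrow> int \<times> nat \<Rightarrow> ('k, 'v) mpol"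
    assume g: "g = (\<lambda>i j. of_nat (b i j))" and fin: "\<And>i. finite {j. b i j \<noteq> 0}"
      and bounds: "\<And>i j. b i j \<noteq> 0 \<Longrightarrow> i \<le> 2 \<and> int (dl i) \<le> j \<and> j \<le> int (du i)"
      and \<phi>: "\<And>i. \<phi> i \<in> graded_hom (graded_free (b (Suc i))) (graded_free (b i))"
      and exact: "\<And>i x. x \<in> carrier (graded_free (b (Suc i))) \<Longrightarrow>
        \<phi> i x = (\<lambda>_. 0) \<longleftrightarrow> (\<exists>y\<in>carrier (graded_free (b (Suc (Suc i)))). x = \<phi> (Suc i) y)"
      and minimal: "\<And>i x e. x \<in> carrier (graded_free (b (Suc i))) \<Longrightarrow> \<phi> i x e \<in> irrelevant_ideal"
    have "\<forall>i j. b i j \<noteq> 0 \<longrightarrow> i \<le> 2 \<and> int (dl i) \<le> j \<and> j \<le> int (du i)"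
      using bounds by blast
    note counts = counts[of b, OF fin this]
    have triv: "carrier (graded_free (b 3)) = {\<lambda>_. 0 :: ('k, 'v) mpol}"
      using bounds[of 3] by (intro carrier_graded_free_trivial) fastforce
    have \<phi>0: "\<phi> 0 \<in> graded_hom (graded_free (b 1)) (graded_free (b 0))"
      and \<phi>1: "\<phi> 1 \<in> graded_hom (graded_free (b 2)) (graded_free (b 1))"
      using \<phi>[of 0] \<phi>[of 1] by (simp_all add: numeral_2_eq_2)
    have exact0: "\<phi> 0 x = (\<lambda>_. 0) \<longleftrightarrow> (\<exists>y\<in>carrier (graded_free (b 2)). x = \<phi> 1 y)"
      if "x \<in> carrier (graded_free (b 1))" for x
      using exact[of x 0] that by (simp add: numeral_2_eq_2)
    have inj: "y = (\<lambda>_. 0)" if "y \<in> carrier (graded_free (b 2))" "\<phi> 1 y = (\<lambda>_. 0)" for y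
      using exact[of y 1] that triv mod_hom_0[OF graded_hom_D(1)[OF \<phi>[of 2]]]
      by (simp add: numeral_2_eq_2 numeral_3_eq_3)
    have min0: "\<phi> 0 x e \<in> irrelevant_ideal" if "x \<in> carrier (graded_free (b 1))" for x e
      using minimal[of x 0] that by simp
    have "card (gens (b 1)) \<le> card (gens (b 2)) + card (gens (b 0))"
      by (rule rank_inequality[OF vars fin fin fin \<phi>0 \<phi>1 _ min0]) (use exact0 in blast)
    then have "(\<Sum>j\<in>I. b 1 j) \<le> b 2 c + b 0 a"
      by (simp only: counts)
    moreover have "nat (c - a) * b 2 c \<le> (\<Sum>e\<in>gens (b 1). nat (fst e - a))"
    proof (rule degree_inequality[OF vars fin fin fin _ _ _ ac \<phi>0 \<phi>1])
      show "\<phi> 0 (\<phi> 1 y) = (\<lambda>_. 0)" if "y \<in> carrier (graded_free (b 2))" for y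
        using exact0[OF mod_hom_closed[OF graded_hom_D(1)[OF \<phi>1] that]] that by blast
    qed (use counts(5-7) exact0 inj in \<open>auto simp: less_imp_le\<close>)
    then have "nat (c - a) * b 2 c \<le> (\<Sum>j\<in>I. nat (j - a) * b 1 j)"
      by (simp only: counts)
    ultimately show "P g"
      unfolding P_def g using bounds
      by (auto simp: of_nat_sum[symmetric] of_nat_mult[symmetric] of_nat_add[symmetric]
        simp del: of_nat_sum of_nat_mult of_nat_add)
  qed
  have "v \<in> rational_cone (B_mod TYPE(('k, 'v) mpol) 2 dl du)"
    using v by (simp add: B_N_def B_Q_def)
  then have "P v"
  proof (rule rational_cone_induct)
    show "P (\<lambda>_ _. 0)"
      by (simp add: P_def)
    fix r :: rat and g x
    assume "g \<in> B_mod TYPE(('k, 'v) mpol) 2 dl du" and r: "0 \<le> r" and x: "P x"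
    then have g: "P g"
      using P_mod by blast
    have "0 \<le> r * g i j + x i j" for i j
      using g x r by (simp add: P_def)
    moreover have "i \<le> 2 \<and> int (dl i) \<le> j \<and> j \<le> int (du i)" if "r * g i j + x i j \<noteq> 0" for i j
    proof -
      have "g i j \<noteq> 0 \<or> x i j \<noteq> 0"
        using that by auto
      then show ?thesis
        using g x unfolding P_def by blast
    qed
    moreover have "(\<Sum>j\<in>I. r * g 1 j + x 1 j) \<le> (r * g 2 c + x 2 c) + (r * g 0 a + x 0 a)"
    proof -
      have "(\<Sum>j\<in>I. r * g 1 j + x 1 j) = r * (\<Sum>j\<in>I. g 1 j) + (\<Sum>j\<in>I. x 1 j)"
        by (simp add: sum.distrib sum_distrib_left)
      also have "\<dots> \<le> r * (g 2 c + g 0 a) + (x 2 c + x 0 a)"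
        using g x r by (intro add_mono mult_left_mono) (simp_all add: P_def)
      finally show ?thesis
        by (simp add: algebra_simps)
    qed
    moreover have "of_nat (nat (c - a)) * (r * g 2 c + x 2 c)
        \<le> (\<Sum>j\<in>I. of_nat (nat (j - a)) * (r * g 1 j + x 1 j))"
    proof -
      have "of_nat (nat (c - a)) * (r * g 2 c + x 2 c)
          = r * (of_nat (nat (c - a)) * g 2 c) + of_nat (nat (c - a)) * x 2 c"
        by (simp add: algebra_simps)
      also have "\<dots> \<le> r * (\<Sum>j\<in>I. of_nat (nat (j - a)) * g 1 j) + (\<Sum>j\<in>I. of_nat (nat (j - a)) * x 1 j)"
        using g x r by (intro add_mono mult_left_mono) (simp_all add: P_def)
      also have "\<dots> = (\<Sum>j\<in>I. of_nat (nat (j - a)) * (r * g 1 j + x 1 j))"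
        by (simp add: sum_distrib_left distrib_left sum.distrib mult_ac)
      finally show ?thesis .
    qed
    ultimately show "P (\<lambda>i j. r * g i j + x i j)"
      unfolding P_def by blast
  qed
  then have nonneg: "\<And>i j. 0 \<le> v i j"
    and supp: "\<And>i j. v i j \<noteq> 0 \<Longrightarrow> i \<le> 2 \<and> int (dl i) \<le> j \<and> j \<le> int (du i)"
    and rank: "(\<Sum>j\<in>I. v 1 j) \<le> v 2 c + v 0 a"
    and degree: "of_nat (nat (c - a)) * v 2 c \<le> (\<Sum>j\<in>I. of_nat (nat (j - a)) * v 1 j)"
    unfolding P_def by blast+
  obtain b where b: "v = (\<lambda>i j. of_nat (b i j))"
    using integral_diagram[of v] v nonneg unfolding B_N_def by blast
  have bounds: "i \<le> 2 \<and> int (dl i) \<le> j \<and> j \<le> int (du i)" if "b i j \<noteq> 0" for i j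
    using supp[of i j] that by (simp add: b)
  have fin: "finite {j. b i j \<noteq> 0}" for i
    by (rule finite_subset[of _ "{int (dl i)..int (du i)}"]) (use bounds in auto)
  have "\<forall>i j. b i j \<noteq> 0 \<longrightarrow> i \<le> 2 \<and> int (dl i) \<le> j \<and> j \<le> int (du i)"
    using bounds by blast
  note counts = counts[of b, OF fin this]
  have "of_nat (\<Sum>j\<in>I. b 1 j) \<le> (of_nat (b 2 c + b 0 a) :: rat)"
    using rank by (simp add: b)
  then have rank: "card (gens (b 1)) \<le> b 2 c + b 0 a"
    unfolding counts(1) of_nat_le_iff .
  have "of_nat (nat (c - a) * b 2 c) \<le> (of_nat (\<Sum>j\<in>I. nat (j - a) * b 1 j) :: rat)"
    using degree by (simp add: b)
  then have degree: "nat (c - a) * b 2 c \<le> (\<Sum>e\<in>gens (b 1). nat (fst e - a))"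
    unfolding counts(2) of_nat_le_iff .
  show "v \<in> B_mod TYPE(('k, 'v) mpol) 2 dl du"
    unfolding b
    by (rule level_in_B_mod[where b = b and a = a and c = c])
      (fact vars fin bounds counts(5-7) ac rank degree)+
qed

theorem proposition1p4:
  shows "(\<forall>dl du. degree_sequence 1 dl \<longrightarrow> degree_sequence 1 du \<longrightarrow> (\<forall>i\<le>1. dl i \<le> du i) \<longrightarrow>
            B_N TYPE(('k::field, 1) mpol) 1 dl du = B_mod TYPE(('k, 1) mpol) 1 dl du) \<and>
         (\<forall>dl du. degree_sequence 2 dl \<longrightarrow> degree_sequence 2 du \<longrightarrow> (\<forall>i\<le>2. dl i \<le> du i) \<longrightarrow>
            dl 0 = du 0 \<longrightarrow> dl 2 = du 2 \<longrightarrow>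
            B_N TYPE(('k, 2) mpol) 2 dl du = B_mod TYPE(('k, 2) mpol) 2 dl du)"
proof (intro conjI allI impI)
  fix dl du
  have "UNIV = {1 :: 1}"
    by auto
  then show "B_N TYPE(('k, 1) mpol) 1 dl du = B_mod TYPE(('k, 1) mpol) 1 dl du"
    by (rule one_variable)
next
  fix dl du
  assume "degree_sequence 2 dl" "degree_sequence 2 du" "dl 0 = du 0" "dl 2 = du 2"
  moreover obtain vx vy :: 2 where "UNIV = {vx, vy}" "vx \<noteq> vy"
    using card_2_iff[of "UNIV :: 2 set"] by auto
  ultimately show "B_N TYPE(('k, 2) mpol) 2 dl du = B_mod TYPE(('k, 2) mpol) 2 dl du"
    by (intro two_variables_level)
qed

end
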